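(* Let $T$ be a complete simple theory, let $(p_w(x_w))_{w\in W}$ be an amalgamation system over a set of parameters $A$, and let $C\subseteq A$ be such that for every $w\in W$ the type $p_w$ does not fork over $C$. Then $(p_w(x_w)\upharpoonright C)_{w\in W}$ is an amalgamation system over $C$.
   Context: Independence is nonforking independence. For finite $W\subseteq\mathfrak{P}(\mathbb{N})$ closed under subsets, a $W$-amalgamation system over $C$ is a family $(p_w(x_w))_{w\in W}$ of complete types over $C$ such that: (1) for distinct variables $y,z$ in $x_w$, $p_w\vdash y\ne z$; (2) $x_v\cap x_w=x_{v\cap w}$ for all $v,w\in W$ and $p_w\upharpoonright x_v=p_v$ whenever $v\subseteq w$; (3) for any realization $b_w$ of $p_w$, with $b_i=b_w\upharpoonright x_{\{i\}}$ for $i\in w$, the family $(b_i)_{i\in w}$ is independent over $C$ and $b_w$ is algebraic over $C\cup\{b_i:i\in w\}$. $p\upharpoonright C$ denotes the restriction of a type to parameters in $C$. *)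

theory Defs
  imports Main "HOL-Library.Infinite_Typeclass"
begin

unbundle cardinal_syntax

section \<open>First-order logic with parameters\<close>

text \<open>The type parameter \<open>'v\<close> of a language is a phantom: it is the type of the variables.\<close>

datatype ('f, 'r, 'v) language = Language
  (fun_syms: "'f set")
  (fun_arity: "'f \<Rightarrow> nat")
  (rel_syms: "'r set")
  (rel_arity: "'r \<Rightarrow> nat")

text \<open>The universe of a structure is the whole type \<open>'a\<close>.\<close>

record ('f, 'r, 'a) struc =
  int_fun :: "'f \<Rightarrow> 'a list \<Rightarrow> 'a"
  int_rel :: "'r \<Rightarrow> 'a list \<Rightarrow> bool"

text \<open>\<open>Par a\<close> is the constant symbol that names the element \<open>a\<close> of the universe.\<close>

datatype (trm_funs: 'f, trm_vars: 'v, trm_params: 'a) trm =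
    Var 'v
  | Par 'a
  | Fn 'f "('f, 'v, 'a) trm list"

datatype (fm_funs: 'f, fm_rels: 'r, fm_vars: 'v, fm_params: 'a) fm =
    Eq "('f, 'v, 'a) trm" "('f, 'v, 'a) trm"
  | Rel 'r "('f, 'v, 'a) trm list"
  | Neg "('f, 'r, 'v, 'a) fm"
  | Conj "('f, 'r, 'v, 'a) fm" "('f, 'r, 'v, 'a) fm"
  | Ex 'v "('f, 'r, 'v, 'a) fm"

primrec wf_trm :: "('f, 'r, 'v) language \<Rightarrow> ('f, 'v, 'a) trm \<Rightarrow> bool" where
  "wf_trm L (Var v) \<longleftrightarrow> True"
| "wf_trm L (Par a) \<longleftrightarrow> True"
| "wf_trm L (Fn f ts) \<longleftrightarrow>
     f \<in> fun_syms L \<and> length ts = fun_arity L f \<and> (\<forall>b\<in>set (map (wf_trm L) ts). b)"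

primrec wf_fm :: "('f, 'r, 'v) language \<Rightarrow> ('f, 'r, 'v, 'a) fm \<Rightarrow> bool" where
  "wf_fm L (Eq s t) \<longleftrightarrow> wf_trm L s \<and> wf_trm L t"
| "wf_fm L (Rel r ts) \<longleftrightarrow>
     r \<in> rel_syms L \<and> length ts = rel_arity L r \<and> (\<forall>t\<in>set ts. wf_trm L t)"
| "wf_fm L (Neg \<phi>) \<longleftrightarrow> wf_fm L \<phi>"
| "wf_fm L (Conj \<phi> \<psi>) \<longleftrightarrow> wf_fm L \<phi> \<and> wf_fm L \<psi>"
| "wf_fm L (Ex v \<phi>) \<longleftrightarrow> wf_fm L \<phi>"

primrec fv :: "('f, 'r, 'v, 'a) fm \<Rightarrow> 'v set" where
  "fv (Eq s t) = trm_vars s \<union> trm_vars t"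
| "fv (Rel r ts) = (\<Union>t\<in>set ts. trm_vars t)"
| "fv (Neg \<phi>) = fv \<phi>"
| "fv (Conj \<phi> \<psi>) = fv \<phi> \<union> fv \<psi>"
| "fv (Ex v \<phi>) = fv \<phi> - {v}"

primrec val :: "('f, 'r, 'a) struc \<Rightarrow> ('v \<Rightarrow> 'a) \<Rightarrow> ('f, 'v, 'a) trm \<Rightarrow> 'a" where
  "val M e (Var v) = e v"
| "val M e (Par a) = a"
| "val M e (Fn f ts) = int_fun M f (map (val M e) ts)"

primrec sat :: "('f, 'r, 'a) struc \<Rightarrow> ('v \<Rightarrow> 'a) \<Rightarrow> ('f, 'r, 'v, 'a) fm \<Rightarrow> bool" where
  "sat M e (Eq s t) \<longleftrightarrow> val M e s = val M e t"
| "sat M e (Rel r ts) \<longleftrightarrow> int_rel M r (map (val M e) ts)"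
| "sat M e (Neg \<phi>) \<longleftrightarrow> \<not> sat M e \<phi>"
| "sat M e (Conj \<phi> \<psi>) \<longleftrightarrow> sat M e \<phi> \<and> sat M e \<psi>"
| "sat M e (Ex v \<phi>) \<longleftrightarrow> (\<exists>a. sat M (e(v := a)) \<phi>)"

text \<open>The formulas of \<open>L(D)\<close> with free variables in \<open>X\<close>.\<close>

definition fms :: "('f, 'r, 'v) language \<Rightarrow> 'a set \<Rightarrow> 'v set \<Rightarrow> ('f, 'r, 'v, 'a) fm set" where
  "fms L D X = {\<phi>. wf_fm L \<phi> \<and> fm_params \<phi> \<subseteq> D \<and> fv \<phi> \<subseteq> X}"

definition rename_params :: "('a \<Rightarrow> 'a) \<Rightarrow> ('f, 'r, 'v, 'a) fm \<Rightarrow> ('f, 'r, 'v, 'a) fm" where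
  "rename_params h = map_fm id id id h"

section \<open>Complete theories and monster models\<close>

text \<open>A theory is identified with its deductive closure.  Consistency is not included here;
  it will come from the existence of a model.\<close>

definition complete_theory :: "('f, 'r, 'v) language \<Rightarrow> ('f, 'r, 'v, 'a) fm set \<Rightarrow> bool" where
  "complete_theory L T \<longleftrightarrow>
     T \<subseteq> fms L {} {} \<and> (\<forall>\<sigma>\<in>fms L {} {}. \<sigma> \<in> T \<or> Neg \<sigma> \<in> T)"

definition models :: "('f, 'r, 'a) struc \<Rightarrow> ('f, 'r, 'v, 'a) fm set \<Rightarrow> bool" where
  "models M T \<longleftrightarrow> (\<forall>\<sigma>\<in>T. \<forall>e. sat M e \<sigma>)"

text \<open>Consistency with the elementary diagram of \<open>M\<close>.\<close>

definition consistent :: "('f, 'r, 'a) struc \<Rightarrow> ('f, 'r, 'v, 'a) fm set \<Rightarrow> bool" where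
  "consistent M \<Sigma> \<longleftrightarrow> (\<forall>F\<subseteq>\<Sigma>. finite F \<longrightarrow> (\<exists>e. \<forall>\<phi>\<in>F. sat M e \<phi>))"

text \<open>\<open>\<Sigma> \<turnstile> \<Or>\<Psi>\<close> modulo the elementary diagram of \<open>M\<close>, for a finite set \<open>\<Psi>\<close>.\<close>

definition entails_disj ::
  "('f, 'r, 'a) struc \<Rightarrow> ('f, 'r, 'v, 'a) fm set \<Rightarrow> ('f, 'r, 'v, 'a) fm set \<Rightarrow> bool" where
  "entails_disj M \<Sigma> \<Psi> \<longleftrightarrow>
     (\<exists>F\<subseteq>\<Sigma>. finite F \<and> (\<forall>e. (\<forall>\<phi>\<in>F. sat M e \<phi>) \<longrightarrow> (\<exists>\<psi>\<in>\<Psi>. sat M e \<psi>)))"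

definition elementary_map ::
  "('f, 'r, 'v) language \<Rightarrow> ('f, 'r, 'a) struc \<Rightarrow> 'a set \<Rightarrow> ('a \<Rightarrow> 'a) \<Rightarrow> bool" where
  "elementary_map L M D h \<longleftrightarrow>
     (\<forall>\<phi>\<in>fms L D {}. \<forall>e. sat M e (rename_params h \<phi>) \<longleftrightarrow> sat M e \<phi>)"

definition automorphism ::
  "('f, 'r, 'v) language \<Rightarrow> ('f, 'r, 'a) struc \<Rightarrow> ('a \<Rightarrow> 'a) \<Rightarrow> bool" where
  "automorphism L M g \<longleftrightarrow> bij g \<and>
     (\<forall>f\<in>fun_syms L. \<forall>as. length as = fun_arity L f \<longrightarrow>
        g (int_fun M f as) = int_fun M f (map g as)) \<and>
     (\<forall>r\<in>rel_syms L. \<forall>as. length as = rel_arity L r \<longrightarrow>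
        (int_rel M r (map g as) \<longleftrightarrow> int_rel M r as))"

definition saturated ::
  "('f, 'r, 'v) language \<Rightarrow> 'k rel \<Rightarrow> ('f, 'r, 'a) struc \<Rightarrow> bool" where
  "saturated L \<kappa> M \<longleftrightarrow>
     (\<forall>D v p. |D| <o \<kappa> \<and> p \<subseteq> fms L D {v} \<and> consistent M p \<longrightarrow> (\<exists>e. \<forall>\<phi>\<in>p. sat M e \<phi>))"

definition strongly_homogeneous ::
  "('f, 'r, 'v) language \<Rightarrow> 'k rel \<Rightarrow> ('f, 'r, 'a) struc \<Rightarrow> bool" where
  "strongly_homogeneous L \<kappa> M \<longleftrightarrow>
     (\<forall>D h. |D| <o \<kappa> \<and> elementary_map L M D h \<longrightarrow>
        (\<exists>g. automorphism L M g \<and> (\<forall>d\<in>D. g d = h d)))"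

definition monster_model ::
  "('f, 'r, 'v) language \<Rightarrow> ('f, 'r, 'v, 'a) fm set \<Rightarrow> 'k rel \<Rightarrow> ('f, 'r, 'a) struc \<Rightarrow> bool" where
  "monster_model L T \<kappa> M \<longleftrightarrow>
     Card_order \<kappa> \<and> natLeq <o \<kappa> \<and> |fun_syms L| <o \<kappa> \<and> |rel_syms L| <o \<kappa> \<and>
     models M T \<and> saturated L \<kappa> M \<and> strongly_homogeneous L \<kappa> M"

section \<open>Simplicity\<close>

definition k_inconsistent :: "nat \<Rightarrow> (nat \<Rightarrow> 'e \<Rightarrow> bool) \<Rightarrow> bool" where
  "k_inconsistent k P \<longleftrightarrow> (\<forall>I. finite I \<and> card I = k \<longrightarrow> \<not> (\<exists>e. \<forall>i\<in>I. P i e))"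

text \<open>The formula \<open>\<phi>\<close> is read as \<open>\<phi>(x,y)\<close>, where the variables in \<open>X\<close> form \<open>x\<close> and all others
  form \<open>y\<close>.  The tree of parameters is \<open>b\<close>; \<open>override_on (b s) e X\<close> assigns \<open>e\<close> to \<open>x\<close> and
  \<open>b s\<close> to \<open>y\<close>.\<close>

definition tree_property :: "('f, 'r, 'a) struc \<Rightarrow> ('f, 'r, 'v, 'a) fm \<Rightarrow> 'v set \<Rightarrow> bool" where
  "tree_property M \<phi> X \<longleftrightarrow> (\<exists>k. \<exists>b :: nat list \<Rightarrow> 'v \<Rightarrow> 'a.
     (\<forall>\<eta> :: nat \<Rightarrow> nat. \<forall>N. finite N \<longrightarrow>
        (\<exists>e. \<forall>n\<in>N. sat M (override_on (b (map \<eta> [0..<n])) e X) \<phi>)) \<and>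
     (\<forall>s. k_inconsistent k (\<lambda>i e. sat M (override_on (b (s @ [i])) e X) \<phi>)))"

text \<open>Only models with universe \<open>'a\<close> are inspected.  If \<open>T\<close> is complete and has an
  \<open>\<aleph>\<^sub>1\<close>-saturated model with universe \<open>'a\<close>, as it does below, this loses nothing: by compactness
  a tree in any model of \<open>T\<close> yields a tree in that one.\<close>

definition simple_theory :: "('f, 'r, 'v) language \<Rightarrow> ('f, 'r, 'v, 'a) fm set \<Rightarrow> bool" where
  "simple_theory L T \<longleftrightarrow>
     (\<forall>M. models M T \<longrightarrow> (\<forall>\<phi>\<in>fms L {} UNIV. \<forall>X. \<not> tree_property M \<phi> X))"

section \<open>Types, forking, independence\<close>

definition complete_type ::
  "('f, 'r, 'v) language \<Rightarrow> ('f, 'r, 'a) struc \<Rightarrow> 'a set \<Rightarrow> 'v set \<Rightarrow>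
   ('f, 'r, 'v, 'a) fm set \<Rightarrow> bool" where
  "complete_type L M D X p \<longleftrightarrow>
     p \<subseteq> fms L D X \<and> consistent M p \<and> (\<forall>\<phi>\<in>fms L D X. \<phi> \<in> p \<or> Neg \<phi> \<in> p)"

definition tp ::
  "('f, 'r, 'v) language \<Rightarrow> ('f, 'r, 'a) struc \<Rightarrow> 'a set \<Rightarrow> 'v set \<Rightarrow> ('v \<Rightarrow> 'a) \<Rightarrow>
   ('f, 'r, 'v, 'a) fm set" where
  "tp L M D X b = {\<phi> \<in> fms L D X. sat M b \<phi>}"

definition restrict_vars ::
  "'v set \<Rightarrow> ('f, 'r, 'v, 'a) fm set \<Rightarrow> ('f, 'r, 'v, 'a) fm set" where
  "restrict_vars X p = {\<phi> \<in> p. fv \<phi> \<subseteq> X}"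

definition restrict_params ::
  "'a set \<Rightarrow> ('f, 'r, 'v, 'a) fm set \<Rightarrow> ('f, 'r, 'v, 'a) fm set" where
  "restrict_params C p = {\<phi> \<in> p. fm_params \<phi> \<subseteq> C}"

text \<open>Write \<open>\<phi>\<close> as \<open>\<phi>(x,b)\<close> where \<open>b\<close> enumerates the parameters of \<open>\<phi>\<close>.  A tuple \<open>b'\<close> with
  \<open>b' \<equiv>\<^sub>C b\<close> is the same thing as an elementary map on \<open>C \<union> b\<close> that fixes \<open>C\<close> pointwise and
  sends \<open>b\<close> to \<open>b'\<close>; the sequence \<open>h\<close> below thus encodes the sequence of conjugates of \<open>b\<close>.\<close>

definition divides ::
  "('f, 'r, 'v) language \<Rightarrow> ('f, 'r, 'a) struc \<Rightarrow> 'a set \<Rightarrow> ('f, 'r, 'v, 'a) fm \<Rightarrow> bool" where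
  "divides L M C \<phi> \<longleftrightarrow> (\<exists>k. \<exists>h :: nat \<Rightarrow> 'a \<Rightarrow> 'a.
     (\<forall>i. elementary_map L M (C \<union> fm_params \<phi>) (h i) \<and> (\<forall>c\<in>C. h i c = c)) \<and>
     k_inconsistent k (\<lambda>i e. sat M e (rename_params (h i) \<phi>)))"

definition forks ::
  "('f, 'r, 'v) language \<Rightarrow> ('f, 'r, 'a) struc \<Rightarrow> 'a set \<Rightarrow> 'v set \<Rightarrow>
   ('f, 'r, 'v, 'a) fm set \<Rightarrow> bool" where
  "forks L M C X p \<longleftrightarrow>
     (\<exists>\<Psi>. finite \<Psi> \<and> \<Psi> \<subseteq> fms L UNIV X \<and> (\<forall>\<psi>\<in>\<Psi>. divides L M C \<psi>) \<and> entails_disj M p \<Psi>)"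

text \<open>Independence over \<open>C\<close> of the family of tuples \<open>(b \<upharpoonright> X i)\<close>, \<open>i \<in> I\<close>.\<close>

definition independent_family ::
  "('f, 'r, 'v) language \<Rightarrow> ('f, 'r, 'a) struc \<Rightarrow> 'a set \<Rightarrow> 'i set \<Rightarrow> ('i \<Rightarrow> 'v set) \<Rightarrow>
   ('v \<Rightarrow> 'a) \<Rightarrow> bool" where
  "independent_family L M C I X b \<longleftrightarrow>
     (\<forall>i\<in>I. \<not> forks L M C (X i) (tp L M (C \<union> (\<Union>j\<in>I - {i}. b ` X j)) (X i) b))"

definition acl :: "('f, 'r, 'v) language \<Rightarrow> ('f, 'r, 'a) struc \<Rightarrow> 'a set \<Rightarrow> 'a set" where
  "acl L M D = {a. \<exists>v. \<exists>\<phi>\<in>fms L D {v}. finite {e v |e. sat M e \<phi>} \<and> a \<in> {e v |e. sat M e \<phi>}}"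

section \<open>Amalgamation systems\<close>

definition amalgamation_system ::
  "('f, 'r, 'v) language \<Rightarrow> ('f, 'r, 'a) struc \<Rightarrow> 'a set \<Rightarrow> nat set set \<Rightarrow>
   (nat set \<Rightarrow> 'v set) \<Rightarrow> (nat set \<Rightarrow> ('f, 'r, 'v, 'a) fm set) \<Rightarrow> bool" where
  "amalgamation_system L M C W x p \<longleftrightarrow>
     finite W \<and> (\<forall>w\<in>W. \<forall>v\<subseteq>w. v \<in> W) \<and>
     (\<forall>w\<in>W. complete_type L M C (x w) (p w)) \<and>
     (\<forall>w\<in>W. \<forall>y\<in>x w. \<forall>z\<in>x w. y \<noteq> z \<longrightarrow> entails_disj M (p w) {Neg (Eq (Var y) (Var z))}) \<and>
     (\<forall>v\<in>W. \<forall>w\<in>W. x v \<inter> x w = x (v \<inter> w)) \<and>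
     (\<forall>v\<in>W. \<forall>w\<in>W. v \<subseteq> w \<longrightarrow> restrict_vars (x v) (p w) = p v) \<and>
     (\<forall>w\<in>W. \<forall>b. (\<forall>\<phi>\<in>p w. sat M b \<phi>) \<longrightarrow>
        independent_family L M C w (\<lambda>i. x {i}) b \<and>
        b ` x w \<subseteq> acl L M (C \<union> (\<Union>i\<in>w. b ` x {i})))"

end

theory Submission
  imports Defs "HOL-Library.Countable" "HOL-Library.Infinite_Set"
begin

text \<open>
  Realize \<open>p\<^sub>w\<close> by \<open>b\<close>; by homogeneity it suffices to treat this realization of \<open>p\<^sub>w \<restriction> C\<close>.  Since
  \<open>tp(b/A)\<close> does not fork over \<open>C\<close> and the \<open>b\<^sub>i\<close> are independent over \<open>A\<close>, transitivity of nonforking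
  makes them independent over \<open>C\<close>.  By symmetry \<open>tp(A/Cb)\<close> does not divide over \<open>C \<union> {b\<^sub>i}\<close>, and then an
  element of \<open>b\<close> that is algebraic over \<open>A \<union> {b\<^sub>i}\<close> cannot have infinitely many conjugates over
  \<open>C \<union> {b\<^sub>i}\<close>.

  Symmetry and transitivity are derived from the absence of the tree property without
  indiscernible sequences.  The key step is that a formula over \<open>D \<union> b\<close> dividing over \<open>D\<close> still divides, with
  the same \<open>k\<close>, over \<open>D \<union> a\<close> whenever \<open>tp(a/Db)\<close> does not divide over \<open>D\<close>.  Hence along a
  sequence in which every \<open>a\<^sub>i\<close> is free from its predecessors over \<open>C\<close>, formulas \<open>\<psi>(x,a\<^sub>i)\<close> that divide over
  \<open>C\<close> and have a common solution give trees of arbitrary finite height.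
\<close>

section \<open>Substitution and automorphisms\<close>

text \<open>Formulas are replaced throughout by the relations on finite lists that they define, and
  conjugate parameters by automorphisms acting on the points; variable names and parameters are then
  dealt with once, in the closure properties of \<open>Def\<close>. Forking is defined through
  covers by dividing formulas, so building free sequences presupposes that a type does not fork over
  its own domain. This already uses simplicity: the rank \<open>rk\<close> is bounded, since
  unbounded rank gives the tree property, and a set of maximal rank invariant over the base cannot
  be covered by dividing ones. The same bound shows that forking sets divide. Hence
  \<open>dnd\<close> and \<open>dnf\<close> coincide over small sets, which is indispensable because
  preservation of dividing is a statement about \<open>dnd\<close> while independence is one about
  \<open>dnf\<close>. The types may have infinitely many variables, whereas homogeneity is used for
  finite tuples; so all notions are developed for finite tuples, and at the end each finite tuple
  receives an automorphism of its own.\<close>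

primrec subst_trm :: "('v \<Rightarrow> ('f,'w,'a) trm) \<Rightarrow> ('b \<Rightarrow> ('f,'w,'a) trm) \<Rightarrow> ('f,'v,'b) trm \<Rightarrow> ('f,'w,'a) trm" where
  "subst_trm \<tau> \<rho> (Var v) = \<tau> v"
| "subst_trm \<tau> \<rho> (Par a) = \<rho> a"
| "subst_trm \<tau> \<rho> (Fn f ts) = Fn f (map (subst_trm \<tau> \<rho>) ts)"

lemma val_subst_trm:
  "val M e (subst_trm \<tau> \<rho> t) = val M (\<lambda>v. val M e (\<tau> v)) (map_trm id id (\<lambda>a. val M e (\<rho> a)) t)"
proof (induction t)
  case (Fn f ts)
  then show ?case by (auto intro!: arg_cong[of _ _ "int_fun M f"])
qed auto

lemma wf_subst_trm:
  assumes "wf_trm L t" "\<And>v. wf_trm L (\<tau> v)" "\<And>a. wf_trm L (\<rho> a)"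
  shows "wf_trm L (subst_trm \<tau> \<rho> t)"
  using assms(1) by (induction t) (auto simp: assms)

lemma vars_subst_trm:
  "trm_vars (subst_trm \<tau> \<rho> t) = (\<Union>v\<in>trm_vars t. trm_vars (\<tau> v)) \<union> (\<Union>a\<in>trm_params t. trm_vars (\<rho> a))"
  by (induction t) auto

lemma params_subst_trm:
  "trm_params (subst_trm \<tau> \<rho> t) = (\<Union>v\<in>trm_vars t. trm_params (\<tau> v)) \<union> (\<Union>a\<in>trm_params t. trm_params (\<rho> a))"
  by (induction t) auto

lemma finite_trm_vars [simp]: "finite (trm_vars t)"
  by (induction t) auto

lemma finite_trm_params [simp]: "finite (trm_params t)"
  by (induction t) auto

lemma finite_fv [simp]: "finite (fv \<phi>)"
  by (induction \<phi>) auto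

lemma finite_fm_params [simp]: "finite (fm_params \<phi>)"
  by (induction \<phi>) auto

lemma val_cong:
  assumes "\<And>v. v \<in> trm_vars t \<Longrightarrow> e v = e' v"
  shows "val M e t = val M e' t"
  using assms
proof (induction t)
  case (Fn f ts)
  then have "map (val M e) ts = map (val M e') ts"
    by (fastforce intro!: map_cong)
  then show ?case by (simp del: map_eq_conv)
qed auto

lemma sat_cong:
  assumes "\<And>v. v \<in> fv \<phi> \<Longrightarrow> e v = e' v"
  shows "sat M e \<phi> \<longleftrightarrow> sat M e' \<phi>"
  using assms
proof (induction \<phi> arbitrary: e e')
  case (Eq s t)
  then show ?case using val_cong[of s e e' M] val_cong[of t e e' M] by auto
next
  case (Rel r ts)
  then have "map (val M e) ts = map (val M e') ts"
    by (fastforce intro!: map_cong val_cong)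
  then show ?case by (simp del: map_eq_conv)
next
  case (Conj \<phi> \<psi>)
  from Conj.IH(1)[of e e'] Conj.IH(2)[of e e'] Conj.prems show ?case by auto
next
  case (Ex v \<phi>)
  have "sat M (e(v := a)) \<phi> \<longleftrightarrow> sat M (e'(v := a)) \<phi>" for a
    using Ex.prems by (intro Ex.IH) auto
  then show ?case by simp
next
  case (Neg \<phi>)
  from Neg.IH[of e e'] Neg.prems show ?case by auto
qed

lemma fv_rename_params [simp]: "fv (rename_params h \<phi>) = fv \<phi>"
  unfolding rename_params_def by (induction \<phi>) (auto simp: trm.set_map)

lemma rename_params_cong:
  "(\<And>a. a \<in> fm_params \<phi> \<Longrightarrow> h a = h' a) \<Longrightarrow> rename_params h \<phi> = rename_params h' \<phi>"
  unfolding rename_params_def by (intro fm.map_cong) auto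

text \<open>Free variables and parameters are substituted simultaneously, so that parameters can be
  turned into variables and back.\<close>

lemma fm_subst:
  fixes L :: "('f, 'r, 'v :: infinite) language" and \<phi> :: "('f,'r,'v,'a) fm"
  assumes "wf_fm L \<phi>" "\<And>v. wf_trm L (\<tau> v)" "\<And>a. wf_trm L (\<rho> a)"
  shows "\<exists>\<phi>'. wf_fm L \<phi>' \<and>
    fv \<phi>' \<subseteq> (\<Union>v\<in>fv \<phi>. trm_vars (\<tau> v)) \<union> (\<Union>a\<in>fm_params \<phi>. trm_vars (\<rho> a)) \<and>
    fm_params \<phi>' \<subseteq> (\<Union>v\<in>fv \<phi>. trm_params (\<tau> v)) \<union> (\<Union>a\<in>fm_params \<phi>. trm_params (\<rho> a)) \<and>
    (\<forall>e. sat M e \<phi>' \<longleftrightarrow> sat M (\<lambda>v. val M e (\<tau> v)) (rename_params (\<lambda>a. val M e (\<rho> a)) \<phi>))"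
  using assms(1,2)
proof (induction \<phi> arbitrary: \<tau>)
  case (Eq s t)
  then show ?case
    by (intro exI[of _ "Eq (subst_trm \<tau> \<rho> s) (subst_trm \<tau> \<rho> t)"])
      (auto simp: wf_subst_trm assms(3) vars_subst_trm params_subst_trm val_subst_trm rename_params_def)
next
  case (Rel r ts)
  then show ?case
    by (intro exI[of _ "Rel r (map (subst_trm \<tau> \<rho>) ts)"])
      (auto simp: wf_subst_trm assms(3) vars_subst_trm params_subst_trm val_subst_trm rename_params_def
        comp_def)
next
  case (Neg \<phi>)
  from Neg.IH[of \<tau>] Neg.prems obtain \<phi>' where "wf_fm L \<phi>'"
    "fv \<phi>' \<subseteq> (\<Union>v\<in>fv \<phi>. trm_vars (\<tau> v)) \<union> (\<Union>a\<in>fm_params \<phi>. trm_vars (\<rho> a))"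
    "fm_params \<phi>' \<subseteq> (\<Union>v\<in>fv \<phi>. trm_params (\<tau> v)) \<union> (\<Union>a\<in>fm_params \<phi>. trm_params (\<rho> a))"
    "\<forall>e. sat M e \<phi>' \<longleftrightarrow> sat M (\<lambda>v. val M e (\<tau> v)) (rename_params (\<lambda>a. val M e (\<rho> a)) \<phi>)"
    by auto
  then show ?case
    by (intro exI[of _ "Neg \<phi>'"]) (auto simp: rename_params_def)
next
  case (Conj \<phi> \<psi>)
  from Conj.IH(1)[of \<tau>] Conj.prems obtain \<phi>' where "wf_fm L \<phi>'"
    "fv \<phi>' \<subseteq> (\<Union>v\<in>fv \<phi>. trm_vars (\<tau> v)) \<union> (\<Union>a\<in>fm_params \<phi>. trm_vars (\<rho> a))"
    "fm_params \<phi>' \<subseteq> (\<Union>v\<in>fv \<phi>. trm_params (\<tau> v)) \<union> (\<Union>a\<in>fm_params \<phi>. trm_params (\<rho> a))"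
    "\<forall>e. sat M e \<phi>' \<longleftrightarrow> sat M (\<lambda>v. val M e (\<tau> v)) (rename_params (\<lambda>a. val M e (\<rho> a)) \<phi>)"
    by auto
  moreover from Conj.IH(2)[of \<tau>] Conj.prems obtain \<psi>' where "wf_fm L \<psi>'"
    "fv \<psi>' \<subseteq> (\<Union>v\<in>fv \<psi>. trm_vars (\<tau> v)) \<union> (\<Union>a\<in>fm_params \<psi>. trm_vars (\<rho> a))"
    "fm_params \<psi>' \<subseteq> (\<Union>v\<in>fv \<psi>. trm_params (\<tau> v)) \<union> (\<Union>a\<in>fm_params \<psi>. trm_params (\<rho> a))"
    "\<forall>e. sat M e \<psi>' \<longleftrightarrow> sat M (\<lambda>v. val M e (\<tau> v)) (rename_params (\<lambda>a. val M e (\<rho> a)) \<psi>)"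
    by auto
  ultimately show ?case
    by (intro exI[of _ "Conj \<phi>' \<psi>'"]) (auto simp: rename_params_def)
next
  case (Ex v \<phi>)
  let ?V = "(\<Union>u\<in>fv \<phi>. trm_vars (\<tau> u)) \<union> (\<Union>a\<in>fm_params \<phi>. trm_vars (\<rho> a))"
  have "finite ?V" by auto
  \<comment> \<open>The bound variable is replaced by one that occurs in none of the substituted
    terms, which prevents capture. Infinity of the type of variables supplies it;
    \<open>\<tau>\<close> is arbitrary in the induction so that it can be updated at
    \<open>v\<close>.\<close>
  then obtain v' where v': "v' \<notin> ?V"
    using ex_new_if_finite[OF infinite_UNIV] by blast
  let ?\<tau> = "\<tau>(v := Var v')"
  have "wf_fm L \<phi>" "\<And>u. wf_trm L (?\<tau> u)" using Ex.prems by auto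
  from Ex.IH[of ?\<tau>, OF this] obtain \<phi>' where \<phi>': "wf_fm L \<phi>'"
    "fv \<phi>' \<subseteq> (\<Union>u\<in>fv \<phi>. trm_vars (?\<tau> u)) \<union> (\<Union>a\<in>fm_params \<phi>. trm_vars (\<rho> a))"
    "fm_params \<phi>' \<subseteq> (\<Union>u\<in>fv \<phi>. trm_params (?\<tau> u)) \<union> (\<Union>a\<in>fm_params \<phi>. trm_params (\<rho> a))"
    "\<forall>e. sat M e \<phi>' \<longleftrightarrow> sat M (\<lambda>u. val M e (?\<tau> u)) (rename_params (\<lambda>a. val M e (\<rho> a)) \<phi>)"
    by (elim exE conjE)
  have "sat M (e(v' := a)) \<phi>' \<longleftrightarrow>
      sat M ((\<lambda>u. val M e (\<tau> u))(v := a)) (rename_params (\<lambda>a. val M e (\<rho> a)) \<phi>)" for e a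
  proof -
    have 1: "rename_params (\<lambda>b. val M (e(v' := a)) (\<rho> b)) \<phi> = rename_params (\<lambda>a. val M e (\<rho> a)) \<phi>"
      using v' by (intro rename_params_cong val_cong) auto
    show ?thesis unfolding \<phi>'(4)[rule_format] 1
    proof (rule sat_cong)
      fix u assume "u \<in> fv (rename_params (\<lambda>a. val M e (\<rho> a)) \<phi>)"
      then have u: "u \<in> fv \<phi>" by simp
      show "val M (e(v' := a)) (?\<tau> u) = ((\<lambda>u. val M e (\<tau> u))(v := a)) u"
      proof (cases "u = v")
        case False
        then show ?thesis using v' u by (auto intro!: val_cong)
      qed auto
    qed
  qed
  moreover have "fv (Ex v' \<phi>') \<subseteq> (\<Union>u\<in>fv (Ex v \<phi>). trm_vars (\<tau> u)) \<union> (\<Union>a\<in>fm_params (Ex v \<phi>). trm_vars (\<rho> a))"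
    using \<phi>'(2) by (fastforce split: if_splits)
  moreover have "fm_params (Ex v' \<phi>') \<subseteq> (\<Union>u\<in>fv (Ex v \<phi>). trm_params (\<tau> u)) \<union> (\<Union>a\<in>fm_params (Ex v \<phi>). trm_params (\<rho> a))"
    using \<phi>'(3) by (fastforce split: if_splits)
  ultimately show ?case using \<phi>'(1)
    by (intro exI[of _ "Ex v' \<phi>'"]) (simp add: rename_params_def)
qed

lemma val_automorphism:
  assumes "automorphism L M g" "wf_trm L t"
  shows "val M (g \<circ> e) (map_trm id id g t) = g (val M e t)"
  using assms(2)
proof (induction t)
  case (Fn f ts)
  have "val M (g \<circ> e) (map_trm id id g t) = g (val M e t)" if "t \<in> set ts" for t
    by (rule Fn.IH) (use that Fn.prems in auto)
  then have "map (\<lambda>t. val M (g \<circ> e) (map_trm id id g t)) ts = map (\<lambda>t. g (val M e t)) ts"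
    by (rule map_cong[OF refl])
  moreover have "g (int_fun M f (map (val M e) ts)) = int_fun M f (map g (map (val M e) ts))"
    using assms(1) Fn.prems unfolding automorphism_def by (auto simp del: map_map)
  ultimately show ?case by (simp add: comp_def id_def del: map_eq_conv)
qed auto

text \<open>Injectivity of \<open>g\<close> settles equations, and surjectivity allows every witness
  of an existential formula to be written as \<open>g a\<close>, so that quantifiers transfer in
  both directions.\<close>

lemma sat_automorphism:
  assumes g: "automorphism L M g" and "wf_fm L \<phi>"
  shows "sat M (g \<circ> e) (rename_params g \<phi>) \<longleftrightarrow> sat M e \<phi>"
  using assms(2)
proof (induction \<phi> arbitrary: e)
  case (Eq s t)
  have "inj g" using g unfolding automorphism_def bij_def by auto
  moreover have "val M (g \<circ> e) (map_trm id id g s) = g (val M e s)"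
    "val M (g \<circ> e) (map_trm id id g t) = g (val M e t)"
    using Eq val_automorphism[OF g] by (auto simp del: comp_apply)
  ultimately show ?case by (simp add: rename_params_def inj_eq del: comp_apply)
next
  case (Rel r ts)
  have "map (\<lambda>t. val M (g \<circ> e) (map_trm id id g t)) ts = map (\<lambda>t. g (val M e t)) ts"
    by (rule map_cong[OF refl], rule val_automorphism[OF g]) (use Rel in auto)
  moreover have "int_rel M r (map g (map (val M e) ts)) \<longleftrightarrow> int_rel M r (map (val M e) ts)"
    using g Rel unfolding automorphism_def by (auto simp del: map_map)
  ultimately show ?case by (simp add: rename_params_def comp_def id_def del: map_eq_conv)
next
  case (Ex v \<phi>)
  have s: "surj g" using g unfolding automorphism_def bij_def by auto
  have *: "sat M ((g \<circ> e)(v := g a)) (rename_params g \<phi>) \<longleftrightarrow> sat M (e(v := a)) \<phi>" for a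
  proof -
    have "(g \<circ> e)(v := g a) = g \<circ> e(v := a)" by auto
    then show ?thesis using Ex.IH[of "e(v := a)"] Ex.prems by (simp only: wf_fm.simps)
  qed
  have "(\<exists>a. sat M ((g \<circ> e)(v := a)) (rename_params g \<phi>)) \<longleftrightarrow> (\<exists>a. sat M (e(v := a)) \<phi>)"
  proof
    assume "\<exists>a. sat M ((g \<circ> e)(v := a)) (rename_params g \<phi>)"
    then obtain a where a: "sat M ((g \<circ> e)(v := a)) (rename_params g \<phi>)" by auto
    obtain a' where "a = g a'" using s by (metis surjD)
    then show "\<exists>a. sat M (e(v := a)) \<phi>" using a * by auto
  qed (use * in auto)
  then show ?case by (simp only: rename_params_def fm.map sat.simps id_apply)
qed (auto simp: rename_params_def)

lemma automorphism_inv: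
  assumes "automorphism L M g"
  shows "automorphism L M (inv g)"
proof -
  have b: "bij g" using assms unfolding automorphism_def by auto
  have gi: "g (inv g a) = a" "inv g (g a) = a" for a
    using b by (auto simp: bij_def surj_f_inv_f)
  have m: "map g (map (inv g) as) = as" for as using gi by (simp add: comp_def)
  have "inv g (int_fun M f as) = int_fun M f (map (inv g) as)"
    if "f \<in> fun_syms L" "length as = fun_arity L f" for f as
  proof -
    have "g (int_fun M f (map (inv g) as)) = int_fun M f (map g (map (inv g) as))"
      using assms that unfolding automorphism_def by (auto simp del: map_map)
    then show ?thesis using gi m by metis
  qed
  moreover have "int_rel M r (map (inv g) as) \<longleftrightarrow> int_rel M r as"
    if "r \<in> rel_syms L" "length as = rel_arity L r" for r as
  proof -
    have "int_rel M r (map g (map (inv g) as)) \<longleftrightarrow> int_rel M r (map (inv g) as)"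
      using assms that unfolding automorphism_def by (auto simp del: map_map)
    then show ?thesis using m by metis
  qed
  ultimately show ?thesis using b unfolding automorphism_def by (auto simp: bij_imp_bij_inv)
qed

lemma automorphism_comp:
  fixes L :: "('f, 'r, 'v) language" and M :: "('f, 'r, 'a) struc"
  assumes g: "automorphism L M g" and h: "automorphism L M h"
  shows "automorphism L M (g \<circ> h)"
  unfolding automorphism_def
proof (intro conjI ballI allI impI)
  show "bij (g \<circ> h)" using assms unfolding automorphism_def by (auto intro: bij_comp)
next
  fix f and as :: "'a list" assume f: "f \<in> fun_syms L" "length as = fun_arity L f"
  have "h (int_fun M f as) = int_fun M f (map h as)"
    using h f unfolding automorphism_def by blast
  moreover have "g (int_fun M f (map h as)) = int_fun M f (map g (map h as))"
    using g f unfolding automorphism_def by (simp del: map_map)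
  ultimately show "(g \<circ> h) (int_fun M f as) = int_fun M f (map (g \<circ> h) as)" by simp
next
  fix r and as :: "'a list" assume r: "r \<in> rel_syms L" "length as = rel_arity L r"
  have "int_rel M r (map h as) \<longleftrightarrow> int_rel M r as"
    using h r unfolding automorphism_def by blast
  moreover have "int_rel M r (map g (map h as)) \<longleftrightarrow> int_rel M r (map h as)"
    using g r unfolding automorphism_def by (simp del: map_map)
  ultimately show "int_rel M r (map (g \<circ> h) as) \<longleftrightarrow> int_rel M r as" by simp
qed

lemma elementary_map_automorphism:
  fixes L :: "('f, 'r, 'v) language" and M :: "('f, 'r, 'a) struc"
  assumes "automorphism L M g"
  shows "elementary_map L M D g"
  unfolding elementary_map_def
proof (intro ballI allI)
  fix \<phi> :: "('f,'r,'v,'a) fm" and e assume \<phi>: "\<phi> \<in> fms L D {}"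
  have "sat M e (rename_params g \<phi>) \<longleftrightarrow> sat M (g \<circ> e) (rename_params g \<phi>)"
    using \<phi> by (intro sat_cong) (auto simp: fms_def)
  also have "\<dots> \<longleftrightarrow> sat M e \<phi>" using \<phi> sat_automorphism[OF assms] by (auto simp: fms_def)
  finally show "sat M e (rename_params g \<phi>) \<longleftrightarrow> sat M e \<phi>" .
qed

section \<open>Definable sets of tuples\<close>

definition pos :: "'x list \<Rightarrow> 'x \<Rightarrow> nat" where
  "pos vs v = (LEAST i. i < length vs \<and> vs ! i = v)"

lemma pos_less: "v \<in> set vs \<Longrightarrow> pos vs v < length vs"
  and nth_pos: "v \<in> set vs \<Longrightarrow> vs ! pos vs v = v"
proof -
  assume "v \<in> set vs"
  then have "\<exists>i. i < length vs \<and> vs ! i = v" by (auto simp: in_set_conv_nth)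
  then have "pos vs v < length vs \<and> vs ! pos vs v = v" unfolding pos_def by (rule LeastI_ex)
  then show "pos vs v < length vs" "vs ! pos vs v = v" by auto
qed

lemma pos_nth: "distinct vs \<Longrightarrow> i < length vs \<Longrightarrow> pos vs (vs ! i) = i"
  using pos_less[of "vs ! i" vs] nth_pos[of "vs ! i" vs] by (auto simp: nth_eq_iff_index_eq)

text \<open>With repeated variables the first occurrence decides. Outside \<open>vs\<close> the
  value is unspecified, so only values at variables in \<open>vs\<close> are ever relevant.\<close>

definition asg :: "'v list \<Rightarrow> 'a list \<Rightarrow> 'v \<Rightarrow> 'a" where
  "asg vs xs v = xs ! pos vs v"

lemma map_asg: "distinct vs \<Longrightarrow> length xs = length vs \<Longrightarrow> map (asg vs xs) vs = xs"
  by (auto simp: asg_def pos_nth intro: nth_equalityI)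

lemma asg_map: "v \<in> set vs \<Longrightarrow> asg vs (map e vs) v = e v"
  by (auto simp: asg_def pos_less nth_pos)

lemma ex_distinct_list: "\<exists>vs :: 'v :: infinite list. distinct vs \<and> length vs = n"
proof -
  obtain V :: "'v set" where "finite V" "card V = n"
    using infinite_arbitrarily_large[OF infinite_UNIV] by blast
  then show ?thesis using finite_distinct_list[of V] distinct_card by metis
qed

lemma rename_params_ident: "rename_params (\<lambda>a. a) \<phi> = \<phi>"
  unfolding rename_params_def id_def by (rule fm.map_ident)

text \<open>The coordinates of \<open>t x\<close> are coordinates of \<open>x\<close> or fixed parameters from \<open>E\<close>.\<close>

definition tuple_subst :: "'a set \<Rightarrow> nat \<Rightarrow> ('a list \<Rightarrow> 'a list) \<Rightarrow> bool" where
  "tuple_subst E k t \<longleftrightarrow> (\<exists>f :: (nat + 'a) list. set f \<subseteq> Inl ` {..<k} \<union> Inr ` E \<and>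
     (\<forall>x. length x = k \<longrightarrow> t x = map (case_sum (nth x) id) f))"

lemma tuple_subst_id: "tuple_subst E k (\<lambda>x. x)"
  unfolding tuple_subst_def
  by (intro exI[of _ "map Inl [0..<k]"]) (auto intro: nth_equalityI)

lemma tuple_subst_const: "set d \<subseteq> E \<Longrightarrow> tuple_subst E k (\<lambda>_. d)"
  unfolding tuple_subst_def by (intro exI[of _ "map Inr d"]) (auto simp: comp_def)

lemma tuple_subst_append: "tuple_subst E k t \<Longrightarrow> tuple_subst E k u \<Longrightarrow> tuple_subst E k (\<lambda>x. t x @ u x)"
  unfolding tuple_subst_def by (elim exE, rule_tac x = "f @ fa" in exI) auto

lemma tuple_subst_take: "tuple_subst E k t \<Longrightarrow> tuple_subst E k (\<lambda>x. take m (t x))"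
  unfolding tuple_subst_def
  by (elim exE, rule_tac x = "take m f" in exI) (auto simp: take_map dest: in_set_takeD)

lemma tuple_subst_drop: "tuple_subst E k t \<Longrightarrow> tuple_subst E k (\<lambda>x. drop m (t x))"
  unfolding tuple_subst_def
  by (elim exE, rule_tac x = "drop m f" in exI) (auto simp: drop_map dest: in_set_dropD)

lemma tuple_subst_map_nth:
  assumes "tuple_subst E k t" "\<And>i x. i \<in> set js \<Longrightarrow> length x = k \<Longrightarrow> i < length (t x)"
  shows "tuple_subst E k (\<lambda>x. map (nth (t x)) js)"
proof -
  obtain f :: "(nat + 'a) list" where f: "set f \<subseteq> Inl ` {..<k} \<union> Inr ` E"
    "\<And>x. length x = k \<Longrightarrow> t x = map (case_sum (nth x) id) f" using assms(1) unfolding tuple_subst_def by auto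
  \<comment> \<open>\<open>replicate k undefined\<close> is merely a sample argument:
    \<open>t x\<close> has length \<open>length f\<close> for every \<open>x\<close> of length
    \<open>k\<close>.\<close>
  have "i < length f" if "i \<in> set js" for i
    using assms(2)[OF that, of "replicate k undefined"] f(2)[of "replicate k undefined"] by simp
  moreover from this have "set (map (nth f) js) \<subseteq> set f" by auto
  ultimately show ?thesis unfolding tuple_subst_def using f
    by (intro exI[of _ "map (nth f) js"]) auto
qed

lemma tuple_subst_nth: "i < k \<Longrightarrow> tuple_subst E k (\<lambda>x. [x ! i])"
  unfolding tuple_subst_def by (intro exI[of _ "[Inl i]"]) auto

lemma tuple_subst_map:
  assumes "\<And>u. u \<in> set ws \<Longrightarrow> tuple_subst E k (\<lambda>x. [g u x])"
  shows "tuple_subst E k (\<lambda>x. map (\<lambda>u. g u x) ws)"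
  using assms
proof (induction ws)
  case (Cons w ws)
  then have "tuple_subst E k (\<lambda>x. [g w x] @ map (\<lambda>u. g u x) ws)" by (intro tuple_subst_append) auto
  then show ?case by simp
qed (simp add: tuple_subst_const)

lemmas tuple_subst_intros = tuple_subst_id tuple_subst_const tuple_subst_append tuple_subst_take tuple_subst_drop

lemma ex_index_list:
  assumes "set d \<subseteq> set l"
  shows "\<exists>js. length js = length d \<and> (\<forall>i\<in>set js. i < length l) \<and> map (nth l) js = d"
  using assms
  by (intro exI[of _ "map (pos l) d"]) (auto simp: pos_less nth_pos comp_def intro!: map_idI)

section \<open>Relations definable with parameters in a monster model\<close>

locale monster =
  fixes L :: "('f, 'r, 'v :: infinite) language" and M :: "('f, 'r, 'a) struc" and \<kappa> :: "'k rel"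
  assumes Card_order_\<kappa>: "Card_order \<kappa>"
    and natLeq_less_\<kappa>: "natLeq <o \<kappa>"
    and saturated: "saturated L \<kappa> M"
    and homogeneous: "strongly_homogeneous L \<kappa> M"
    and no_tree_property: "\<And>\<phi> X. \<phi> \<in> fms L {} UNIV \<Longrightarrow> \<not> tree_property M \<phi> X"
begin

text \<open>The variables are existentially quantified, so a definable relation carries no variable
  names and relations can be combined without renaming. Its behaviour on lists whose length is not
  \<open>n\<close> is left open; this is why \<open>Def_cong\<close> compares relations on lists of
  length \<open>n\<close> only.\<close>

definition Def :: "'a set \<Rightarrow> nat \<Rightarrow> ('a list \<Rightarrow> bool) \<Rightarrow> bool" where
  "Def D n P \<longleftrightarrow> (\<exists>\<phi> vs. \<phi> \<in> fms L D (set vs) \<and> distinct vs \<and> length vs = n \<and>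
     (\<forall>e. sat M e \<phi> \<longleftrightarrow> P (map e vs)))"

text \<open>Distinctness of the variables hidden in \<open>Def\<close> makes it meaningful to
  replace the \<open>i\<close>-th variable by the \<open>i\<close>-th term. \<open>Def_fm\<close>
  and \<open>Def_tuple_subst\<close> are obtained as instances.\<close>

lemma Def_trms:
  assumes "Def D n P" "length ts = n" "\<And>t. t \<in> set ts \<Longrightarrow> wf_trm L t"
  shows "\<exists>\<phi>. \<phi> \<in> fms L (D \<union> (\<Union>t\<in>set ts. trm_params t)) (\<Union>t\<in>set ts. trm_vars t) \<and>
    (\<forall>e. sat M e \<phi> \<longleftrightarrow> P (map (val M e) ts))"
proof -
  obtain \<phi> vs where \<phi>: "\<phi> \<in> fms L D (set vs)" "distinct vs" "length vs = n"
    "\<And>e. sat M e \<phi> \<longleftrightarrow> P (map e vs)" using assms(1) unfolding Def_def by auto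
  let ?\<tau> = "\<lambda>v. if v \<in> set vs then ts ! pos vs v else Var v"
  have "wf_fm L \<phi>" using \<phi> by (auto simp: fms_def)
  moreover have mem: "v \<in> set vs \<Longrightarrow> ts ! pos vs v \<in> set ts" for v
    using assms(2) \<phi>(3) pos_less by fastforce
  then have "\<And>v. wf_trm L (?\<tau> v)" using assms(3) by auto
  ultimately obtain \<phi>' where \<phi>': "wf_fm L \<phi>'"
    "fv \<phi>' \<subseteq> (\<Union>v\<in>fv \<phi>. trm_vars (?\<tau> v)) \<union> (\<Union>a\<in>fm_params \<phi>. trm_vars (Par a :: ('f,'v,'a) trm))"
    "fm_params \<phi>' \<subseteq> (\<Union>v\<in>fv \<phi>. trm_params (?\<tau> v)) \<union> (\<Union>a\<in>fm_params \<phi>. trm_params (Par a :: ('f,'v,'a) trm))"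
    "\<And>e. sat M e \<phi>' \<longleftrightarrow> sat M (\<lambda>v. val M e (?\<tau> v)) (rename_params (\<lambda>a. val M e (Par a)) \<phi>)"
    using fm_subst[of L \<phi> ?\<tau> Par M] by auto
  have "sat M e \<phi>' \<longleftrightarrow> P (map (val M e) ts)" for e
  proof -
    have "map (\<lambda>v. val M e (?\<tau> v)) vs = map (val M e) ts"
      using assms(2) \<phi>(2,3) by (auto intro!: nth_equalityI simp: pos_nth)
    then show ?thesis using \<phi>'(4)[of e] \<phi>(4) by (simp add: rename_params_ident)
  qed
  moreover have "fv \<phi>' \<subseteq> (\<Union>t\<in>set ts. trm_vars t)"
    using \<phi>'(2) \<phi>(1) mem by (fastforce simp: fms_def subset_iff split: if_splits)
  moreover have "fm_params \<phi>' \<subseteq> D \<union> (\<Union>t\<in>set ts. trm_params t)"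
    using \<phi>'(3) \<phi>(1) mem by (fastforce simp: fms_def subset_iff split: if_splits)
  ultimately show ?thesis using \<phi>'(1) unfolding fms_def by blast
qed

text \<open>Unlike the list hidden in \<open>Def\<close>, \<open>vs\<close> is arbitrary and may
  repeat variables. With \<open>fm_Def\<close> for the other direction this is the dictionary
  between formulas and relations.\<close>

lemma Def_fm:
  assumes "Def D n P" "length vs = n"
  shows "\<exists>\<phi>\<in>fms L D (set vs). \<forall>e. sat M e \<phi> \<longleftrightarrow> P (map e vs)"
proof -
  have wf: "wf_trm L t" if "t \<in> Var ` set vs" for t :: "('f,'v,'a) trm" using that by auto
  obtain \<phi> where "\<phi> \<in> fms L (D \<union> (\<Union>t\<in>set (map Var vs). trm_params (t :: ('f,'v,'a) trm)))
      (\<Union>t\<in>set (map Var vs). trm_vars (t :: ('f,'v,'a) trm))"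
    "\<forall>e. sat M e \<phi> \<longleftrightarrow> P (map (val M e) (map Var vs))"
    using Def_trms[OF assms(1), of "map Var vs"] assms(2) wf by (auto simp del: map_map)
  then show ?thesis by (intro bexI[of _ \<phi>]) (simp_all add: comp_def)
qed

lemma fm_Def:
  assumes "\<phi> \<in> fms L D (set vs)"
  shows "Def D (length vs) (\<lambda>xs. sat M (asg vs xs) \<phi>)"
proof -
  obtain us :: "'v list" where us: "distinct us" "length us = length vs"
    using ex_distinct_list by blast
  let ?\<tau> = "\<lambda>v. Var (us ! pos vs v) :: ('f,'v,'a) trm"
  have wf: "wf_fm L \<phi>" using assms by (auto simp: fms_def)
  obtain \<phi>' where \<phi>': "wf_fm L \<phi>'"
    "fv \<phi>' \<subseteq> (\<Union>v\<in>fv \<phi>. trm_vars (?\<tau> v)) \<union> (\<Union>a\<in>fm_params \<phi>. trm_vars (Par a :: ('f,'v,'a) trm))"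
    "fm_params \<phi>' \<subseteq> (\<Union>v\<in>fv \<phi>. trm_params (?\<tau> v)) \<union> (\<Union>a\<in>fm_params \<phi>. trm_params (Par a :: ('f,'v,'a) trm))"
    "\<And>e. sat M e \<phi>' \<longleftrightarrow> sat M (\<lambda>v. val M e (?\<tau> v)) (rename_params (\<lambda>a. val M e (Par a)) \<phi>)"
    using fm_subst[of L \<phi> ?\<tau> Par M] wf by auto
  have "us ! pos vs v \<in> set us" if "v \<in> fv \<phi>" for v
    using that assms us pos_less[of v vs] by (auto simp: fms_def)
  then have "\<phi>' \<in> fms L D (set us)" using \<phi>' assms by (auto simp: fms_def subset_iff)
  moreover have "sat M e \<phi>' \<longleftrightarrow> sat M (asg vs (map e us)) \<phi>" for e
    unfolding \<phi>'(4) val.simps rename_params_ident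
  proof (rule sat_cong)
    fix v assume "v \<in> fv \<phi>"
    then have "v \<in> set vs" using assms by (auto simp: fms_def)
    then show "e (us ! pos vs v) = asg vs (map e us) v" using us pos_less[of v vs] by (simp add: asg_def)
  qed
  ultimately show ?thesis unfolding Def_def using us by metis
qed

lemma sat_asg_map:
  assumes "fv \<phi> \<subseteq> set vs"
  shows "sat M (asg vs (map e vs)) \<phi> \<longleftrightarrow> sat M e \<phi>"
  using assms by (intro sat_cong) (auto simp: asg_map)

lemma Def_cong:
  assumes "Def D n P" "\<And>x. length x = n \<Longrightarrow> P x \<longleftrightarrow> Q x"
  shows "Def D n Q"
  using assms unfolding Def_def by (metis length_map)

lemma Def_mono: "Def D n P \<Longrightarrow> D \<subseteq> E \<Longrightarrow> Def E n P"
  unfolding Def_def fms_def by blast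

text \<open>The finitely many parameters of a formula become additional variables. The resulting
  \<open>R\<close> is invariant under every automorphism, so conjugating \<open>P\<close> amounts to
  moving the tuple \<open>d\<close>.\<close>

lemma Def_params:
  assumes "Def D n P"
  shows "\<exists>d R. set d \<subseteq> D \<and> Def {} (n + length d) R \<and> (\<forall>x. length x = n \<longrightarrow> P x \<longleftrightarrow> R (x @ d))"
proof -
  obtain \<phi> vs where \<phi>: "\<phi> \<in> fms L D (set vs)" "distinct vs" "length vs = n"
    "\<And>e. sat M e \<phi> \<longleftrightarrow> P (map e vs)" using assms(1) unfolding Def_def by auto
  obtain ps where ps: "set ps = fm_params \<phi>" using finite_list[OF finite_fm_params, of \<phi>] by auto
  obtain us :: "'v list" where us: "distinct us" "length us = n + length ps"
    using ex_distinct_list by blast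
  let ?\<tau> = "\<lambda>v. Var (us ! pos vs v) :: ('f,'v,'a) trm"
  let ?\<rho> = "\<lambda>a. Var (us ! (n + pos ps a)) :: ('f,'v,'a) trm"
  have wf: "wf_fm L \<phi>" and fv: "fv \<phi> \<subseteq> set vs" using \<phi> by (auto simp: fms_def)
  obtain \<phi>' where \<phi>': "wf_fm L \<phi>'"
    "fv \<phi>' \<subseteq> (\<Union>v\<in>fv \<phi>. trm_vars (?\<tau> v)) \<union> (\<Union>a\<in>fm_params \<phi>. trm_vars (?\<rho> a))"
    "fm_params \<phi>' \<subseteq> (\<Union>v\<in>fv \<phi>. trm_params (?\<tau> v)) \<union> (\<Union>a\<in>fm_params \<phi>. trm_params (?\<rho> a))"
    "\<And>e. sat M e \<phi>' \<longleftrightarrow> sat M (\<lambda>v. val M e (?\<tau> v)) (rename_params (\<lambda>a. val M e (?\<rho> a)) \<phi>)"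
    using fm_subst[of L \<phi> ?\<tau> ?\<rho> M] wf by auto
  have in1: "us ! pos vs v \<in> set us" if "v \<in> fv \<phi>" for v
    using that fv \<phi>(3) us pos_less[of v vs] by auto
  have in2: "us ! (n + pos ps a) \<in> set us" if "a \<in> fm_params \<phi>" for a
    using that us pos_less[of a ps] ps by auto
  have "\<phi>' \<in> fms L {} (set us)" using \<phi>'(1-3) in1 in2 by (fastforce simp: fms_def)
  then have "Def {} (n + length ps) (\<lambda>xs. sat M (asg us xs) \<phi>')"
    using fm_Def us(2) by metis
  moreover have "P x \<longleftrightarrow> sat M (asg us (x @ ps)) \<phi>'" if x: "length x = n" for x
  proof -
    have "sat M (asg us (x @ ps)) \<phi>' \<longleftrightarrow>
      sat M (\<lambda>v. asg us (x @ ps) (us ! pos vs v)) (rename_params (\<lambda>a. asg us (x @ ps) (us ! (n + pos ps a))) \<phi>)"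
      unfolding \<phi>'(4) by simp
    also have "rename_params (\<lambda>a. asg us (x @ ps) (us ! (n + pos ps a))) \<phi> = rename_params (\<lambda>a. a) \<phi>"
      using x us ps pos_less[of _ ps] nth_pos[of _ ps]
      by (intro rename_params_cong) (auto simp: asg_def pos_nth)
    also have "sat M (\<lambda>v. asg us (x @ ps) (us ! pos vs v)) (rename_params (\<lambda>a. a) \<phi>) \<longleftrightarrow>
       sat M (asg vs x) (rename_params (\<lambda>a. a) \<phi>)"
    proof (rule sat_cong)
      fix v assume "v \<in> fv (rename_params (\<lambda>a. a) \<phi>)"
      then have "v \<in> set vs" using fv by auto
      then have "pos vs v < n" using pos_less[of v vs] \<phi>(3) by simp
      then show "asg us (x @ ps) (us ! pos vs v) = asg vs x v"
        using us x by (auto simp: asg_def pos_nth nth_append)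
    qed
    also have "\<dots> \<longleftrightarrow> P x" using \<phi> x by (simp add: rename_params_ident map_asg)
    finally show ?thesis by simp
  qed
  ultimately show ?thesis using ps \<phi>(1) by (intro exI[of _ ps] exI) (auto simp: fms_def)
qed

text \<open>Permuting, repeating and dropping coordinates and inserting parameters are handled at
  once: each coordinate of \<open>t x\<close> is the value of a term that is a variable or a
  parameter from \<open>E\<close>.\<close>

lemma Def_tuple_subst:
  assumes "Def D n P" "tuple_subst E k t" "\<And>x. length x = k \<Longrightarrow> length (t x) = n" "D \<subseteq> E"
  shows "Def E k (\<lambda>x. P (t x))"
proof -
  obtain us :: "'v list" where us: "distinct us" "length us = k"
    using ex_distinct_list by blast
  obtain f :: "(nat + 'a) list" where f: "set f \<subseteq> Inl ` {..<k} \<union> Inr ` E"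
    "\<And>x. length x = k \<Longrightarrow> t x = map (case_sum (nth x) id) f" using assms(2) unfolding tuple_subst_def by auto
  have len: "length f = n"
    using assms(3)[of "replicate k undefined"] f(2)[of "replicate k undefined"] by simp
  have "\<forall>i<n. \<exists>tm :: ('f,'v,'a) trm. wf_trm L tm \<and> trm_params tm \<subseteq> E \<and> trm_vars tm \<subseteq> set us \<and>
      (\<forall>x. length x = k \<longrightarrow> val M (asg us x) tm = t x ! i)"
  proof (intro allI impI)
    fix i assume "i < n"
    with len have "f ! i \<in> Inl ` {..<k} \<union> Inr ` E" using f(1) nth_mem by blast
    then consider j where "j < k" "f ! i = Inl j" | c where "c \<in> E" "f ! i = Inr c" by auto
    then show "\<exists>tm :: ('f,'v,'a) trm. wf_trm L tm \<and> trm_params tm \<subseteq> E \<and> trm_vars tm \<subseteq> set us \<and>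
      (\<forall>x. length x = k \<longrightarrow> val M (asg us x) tm = t x ! i)"
    proof cases
      case 1
      then show ?thesis using us f(2) len \<open>i < n\<close>
        by (intro exI[of _ "Var (us ! j)"]) (auto simp: asg_def pos_nth)
    next
      case 2
      then show ?thesis using f(2) len \<open>i < n\<close> by (intro exI[of _ "Par c"]) auto
    qed
  qed
  then obtain tm where tm: "\<And>i. i < n \<Longrightarrow> wf_trm L (tm i :: ('f,'v,'a) trm) \<and> trm_params (tm i) \<subseteq> E \<and>
     trm_vars (tm i) \<subseteq> set us \<and> (\<forall>x. length x = k \<longrightarrow> val M (asg us x) (tm i) = t x ! i)"
    by metis
  let ?ts = "map tm [0..<n]"
  obtain \<phi> where \<phi>: "\<phi> \<in> fms L (D \<union> (\<Union>t\<in>set ?ts. trm_params t)) (\<Union>t\<in>set ?ts. trm_vars t)"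
    "\<And>e. sat M e \<phi> \<longleftrightarrow> P (map (val M e) ?ts)"
    using Def_trms[OF assms(1), of ?ts] tm by (fastforce simp del: map_map)
  have "(\<Union>t\<in>set ?ts. trm_vars t) \<subseteq> set us" using tm by fastforce
  moreover have "D \<union> (\<Union>t\<in>set ?ts. trm_params t) \<subseteq> E" using tm assms(4) by fastforce
  ultimately have "\<phi> \<in> fms L E (set us)" using \<phi>(1) unfolding fms_def by blast
  then have "Def E k (\<lambda>xs. sat M (asg us xs) \<phi>)" using fm_Def us by metis
  then show ?thesis
  proof (rule Def_cong)
    fix x :: "'a list" assume x: "length x = k"
    have "map (val M (asg us x)) ?ts = t x"
    proof (rule nth_equalityI)
      fix i assume "i < length (map (val M (asg us x)) ?ts)"
      then show "map (val M (asg us x)) ?ts ! i = t x ! i" using tm[of i] x by simp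
    qed (simp add: assms(3)[OF x])
    then show "sat M (asg us x) \<phi> \<longleftrightarrow> P (t x)" using \<phi>(2)[of "asg us x"] by simp
  qed
qed

lemma Def_not: "Def D n P \<Longrightarrow> Def D n (\<lambda>x. \<not> P x)"
  unfolding Def_def
  by (elim exE, rule_tac x = "Neg \<phi>" in exI, rule_tac x = vs in exI) (auto simp: fms_def)

lemma Def_conj:
  assumes "Def D n P" "Def D n Q"
  shows "Def D n (\<lambda>x. P x \<and> Q x)"
proof -
  obtain us :: "'v list" where us: "distinct us" "length us = n"
    using ex_distinct_list by blast
  obtain \<phi> where "\<phi> \<in> fms L D (set us)" "\<forall>e. sat M e \<phi> \<longleftrightarrow> P (map e us)"
    using Def_fm[OF assms(1) us(2)] by blast
  moreover obtain \<psi> where "\<psi> \<in> fms L D (set us)" "\<forall>e. sat M e \<psi> \<longleftrightarrow> Q (map e us)"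
    using Def_fm[OF assms(2) us(2)] by blast
  ultimately show ?thesis unfolding Def_def using us
    by (intro exI[of _ "Conj \<phi> \<psi>"] exI[of _ us]) (auto simp: fms_def)
qed

lemma Def_True: "Def D n (\<lambda>_. True)"
proof -
  obtain us :: "'v list" where us: "distinct us" "length us = n"
    using ex_distinct_list by blast
  show ?thesis unfolding Def_def using us
    by (intro exI[of _ "Ex undefined (Eq (Var undefined) (Var undefined))"] exI[of _ us])
      (auto simp: fms_def)
qed

lemma Def_Ball:
  assumes "finite J" "\<And>j. j \<in> J \<Longrightarrow> Def D n (P j)"
  shows "Def D n (\<lambda>x. \<forall>j\<in>J. P j x)"
  using assms by (induction J) (auto intro: Def_True Def_conj)

lemma Def_ex1:
  assumes "Def D (Suc n) P"
  shows "Def D n (\<lambda>x. \<exists>a. P (x @ [a]))"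
proof -
  obtain us :: "'v list" where us: "distinct us" "length us = Suc n"
    using ex_distinct_list by blast
  then obtain vs v where vs: "us = vs @ [v]" by (cases us rule: rev_cases) auto
  obtain \<phi> where \<phi>: "\<phi> \<in> fms L D (set us)" "\<forall>e. sat M e \<phi> \<longleftrightarrow> P (map e us)"
    using Def_fm[OF assms us(2)] by blast
  have "map (e(v := a)) us = map e vs @ [a]" for e :: "'v \<Rightarrow> 'a" and a
    using us vs by auto
  then show ?thesis unfolding Def_def using us \<phi> vs
    by (intro exI[of _ "Ex v \<phi>"] exI[of _ vs]) (auto simp: fms_def)
qed

lemma Def_ex:
  assumes "Def D (n + m) P"
  shows "Def D n (\<lambda>x. \<exists>y. length y = m \<and> P (x @ y))"
  using assms
proof (induction m arbitrary: P)
  case (Suc m)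
  have "Def D (n + m) (\<lambda>x. \<exists>a. P (x @ [a]))" using Suc.prems by (intro Def_ex1) simp
  from Suc.IH[OF this] have "Def D n (\<lambda>x. \<exists>y. length y = m \<and> (\<exists>a. P ((x @ y) @ [a])))" .
  then show ?case
  proof (rule Def_cong)
    fix x :: "'a list"
    show "(\<exists>y. length y = m \<and> (\<exists>a. P ((x @ y) @ [a]))) \<longleftrightarrow> (\<exists>y. length y = Suc m \<and> P (x @ y))"
      by (auto simp: length_Suc_conv_rev)
  qed
qed simp

lemma Def_eq: "i < n \<Longrightarrow> j < n \<Longrightarrow> Def D n (\<lambda>x. x ! i = x ! j)"
proof -
  assume ij: "i < n" "j < n"
  obtain us :: "'v list" where us: "distinct us" "length us = n"
    using ex_distinct_list by blast
  show ?thesis unfolding Def_def using us ij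
    by (intro exI[of _ "Eq (Var (us ! i)) (Var (us ! j))"] exI[of _ us])
      (auto simp: fms_def)
qed

text \<open>Parameters in \<open>D\<close> stay; the others necessarily lie in \<open>A\<close> and
  form the tuple \<open>a\<close>.\<close>

lemma Def_abstract:
  assumes "Def (D \<union> A) n P"
  shows "\<exists>a R. set a \<subseteq> A \<and> Def D (n + length a) R \<and> (\<forall>x. length x = n \<longrightarrow> P x \<longleftrightarrow> R (x @ a))"
proof -
  obtain d R where d: "set d \<subseteq> D \<union> A" "Def {} (n + length d) R"
    "\<And>x. length x = n \<Longrightarrow> P x \<longleftrightarrow> R (x @ d)" using Def_params[OF assms] by auto
  define a where "a = filter (\<lambda>z. z \<notin> D) d"
  define c where "c = filter (\<lambda>z. z \<in> D) d"
  have "set d \<subseteq> set (a @ c)" by (auto simp: a_def c_def)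
  then obtain js where js: "length js = length d" "\<forall>i\<in>set js. i < length (a @ c)"
    "map (nth (a @ c)) js = d" using ex_index_list by metis
  let ?t = "\<lambda>l. take n l @ map (nth (drop n l @ c)) js"
  have "tuple_subst D (n + length a) ?t"
    using js by (intro tuple_subst_intros tuple_subst_map_nth) (auto simp: c_def)
  from Def_tuple_subst[OF d(2) this] have "Def D (n + length a) (\<lambda>l. R (?t l))" using js(1) by simp
  moreover have "P x \<longleftrightarrow> R (?t (x @ a))" if "length x = n" for x
    using d(3)[OF that] js that by simp
  ultimately show ?thesis using d(1) by (intro exI[of _ a] exI) (auto simp: a_def)
qed

text \<open>The whole list \<open>b\<close> becomes an argument, not just those of its entries that
  occur; the relation can then be conjugated by moving the tuple \<open>b\<close> itself.\<close>

lemma Def_abstract_list: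
  assumes "Def (D \<union> set b) n P"
  shows "\<exists>R. Def D (n + length b) R \<and> (\<forall>x. length x = n \<longrightarrow> P x \<longleftrightarrow> R (x @ b))"
proof -
  obtain a R where a: "set a \<subseteq> set b" "Def D (n + length a) R"
    "\<And>x. length x = n \<Longrightarrow> P x \<longleftrightarrow> R (x @ a)" using Def_abstract[OF assms] by blast
  obtain js where js: "length js = length a" "\<forall>i\<in>set js. i < length b"
    "map (nth b) js = a" using ex_index_list[OF a(1)] by metis
  let ?t = "\<lambda>l. take n l @ map (nth (drop n l)) js"
  have "tuple_subst D (n + length b) ?t"
    using js by (intro tuple_subst_intros tuple_subst_map_nth) auto
  from Def_tuple_subst[OF a(2) this] have "Def D (n + length b) (\<lambda>l. R (?t l))" using js(1) by simp
  moreover have "P x \<longleftrightarrow> R (?t (x @ b))" if "length x = n" for x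
    using a(3)[OF that] js that by simp
  ultimately show ?thesis by blast
qed

lemma Def_instance:
  assumes "Def D (n + length a) R" "D \<subseteq> E" "set a \<subseteq> E"
  shows "Def E n (\<lambda>x. R (x @ a))"
  using assms(2,3) by (intro Def_tuple_subst[OF assms(1)] tuple_subst_intros) auto

section \<open>Automorphisms fixing a set pointwise and their action on definable relations\<close>

definition Aut :: "'a set \<Rightarrow> ('a \<Rightarrow> 'a) set" where
  "Aut D = {g. automorphism L M g \<and> (\<forall>d\<in>D. g d = d)}"

lemma Aut_mono: "g \<in> Aut E \<Longrightarrow> D \<subseteq> E \<Longrightarrow> g \<in> Aut D"
  unfolding Aut_def by auto

lemma Aut_comp: "g \<in> Aut D \<Longrightarrow> h \<in> Aut D \<Longrightarrow> g \<circ> h \<in> Aut D"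
  unfolding Aut_def by (auto simp: automorphism_comp)

lemma Aut_bij: "g \<in> Aut D \<Longrightarrow> bij g"
  unfolding Aut_def automorphism_def by auto

lemma Aut_inv_cancel:
  assumes "g \<in> Aut D"
  shows "inv g (g a) = a" "g (inv g a) = a"
    "map (inv g) (map g x) = x" "map g (map (inv g) x) = x"
  using Aut_bij[OF assms] by (auto simp: bij_def surj_f_inv_f comp_def)

lemma Aut_inv:
  assumes "g \<in> Aut D"
  shows "inv g \<in> Aut D"
proof -
  have "inv g d = d" if "d \<in> D" for d
  proof -
    have "g d = d" using assms that unfolding Aut_def by auto
    then show ?thesis using Aut_inv_cancel(1)[OF assms, of d] by simp
  qed
  then show ?thesis using assms unfolding Aut_def by (auto simp: automorphism_inv)
qed

lemma Aut_map: "g \<in> Aut D \<Longrightarrow> set d \<subseteq> D \<Longrightarrow> map g d = d"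
  unfolding Aut_def by (auto intro!: map_idI)

lemma Def_Aut:
  assumes "Def D n P" "g \<in> Aut D" "length x = n"
  shows "P (map g x) \<longleftrightarrow> P x"
proof -
  obtain \<phi> vs where \<phi>: "\<phi> \<in> fms L D (set vs)" "distinct vs" "length vs = n"
    "\<And>e. sat M e \<phi> \<longleftrightarrow> P (map e vs)" using assms(1) unfolding Def_def by auto
  have g: "automorphism L M g" "\<And>d. d \<in> D \<Longrightarrow> g d = d" using assms(2) unfolding Aut_def by auto
  have "rename_params g \<phi> = rename_params (\<lambda>a. a) \<phi>"
    using g(2) \<phi>(1) by (intro rename_params_cong) (auto simp: fms_def)
  then have "sat M (g \<circ> asg vs x) \<phi> \<longleftrightarrow> sat M (asg vs x) \<phi>"
    using sat_automorphism[OF g(1), of \<phi> "asg vs x"] \<phi>(1) by (simp add: rename_params_ident fms_def)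
  moreover have "map (g \<circ> asg vs x) vs = map g x"
    using map_asg[OF \<phi>(2), of x] assms(3) \<phi>(3) by (metis map_map)
  ultimately show ?thesis using \<phi>(4)[of "g \<circ> asg vs x"] \<phi>(4)[of "asg vs x"] map_asg[OF \<phi>(2), of x] assms(3) \<phi>(3)
    by simp
qed

lemma Def_image_Aut:
  assumes "Def D n P" "g \<in> Aut {}"
  shows "Def (g ` D) n (\<lambda>x. P (map (inv g) x))"
proof -
  obtain d R where d: "set d \<subseteq> D" "Def {} (n + length d) R"
    "\<And>x. length x = n \<Longrightarrow> P x \<longleftrightarrow> R (x @ d)" using Def_params[OF assms(1)] by auto
  have "Def (g ` D) n (\<lambda>x. R (x @ map g d))"
    using d by (intro Def_instance[where D = "{}"]) auto
  then show ?thesis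
  proof (rule Def_cong)
    fix x :: "'a list" assume x: "length x = n"
    have "R (map g (map (inv g) x @ d)) \<longleftrightarrow> R (map (inv g) x @ d)"
      using x by (intro Def_Aut[OF d(2) assms(2)]) simp
    then show "R (x @ map g d) \<longleftrightarrow> P (map (inv g) x)"
      using d(3)[of "map (inv g) x"] x Aut_inv_cancel(4)[OF assms(2)] by (simp del: map_map)
  qed
qed

section \<open>Saturation and homogeneity for tuples\<close>

lemma infinite_Field: "\<not> finite (Field \<kappa>)"
proof
  assume "finite (Field \<kappa>)"
  then have "|Field \<kappa>| <o natLeq" using finite_iff_ordLess_natLeq by blast
  then have "\<kappa> <o natLeq"
    using card_of_Field_ordIso[OF Card_order_\<kappa>] ordIso_ordLess_trans ordIso_symmetric by blast
  then show False using natLeq_less_\<kappa> not_ordLess_iff_ordLeq ordLess_transitive ordLess_irreflexive by blast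
qed

lemma small_Un: "|A| <o \<kappa> \<Longrightarrow> |B| <o \<kappa> \<Longrightarrow> |A \<union> B| <o \<kappa>"
  using card_of_Un_ordLess_infinite_Field[OF infinite_Field Card_order_\<kappa>] by blast

lemma small_finite: "finite A \<Longrightarrow> |A| <o \<kappa>"
  using finite_iff_ordLess_natLeq natLeq_less_\<kappa> ordLess_transitive by blast

lemma small_subset: "|A| <o \<kappa> \<Longrightarrow> B \<subseteq> A \<Longrightarrow> |B| <o \<kappa>"
  using card_of_mono1 ordLeq_ordLess_trans by blast

lemma small_image: "|A| <o \<kappa> \<Longrightarrow> |f ` A| <o \<kappa>"
  using card_of_image ordLeq_ordLess_trans by blast

lemma small_range_nat: "|range (f :: nat \<Rightarrow> 'x)| <o \<kappa>"
  using small_image[of "UNIV :: nat set" f] card_of_nat natLeq_less_\<kappa> ordIso_ordLess_trans by blast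

text \<open>Saturation is assumed for types in one variable only; Zorn's lemma extends a partial
  realization one variable at a time.\<close>

lemma realize_type:
  assumes p: "p \<subseteq> fms L D X" and D: "|D| <o \<kappa>" and X: "|X| <o \<kappa>" and con: "consistent M p"
  shows "\<exists>e. \<forall>\<phi>\<in>p. sat M e \<phi>"
proof -
  \<comment> \<open>\<open>G\<close> is the graph of a partial assignment that is compatible with
    every finite part of \<open>p\<close>. This invariant passes to unions of chains and permits
    extension by one variable.\<close>
  define good where "good = (\<lambda>G :: ('v \<times> 'a) set. fst ` G \<subseteq> X \<and>
    (\<forall>F\<subseteq>p. finite F \<longrightarrow> (\<exists>e. (\<forall>u a. (u, a) \<in> G \<longrightarrow> e u = a) \<and> (\<forall>\<phi>\<in>F. sat M e \<phi>))))"
  \<comment> \<open>The empty set of formulas already yields an assignment extending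
    \<open>G\<close>, which forces \<open>G\<close> to be single-valued.\<close>
  have sv: "a = a'" if ua: "good G" "(u, a) \<in> G" "(u, a') \<in> G" for G u a a'
  proof -
    obtain e where "\<forall>u a. (u, a) \<in> G \<longrightarrow> e u = a"
      using ua(1)[unfolded good_def, THEN conjunct2, rule_format, of "{}"] by auto
    then show ?thesis using ua(2,3) by metis
  qed
  have "\<exists>G\<in>Collect good. \<forall>H\<in>Collect good. G \<subseteq> H \<longrightarrow> H = G"
  proof (rule subset_Zorn_nonempty)
    show "Collect good \<noteq> {}"
      using con unfolding good_def consistent_def by (auto intro!: exI[of _ "{}"])
  next
    fix \<C> assume ne: "\<C> \<noteq> {}" and ch: "subset.chain (Collect good) \<C>"
    have gd: "good G" if "G \<in> \<C>" for G using ch that by (auto simp: subset.chain_def)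
    let ?U = "\<Union>\<C>"
    have sU: "a = a'" if ua: "(u, a) \<in> ?U" "(u, a') \<in> ?U" for u a a'
    proof -
      obtain G H where "(u, a) \<in> G" "G \<in> \<C>" "(u, a') \<in> H" "H \<in> \<C>" using ua by auto
      moreover have "G \<subseteq> H \<or> H \<subseteq> G" using ch calculation by (auto simp: subset.chain_def)
      ultimately show ?thesis using sv[OF gd] by blast
    qed
    have "good ?U" unfolding good_def
    proof (intro conjI allI impI)
      show "fst ` ?U \<subseteq> X" using gd unfolding good_def by blast
      fix F assume F: "F \<subseteq> p" "finite F"
      \<comment> \<open>Only the finitely many variables of \<open>F\<close> matter, and one member
        of the chain assigns all those among them that the union assigns.\<close>
      let ?V = "\<Union>\<phi>\<in>F. fv \<phi>"
      let ?G0 = "{(u, a). (u, a) \<in> ?U \<and> u \<in> ?V}"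
      have "finite (fst ` ?G0)" by (rule finite_subset[of _ ?V]) (use F in auto)
      moreover have "inj_on fst ?G0" using sU by (auto simp: inj_on_def)
      ultimately have "finite ?G0" by (rule finite_imageD)
      moreover have "?G0 \<subseteq> ?U" by auto
      ultimately obtain G where G: "G \<in> \<C>" "?G0 \<subseteq> G"
        by (rule finite_subset_Union_chain[OF _ _ ne ch])
      obtain e where e: "\<forall>u a. (u, a) \<in> G \<longrightarrow> e u = a" "\<forall>\<phi>\<in>F. sat M e \<phi>"
        using gd[OF G(1), unfolded good_def, THEN conjunct2, rule_format, OF F] by blast
      define e' where "e' u = (if u \<in> fst ` ?U then THE a. (u, a) \<in> ?U else e u)" for u
      have e'U: "e' u = a" if "(u, a) \<in> ?U" for u a
      proof -
        have "u \<in> fst ` ?U" using that by force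
        moreover have "(THE a. (u, a) \<in> ?U) = a" using that sU by (intro the_equality) auto
        ultimately show ?thesis unfolding e'_def by simp
      qed
      have "e' u = e u" if "u \<in> ?V" for u
      proof (cases "u \<in> fst ` ?U")
        case True
        then obtain a where a: "(u, a) \<in> ?U" by fastforce
        then have "(u, a) \<in> G" using G(2) that by blast
        then show ?thesis using e(1) e'U[OF a] by auto
      qed (simp add: e'_def)
      then have "sat M e' \<phi> \<longleftrightarrow> sat M e \<phi>" if "\<phi> \<in> F" for \<phi>
        using that by (intro sat_cong) blast
      then have "\<forall>\<phi>\<in>F. sat M e' \<phi>" using e(2) by blast
      then show "\<exists>e. (\<forall>u a. (u, a) \<in> ?U \<longrightarrow> e u = a) \<and> (\<forall>\<phi>\<in>F. sat M e \<phi>)" using e'U by blast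
    qed
    then show "?U \<in> Collect good" by simp
  qed
  then obtain G where G: "good G" and max: "\<And>H. good H \<Longrightarrow> G \<subseteq> H \<Longrightarrow> H = G" by auto
  define gv where "gv u = (THE a. (u, a) \<in> G)" for u
  have gv: "gv u = a" if "(u, a) \<in> G" for u a
    unfolding gv_def using that sv[OF G] by blast
  have gv': "(u, gv u) \<in> G" if "u \<in> fst ` G" for u using that gv by fastforce
  have "X \<subseteq> fst ` G"
  proof
    fix v assume v: "v \<in> X"
    show "v \<in> fst ` G"
    proof (rule ccontr)
      assume nv: "v \<notin> fst ` G"
      let ?E = "D \<union> gv ` (fst ` G)"
      have "fst ` G \<subseteq> X" using G unfolding good_def by auto
      then have "|fst ` G| <o \<kappa>" by (rule small_subset[OF X])
      then have E: "|?E| <o \<kappa>" by (rule small_Un[OF D small_image])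
      \<comment> \<open>The condition that a finite part of \<open>p\<close> puts on the value of
        \<open>v\<close> is definable over \<open>?E\<close>: values fixed by \<open>G\<close>
        become parameters, and the remaining variables \<open>us\<close> are quantified away. This
        brings the problem into the scope of saturation for one variable.\<close>
      have key: "\<exists>\<psi>\<in>fms L ?E {v}. \<forall>e. sat M e \<psi> \<longleftrightarrow>
          (\<exists>e'. e' v = e v \<and> (\<forall>u a. (u, a) \<in> G \<longrightarrow> e' u = a) \<and> (\<forall>\<phi>\<in>F. sat M e' \<phi>))"
        if F: "F \<subseteq> p" "finite F" for F
      proof -
        let ?V = "\<Union>\<phi>\<in>F. fv \<phi>"
        have finV: "finite ?V" using F by auto
        obtain ws where ws: "set ws = ?V" using finite_list[OF finV] by auto
        have fin': "finite (?V - {v} - fst ` G)" using finV by auto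
        obtain us where us: "set us = ?V - {v} - fst ` G" using finite_list[OF fin'] by auto
        let ?P = "\<lambda>xs. \<forall>\<phi>\<in>F. sat M (asg ws xs) \<phi>"
        have P: "Def D (length ws) ?P"
        proof (rule Def_Ball[OF F(2)])
          fix \<phi> assume "\<phi> \<in> F"
          then have "\<phi> \<in> fms L D (set ws)" using F p ws by (auto simp: fms_def)
          then show "Def D (length ws) (\<lambda>xs. sat M (asg ws xs) \<phi>)" by (rule fm_Def)
        qed
        have Pe: "?P (map e ws) \<longleftrightarrow> (\<forall>\<phi>\<in>F. sat M e \<phi>)" for e
        proof -
          have "sat M (asg ws (map e ws)) \<phi> \<longleftrightarrow> sat M e \<phi>" if "\<phi> \<in> F" for \<phi>
            using that ws by (intro sat_asg_map) auto
          then show ?thesis by auto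
        qed
        have length_v: "length [v] = 1" by simp
        let ?s = "\<lambda>u l. if u = v then l ! 0 else if u \<in> fst ` G then gv u else l ! Suc (pos us u)"
        let ?t = "\<lambda>l. map (\<lambda>u. ?s u l) ws"
        have "tuple_subst ?E (1 + length us) ?t"
        proof (rule tuple_subst_map)
          fix u assume u: "u \<in> set ws"
          consider "u = v" | "u \<noteq> v" "u \<in> fst ` G" | "u \<noteq> v" "u \<notin> fst ` G" by blast
          then show "tuple_subst ?E (1 + length us) (\<lambda>l. [?s u l])"
          proof cases
            case 2
            then show ?thesis by (simp add: tuple_subst_const)
          next
            case 3
            then have "u \<in> set us" using us ws u by auto
            then show ?thesis using 3 pos_less[of u us] by (simp add: tuple_subst_nth)
          qed (simp add: tuple_subst_nth)
        qed
        then have "Def ?E (1 + length us) (\<lambda>l. ?P (?t l))"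
          by (intro Def_tuple_subst[OF P]) auto
        from Def_fm[OF Def_ex[OF this], of "[v]", OF length_v, unfolded list.map list.set] obtain \<psi> where \<psi>: "\<psi> \<in> fms L ?E {v}"
          "\<And>e. sat M e \<psi> \<longleftrightarrow> (\<exists>y. length y = length us \<and> ?P (?t ([e v] @ y)))"
          by blast
        have "sat M e \<psi> \<longleftrightarrow> (\<exists>e'. e' v = e v \<and> (\<forall>u a. (u, a) \<in> G \<longrightarrow> e' u = a) \<and> (\<forall>\<phi>\<in>F. sat M e' \<phi>))" for e
        proof
          assume "sat M e \<psi>"
          then obtain y where y: "?P (?t ([e v] @ y))" unfolding \<psi>(2) by blast
          define e' where "e' u = ?s u ([e v] @ y)" for u
          have eq: "?t ([e v] @ y) = map e' ws" unfolding e'_def by (rule refl)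
          have "\<forall>\<phi>\<in>F. sat M e' \<phi>" using y unfolding eq Pe .
          moreover have "e' u = a" if "(u, a) \<in> G" for u a
          proof -
            have "u \<in> fst ` G" using that by force
            then show ?thesis using gv[OF that] nv unfolding e'_def by auto
          qed
          moreover have "e' v = e v" by (simp add: e'_def)
          ultimately show "\<exists>e'. e' v = e v \<and> (\<forall>u a. (u, a) \<in> G \<longrightarrow> e' u = a) \<and> (\<forall>\<phi>\<in>F. sat M e' \<phi>)" by blast
        next
          assume "\<exists>e'. e' v = e v \<and> (\<forall>u a. (u, a) \<in> G \<longrightarrow> e' u = a) \<and> (\<forall>\<phi>\<in>F. sat M e' \<phi>)"
          then obtain e' where e': "e' v = e v" "\<forall>u a. (u, a) \<in> G \<longrightarrow> e' u = a" "\<forall>\<phi>\<in>F. sat M e' \<phi>" by blast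
          have eq: "?t ([e v] @ map e' us) = map e' ws"
          proof (rule map_cong[OF refl])
            fix u assume u: "u \<in> set ws"
            consider "u = v" | "u \<noteq> v" "u \<in> fst ` G" | "u \<noteq> v" "u \<notin> fst ` G" by blast
            then show "?s u ([e v] @ map e' us) = e' u"
            proof cases
              case 2
              then have "e' u = gv u" using e'(2) gv' by blast
              then show ?thesis using 2 by simp
            next
              case 3
              then have "u \<in> set us" using us ws u by auto
              then show ?thesis using 3 pos_less[of u us] nth_pos[of u us] by simp
            qed (use e' in auto)
          qed
          have "?P (?t ([e v] @ map e' us))" unfolding eq Pe by (rule e'(3))
          then show "sat M e \<psi>" unfolding \<psi>(2) by (intro exI[of _ "map e' us"] conjI length_map)
        qed
        then show ?thesis using \<psi>(1) by blast
      qed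
      have "\<forall>F\<in>{F. F \<subseteq> p \<and> finite F}. \<exists>\<psi>. \<psi> \<in> fms L ?E {v} \<and> (\<forall>e. sat M e \<psi> \<longleftrightarrow>
          (\<exists>e'. e' v = e v \<and> (\<forall>u a. (u, a) \<in> G \<longrightarrow> e' u = a) \<and> (\<forall>\<phi>\<in>F. sat M e' \<phi>)))"
        using key unfolding Bex_def by simp
      from bchoice[OF this] obtain \<psi> where \<psi>0: "\<forall>F\<in>{F. F \<subseteq> p \<and> finite F}. \<psi> F \<in> fms L ?E {v} \<and>
          (\<forall>e. sat M e (\<psi> F) \<longleftrightarrow>
            (\<exists>e'. e' v = e v \<and> (\<forall>u a. (u, a) \<in> G \<longrightarrow> e' u = a) \<and> (\<forall>\<phi>\<in>F. sat M e' \<phi>)))" ..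
      have \<psi>: "\<And>F. F \<subseteq> p \<Longrightarrow> finite F \<Longrightarrow> \<psi> F \<in> fms L ?E {v}"
        "\<And>F e. F \<subseteq> p \<Longrightarrow> finite F \<Longrightarrow> sat M e (\<psi> F) \<longleftrightarrow>
          (\<exists>e'. e' v = e v \<and> (\<forall>u a. (u, a) \<in> G \<longrightarrow> e' u = a) \<and> (\<forall>\<phi>\<in>F. sat M e' \<phi>))"
        using \<psi>0 by simp_all
      let ?q = "\<psi> ` {F. F \<subseteq> p \<and> finite F}"
      have "consistent M ?q" unfolding consistent_def
      proof (intro allI impI)
        fix Q assume Q: "Q \<subseteq> ?q" "finite Q"
        obtain \<F> where \<F>: "\<F> \<subseteq> {F. F \<subseteq> p \<and> finite F}" "finite \<F>" "Q = \<psi> ` \<F>"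
          using finite_subset_image[OF Q(2,1)] by (elim exE conjE)
        \<comment> \<open>Finitely many such conditions are met at once by an assignment that
          extends \<open>G\<close> and satisfies the union of their sets of formulas.\<close>
        have UF: "\<Union>\<F> \<subseteq> p" "finite (\<Union>\<F>)" using \<F> by auto
        obtain e where e: "\<forall>u a. (u, a) \<in> G \<longrightarrow> e u = a" "\<forall>\<phi>\<in>\<Union>\<F>. sat M e \<phi>"
          using G[unfolded good_def, THEN conjunct2, rule_format, OF UF] by blast
        have "sat M e (\<psi> F)" if F: "F \<in> \<F>" for F
        proof -
          have "F \<subseteq> p" "finite F" using F \<F>(1) by auto
          moreover have "\<forall>\<phi>\<in>F. sat M e \<phi>" using e(2) F by simp
          ultimately show ?thesis using e(1) by (subst \<psi>(2)) auto
        qed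
        then show "\<exists>e. \<forall>\<phi>\<in>Q. sat M e \<phi>" using \<F>(3) by blast
      qed
      moreover have "?q \<subseteq> fms L ?E {v}" using \<psi>(1) by blast
      ultimately obtain e0 where e0: "\<forall>\<phi>\<in>?q. sat M e0 \<phi>"
        using saturated[unfolded saturated_def, rule_format, of ?E ?q v] E by blast
      have "good (insert (v, e0 v) G)" unfolding good_def
      proof (intro conjI allI impI)
        show "fst ` insert (v, e0 v) G \<subseteq> X" using G v unfolding good_def by auto
        fix F assume F: "F \<subseteq> p" "finite F"
        then have "sat M e0 (\<psi> F)" using e0 by blast
        then obtain e' where "e' v = e0 v" "\<forall>u a. (u, a) \<in> G \<longrightarrow> e' u = a" "\<forall>\<phi>\<in>F. sat M e' \<phi>"
          unfolding \<psi>(2)[OF F] by (elim exE conjE)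
        then show "\<exists>e. (\<forall>u a. (u, a) \<in> insert (v, e0 v) G \<longrightarrow> e u = a) \<and> (\<forall>\<phi>\<in>F. sat M e \<phi>)"
          by (intro exI[of _ e']) auto
      qed
      from max[OF this] nv show False by force
    qed
  qed
  have "sat M gv \<phi>" if \<phi>: "\<phi> \<in> p" for \<phi>
  proof -
    obtain e where e: "\<forall>u a. (u, a) \<in> G \<longrightarrow> e u = a" "sat M e \<phi>"
      using G[unfolded good_def, THEN conjunct2, rule_format, of "{\<phi>}"] \<phi> by auto
    have "gv u = e u" if "u \<in> fv \<phi>" for u
    proof -
      have "u \<in> fst ` G" using that \<phi> p \<open>X \<subseteq> fst ` G\<close> unfolding fms_def by blast
      then have "e u = gv u" using gv' e(1) by blast
      then show ?thesis by simp
    qed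
    then show ?thesis using e(2) sat_cong[of \<phi> gv e M] by simp
  qed
  then show ?thesis by blast
qed

text \<open>A constraint \<open>(ts, P)\<close> speaks about the concatenation of the tuples
  attached to the indices in \<open>ts\<close>. The index type is countable so that one variable for
  each pair of index and coordinate fits into a countable, hence small, set of variables. The
  indices will be \<open>nat\<close> for sequences, \<open>nat list\<close> for trees and
  \<open>unit\<close> for a single tuple.\<close>

lemma compactness:
  fixes \<Sigma> :: "('t :: countable list \<times> ('a list \<Rightarrow> bool)) set"
  assumes D: "|D| <o \<kappa>" and Def: "\<And>ts P. (ts, P) \<in> \<Sigma> \<Longrightarrow> Def D (n * length ts) P"
    and fin: "\<And>F. F \<subseteq> \<Sigma> \<Longrightarrow> finite F \<Longrightarrow>
      \<exists>y. (\<forall>t. length (y t) = n) \<and> (\<forall>ts P. (ts, P) \<in> F \<longrightarrow> P (concat (map y ts)))"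
  shows "\<exists>y. (\<forall>t. length (y t) = n) \<and> (\<forall>ts P. (ts, P) \<in> \<Sigma> \<longrightarrow> P (concat (map y ts)))"
proof -
  obtain i :: "nat \<Rightarrow> 'v" where i: "inj i" using infinite_countable_subset[OF infinite_UNIV] by auto
  define j where "j t k = i (to_nat (t :: 't, k :: nat))" for t k
  have j: "j t k = j t' k' \<longleftrightarrow> t = t' \<and> k = k'" for t t' k k'
    unfolding j_def using i by (auto dest: injD)
  define tup where "tup t = map (j t) [0..<n]" for t
  have tup: "map e (concat (map tup ts)) = concat (map (\<lambda>t. map (\<lambda>k. e (j t k)) [0..<n]) ts)"
    for e :: "'v \<Rightarrow> 'a" and ts
    unfolding tup_def by (induction ts) auto
  have "length (concat (map tup ts)) = n * length ts" for ts
    by (induction ts) (auto simp: tup_def)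
  then have "\<forall>c. \<exists>\<phi>. c \<in> \<Sigma> \<longrightarrow> \<phi> \<in> fms L D (range i) \<and>
     (\<forall>e. sat M e \<phi> \<longleftrightarrow> snd c (map e (concat (map tup (fst c)))))"
  proof (intro allI)
    fix c
    show "\<exists>\<phi>. c \<in> \<Sigma> \<longrightarrow> \<phi> \<in> fms L D (range i) \<and>
     (\<forall>e. sat M e \<phi> \<longleftrightarrow> snd c (map e (concat (map tup (fst c)))))"
    proof (cases "c \<in> \<Sigma>")
      case True
      then obtain ts P where c: "c = (ts, P)" "(ts, P) \<in> \<Sigma>" by (cases c) auto
      obtain \<phi> where \<phi>: "\<phi> \<in> fms L D (set (concat (map tup ts)))"
        "\<forall>e. sat M e \<phi> \<longleftrightarrow> P (map e (concat (map tup ts)))"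
        using Def_fm[OF Def[OF c(2)]] \<open>\<And>ts. length (concat (map tup ts)) = n * length ts\<close> by blast
      have "set (concat (map tup ts)) \<subseteq> range i" by (auto simp: tup_def j_def)
      then have "\<phi> \<in> fms L D (range i)" using \<phi>(1) unfolding fms_def by blast
      then show ?thesis using \<phi>(2) c by auto
    qed auto
  qed
  then obtain \<Phi> where \<Phi>: "\<And>c. c \<in> \<Sigma> \<Longrightarrow> \<Phi> c \<in> fms L D (range i)"
    "\<And>c e. c \<in> \<Sigma> \<Longrightarrow> sat M e (\<Phi> c) \<longleftrightarrow> snd c (map e (concat (map tup (fst c))))" by metis
  have "consistent M (\<Phi> ` \<Sigma>)" unfolding consistent_def
  proof (intro allI impI)
    fix Q assume "Q \<subseteq> \<Phi> ` \<Sigma>" "finite Q"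
    then obtain F where F: "F \<subseteq> \<Sigma>" "finite F" "Q = \<Phi> ` F" using finite_subset_image by metis
    obtain y where y: "\<And>t. length (y t) = n" "\<forall>ts P. (ts, P) \<in> F \<longrightarrow> P (concat (map y ts))"
      using fin[OF F(1,2)] by blast
    define e where "e v = (case from_nat (inv i v) of (t, k) \<Rightarrow> y t ! k)" for v
    have "e (j t k) = y t ! k" for t k
      unfolding e_def j_def using i by simp
    then have "map (\<lambda>k. e (j t k)) [0..<n] = y t" for t
      using y(1) by (auto intro!: nth_equalityI)
    then have "map e (concat (map tup ts)) = concat (map y ts)" for ts unfolding tup by simp
    then have "sat M e (\<Phi> c)" if "c \<in> F" for c
      using \<Phi>(2)[of c e] that F(1) y(2) by (cases c) auto
    then show "\<exists>e. \<forall>\<phi>\<in>Q. sat M e \<phi>" using F(3) by blast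
  qed
  moreover have "\<Phi> ` \<Sigma> \<subseteq> fms L D (range i)" using \<Phi>(1) by blast
  ultimately obtain e where e: "\<forall>\<phi>\<in>\<Phi> ` \<Sigma>. sat M e \<phi>"
    using realize_type[OF _ D small_range_nat] by blast
  have "P (concat (map (\<lambda>t. map (\<lambda>k. e (j t k)) [0..<n]) ts))" if "(ts, P) \<in> \<Sigma>" for ts P
    using e \<Phi>(2)[OF that] that tup by fastforce
  then show ?thesis by (intro exI[of _ "\<lambda>t. map (\<lambda>k. e (j t k)) [0..<n]"]) auto
qed

lemma homogeneous_list:
  assumes D: "|D| <o \<kappa>" and len: "length a' = length a"
    and tp: "\<And>P. Def D (length a) P \<Longrightarrow> P a \<Longrightarrow> P a'"
  shows "\<exists>g\<in>Aut D. map g a = a'"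
proof -
  define h where "h z = (if z \<in> D then z else a' ! pos a z)" for z
  \<comment> \<open>Entries of \<open>a\<close> may coincide with elements of \<open>D\<close> or
    with one another; the equality recording this belongs to the type of \<open>a\<close> and so
    holds for \<open>a'\<close>.\<close>
  have "h (a ! i) = a' ! i" if i: "i < length a" for i
  proof (cases "a ! i \<in> D")
    case True
    have "Def D (length a) (\<lambda>x. (x @ [a ! i]) ! i = (x @ [a ! i]) ! length a)"
      using True i by (intro Def_instance[where D = D and R = "\<lambda>x. x ! i = x ! length a"] Def_eq) auto
    from tp[OF this] show ?thesis using True i len by (simp add: h_def nth_append)
  next
    case False
    have "Def D (length a) (\<lambda>x. x ! pos a (a ! i) = x ! i)"
      using i by (intro Def_eq) (auto simp: pos_less)
    from tp[OF this] show ?thesis using False i nth_pos[of "a ! i" a] by (simp add: h_def)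
  qed
  then have ha: "map h a = a'" using len by (auto intro: nth_equalityI)
  have "elementary_map L M (D \<union> set a) h" unfolding elementary_map_def
  proof (intro ballI allI)
    fix \<phi> :: "('f,'r,'v,'a) fm" and e assume \<phi>: "\<phi> \<in> fms L (D \<union> set a) {}"
    obtain us :: "'v list" where us: "distinct us" "length us = length a"
      using ex_distinct_list by blast
    \<comment> \<open>Parameters outside \<open>D\<close> belong to \<open>a\<close> and become
      variables, so that a sentence over \<open>D \<union> set a\<close> turns into a relation over
      \<open>D\<close> evaluated at \<open>a\<close>.\<close>
    define \<rho> where "\<rho> z = (if z \<in> D then Par z else Var (us ! pos a z) :: ('f,'v,'a) trm)" for z
    have wf\<rho>: "\<And>z. wf_trm L (\<rho> z)" by (simp add: \<rho>_def)
    have wf: "wf_fm L \<phi>" "fv \<phi> = {}" "fm_params \<phi> \<subseteq> D \<union> set a" using \<phi> by (auto simp: fms_def)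
    obtain \<phi>' where \<phi>': "wf_fm L \<phi>'"
      "fv \<phi>' \<subseteq> (\<Union>v\<in>fv \<phi>. trm_vars (Var v :: ('f,'v,'a) trm)) \<union> (\<Union>a\<in>fm_params \<phi>. trm_vars (\<rho> a))"
      "fm_params \<phi>' \<subseteq> (\<Union>v\<in>fv \<phi>. trm_params (Var v :: ('f,'v,'a) trm)) \<union> (\<Union>a\<in>fm_params \<phi>. trm_params (\<rho> a))"
      "\<And>e. sat M e \<phi>' \<longleftrightarrow> sat M (\<lambda>v. val M e (Var v)) (rename_params (\<lambda>a. val M e (\<rho> a)) \<phi>)"
      using fm_subst[of L \<phi> Var \<rho> M] wf(1) wf\<rho> by auto
    have "\<phi>' \<in> fms L D (set us)"
    proof -
      have "fv \<phi>' \<subseteq> set us"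
      proof
        fix v assume "v \<in> fv \<phi>'"
        then obtain z where "z \<in> fm_params \<phi>" "v \<in> trm_vars (\<rho> z)" using \<phi>'(2) wf(2) by auto
        then show "v \<in> set us"
          using wf(3) us pos_less[of z a] by (auto simp: \<rho>_def split: if_splits)
      qed
      moreover have "fm_params \<phi>' \<subseteq> D"
        using \<phi>'(3) wf(2) by (auto simp: \<rho>_def split: if_splits)
      ultimately show ?thesis using \<phi>'(1) by (simp add: fms_def)
    qed
    then have Def: "Def D (length a) (\<lambda>xs. sat M (asg us xs) \<phi>')" using fm_Def us(2) by metis
    have ev: "sat M (asg us (map k a)) \<phi>' \<longleftrightarrow> sat M e (rename_params k \<phi>)"
      if k: "\<And>z. z \<in> D \<Longrightarrow> k z = z" for k
    proof -
      have "rename_params (\<lambda>z. val M (asg us (map k a)) (\<rho> z)) \<phi> = rename_params k \<phi>"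
      proof (rule rename_params_cong)
        fix z assume "z \<in> fm_params \<phi>"
        then have "z \<in> D \<or> z \<in> set a" using wf(3) by blast
        then show "val M (asg us (map k a)) (\<rho> z) = k z"
          using k us pos_less[of z a] nth_pos[of z a] by (auto simp: \<rho>_def asg_def pos_nth)
      qed
      then have "sat M (asg us (map k a)) \<phi>' \<longleftrightarrow> sat M (asg us (map k a)) (rename_params k \<phi>)"
        unfolding \<phi>'(4) by simp
      also have "\<dots> \<longleftrightarrow> sat M e (rename_params k \<phi>)" using wf(2) by (intro sat_cong) simp
      finally show ?thesis .
    qed
    \<comment> \<open>The hypothesis leads from \<open>a\<close> to \<open>a'\<close> only; its use
      for the negation gives the converse.\<close>
    have "sat M (asg us a) \<phi>' \<longleftrightarrow> sat M (asg us a') \<phi>'"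
      using tp[OF Def] tp[OF Def_not[OF Def]] by blast
    moreover have "sat M (asg us a) \<phi>' \<longleftrightarrow> sat M e \<phi>"
      using ev[of "\<lambda>z. z"] by (simp add: rename_params_ident)
    moreover have "sat M (asg us a') \<phi>' \<longleftrightarrow> sat M e (rename_params h \<phi>)"
      using ev[of h] ha by (simp add: h_def)
    ultimately show "sat M e (rename_params h \<phi>) \<longleftrightarrow> sat M e \<phi>" by simp
  qed
  moreover have "|D \<union> set a| <o \<kappa>" by (intro small_Un D small_finite) auto
  ultimately obtain g where g: "automorphism L M g" "\<forall>d\<in>D \<union> set a. g d = h d"
    using homogeneous unfolding strongly_homogeneous_def by blast
  then have "g \<in> Aut D" unfolding Aut_def by (auto simp: h_def)
  moreover have "map g a = a'" using g(2) ha by auto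
  ultimately show ?thesis by blast
qed

end

section \<open>Dividing\<close>

definition slice :: "nat \<Rightarrow> nat \<Rightarrow> 'x list \<Rightarrow> 'x list" where
  "slice m i l = take m (drop (i * m) l)"

lemma length_slice: "i < N \<Longrightarrow> length l = N * m \<Longrightarrow> length (slice m i l) = m"
proof -
  assume "i < N" "length l = N * m"
  moreover have "Suc i * m \<le> N * m" using \<open>i < N\<close> by (intro mult_le_mono1) simp
  ultimately show ?thesis unfolding slice_def by simp
qed

lemma slice_concat:
  assumes "\<And>t. length (y t) = m" "i < length ts"
  shows "slice m i (concat (map y ts)) = y (ts ! i)"
  using assms(2)
proof (induction ts arbitrary: i)
  case (Cons t ts)
  then show ?case using assms(1) by (cases i) (auto simp: slice_def)
qed simp

lemma length_concat_map: "(\<And>t. length (y t) = m) \<Longrightarrow> length (concat (map y ts)) = length ts * m"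
  by (induction ts) auto

lemma tuple_subst_slice: "tuple_subst E k t \<Longrightarrow> tuple_subst E k (\<lambda>x. slice m i (t x))"
  unfolding slice_def by (intro tuple_subst_take tuple_subst_drop)

lemma k_inconsistent_mono:
  assumes "k_inconsistent k P" "\<And>i x. Q i x \<Longrightarrow> P i x"
  shows "k_inconsistent k Q"
  using assms unfolding k_inconsistent_def by blast

lemma k_inconsistent_reindex:
  fixes f :: "nat \<Rightarrow> nat"
  assumes "k_inconsistent k P" "inj f"
  shows "k_inconsistent k (\<lambda>i. P (f i))"
  unfolding k_inconsistent_def
proof (intro allI impI, elim conjE)
  fix I :: "nat set" assume I: "finite I" "card I = k"
  then have "finite (f ` I)" "card (f ` I) = k"
    using assms(2) by (auto simp: card_image inj_on_subset)
  then have "\<not> (\<exists>e. \<forall>i\<in>f ` I. P i e)" using assms(1) unfolding k_inconsistent_def by blast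
  then show "\<not> (\<exists>e. \<forall>i\<in>I. P (f i) e)" by blast
qed

context monster
begin

text \<open>Conjugating the parameters of \<open>P\<close> over \<open>C\<close> is expressed by letting automorphisms over
  \<open>C\<close> act on the points of \<open>P\<close>, so that parameters need not be mentioned.\<close>

definition kdiv :: "nat \<Rightarrow> 'a set \<Rightarrow> nat \<Rightarrow> ('a list \<Rightarrow> bool) \<Rightarrow> bool" where
  "kdiv k C n P \<longleftrightarrow> (\<exists>g :: nat \<Rightarrow> 'a \<Rightarrow> 'a. (\<forall>i. g i \<in> Aut C) \<and>
     k_inconsistent k (\<lambda>i x. length x = n \<and> P (map (g i) x)))"

definition fork :: "'a set \<Rightarrow> nat \<Rightarrow> ('a list \<Rightarrow> bool) \<Rightarrow> bool" where
  "fork C n P \<longleftrightarrow> (\<exists>F. finite F \<and> (\<forall>Q\<in>F. Def UNIV n Q \<and> (\<exists>k. kdiv k C n Q)) \<and>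
     (\<forall>x. length x = n \<longrightarrow> P x \<longrightarrow> (\<exists>Q\<in>F. Q x)))"

text \<open>\<open>dnd C b B\<close> and \<open>dnf C b B\<close>: the type \<open>tp(b/B)\<close> does not divide, respectively
  does not fork, over \<open>C\<close>.\<close>

definition dnd :: "'a set \<Rightarrow> 'a list \<Rightarrow> 'a set \<Rightarrow> bool" where
  "dnd C b B \<longleftrightarrow> (\<forall>P k. Def B (length b) P \<longrightarrow> P b \<longrightarrow> \<not> kdiv k C (length b) P)"

definition dnf :: "'a set \<Rightarrow> 'a list \<Rightarrow> 'a set \<Rightarrow> bool" where
  "dnf C b B \<longleftrightarrow> (\<forall>P. Def B (length b) P \<longrightarrow> P b \<longrightarrow> \<not> fork C (length b) P)"

lemma kdiv_cong:
  assumes "kdiv k C n P" "\<And>x. length x = n \<Longrightarrow> P x \<longleftrightarrow> Q x"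
  shows "kdiv k C n Q"
  using assms unfolding kdiv_def k_inconsistent_def by (metis length_map)

lemma kdiv_base_mono: "kdiv k D n P \<Longrightarrow> C \<subseteq> D \<Longrightarrow> kdiv k C n P"
  unfolding kdiv_def using Aut_mono by blast

text \<open>The conjugating automorphisms fix \<open>C\<close> and hence \<open>b\<close>; if
  \<open>P\<close> held at \<open>b\<close>, all conjugates would hold there together.\<close>

lemma kdiv_not_sat:
  assumes "kdiv k C n P" "set b \<subseteq> C" "length b = n"
  shows "\<not> P b"
proof
  assume P: "P b"
  obtain g where g: "\<And>i. g i \<in> Aut C" "k_inconsistent k (\<lambda>i x. length x = n \<and> P (map (g i) x))"
    using assms(1) unfolding kdiv_def by blast
  obtain I :: "nat set" where I: "finite I" "card I = k"
    using infinite_arbitrarily_large[OF infinite_UNIV_nat] by blast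
  have "\<forall>i\<in>I. length b = n \<and> P (map (g i) b)"
    using Aut_map[OF g(1) assms(2)] assms(3) P by simp
  then show False using g(2) I unfolding k_inconsistent_def by blast
qed

lemma kdiv_conj_Aut:
  assumes "kdiv k C n P" "h \<in> Aut C"
  shows "kdiv k C n (\<lambda>x. P (map h x))"
proof -
  obtain g where g: "\<And>i. g i \<in> Aut C" "k_inconsistent k (\<lambda>i x. length x = n \<and> P (map (g i) x))"
    using assms(1) unfolding kdiv_def by blast
  have "inv h \<circ> g i \<in> Aut C" for i using g(1) Aut_inv[OF assms(2)] by (rule Aut_comp[rotated])
  moreover have "map h (map (inv h \<circ> g i) x) = map (g i) x" for i x
    using Aut_inv_cancel(2)[OF assms(2)] by simp
  ultimately show ?thesis using g(2) unfolding kdiv_def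
    by (intro exI[of _ "\<lambda>i. inv h \<circ> g i"]) (simp del: map_map)
qed

text \<open>Dividing asks for an infinite sequence of conjugates of \<open>a\<close> over
  \<open>E\<close>. By compactness it suffices to find, for each \<open>S\<close> in the type of
  \<open>a\<close> over \<open>E\<close> and each \<open>N\<close>, a \<open>k\<close>-inconsistent
  sequence of \<open>N\<close> tuples satisfying \<open>S\<close>; homogeneity turns realizations of
  the type into conjugates.\<close>

lemma kdiv_compact:
  assumes E: "|E| <o \<kappa>" and R: "Def E (n + length a) R"
    and seqs: "\<And>S (N :: nat). Def E (length a) S \<Longrightarrow> S a \<Longrightarrow> N > 0 \<Longrightarrow>
      \<exists>c. (\<forall>i<N. length (c i) = length a \<and> S (c i)) \<and>
        (\<forall>I\<subseteq>{..<N}. card I = k \<longrightarrow> \<not> (\<exists>x. length x = n \<and> (\<forall>i\<in>I. R (x @ c i))))"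
  shows "kdiv k E n (\<lambda>x. R (x @ a))"
proof -
  let ?m = "length a"
  let ?K = "\<lambda>l. \<not> (\<exists>x. length x = n \<and> (\<forall>j\<in>{..<k}. R (x @ slice ?m j l)))"
  let ?\<Sigma> = "{([i], S) | i S. Def E ?m S \<and> S a} \<union> {(ts, ?K) | ts :: nat list. distinct ts \<and> length ts = k}"
  have K: "Def E (?m * k) ?K"
  proof -
    have "Def E (?m * k + n) (\<lambda>l. \<forall>j\<in>{..<k}. R (drop (?m * k) l @ slice ?m j (take (?m * k) l)))"
      by (intro Def_Ball Def_tuple_subst[OF R] tuple_subst_intros tuple_subst_slice)
        (auto simp: length_slice[of _ k] mult.commute)
    from Def_not[OF Def_ex[OF this]] show ?thesis by (rule Def_cong) auto
  qed
  have "\<exists>y. (\<forall>t. length (y t) = ?m) \<and> (\<forall>ts P. (ts, P) \<in> ?\<Sigma> \<longrightarrow> P (concat (map y ts)))"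
  proof (rule compactness[OF E])
    fix ts :: "nat list" and P assume "(ts, P) \<in> ?\<Sigma>"
    then show "Def E (?m * length ts) P" using K by auto
  next
    fix F assume F: "F \<subseteq> ?\<Sigma>" "finite F"
    define \<S> where "\<S> = {S \<in> snd ` F. Def E ?m S \<and> S a}"
    have fS: "finite \<S>" using F(2) unfolding \<S>_def by auto
    define S where "S = (\<lambda>x. \<forall>S\<in>\<S>. S x)"
    have S: "Def E ?m S" "S a"
      unfolding S_def using Def_Ball[OF fS, of E ?m "\<lambda>S. S"] by (auto simp: \<S>_def)
    have "finite (\<Union>ts\<in>fst ` F. set ts)" using F(2) by auto
    then obtain N where N: "\<forall>i\<in>(\<Union>ts\<in>fst ` F. set ts). i < N" using finite_nat_set_iff_bounded by auto
    \<comment> \<open>The length is \<open>Suc N\<close> because \<open>seqs\<close> asks for a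
      positive one.\<close>
    obtain c where c: "\<And>i. i < Suc N \<Longrightarrow> length (c i) = ?m \<and> S (c i)"
      "\<And>I. I \<subseteq> {..<Suc N} \<Longrightarrow> card I = k \<Longrightarrow> \<not> (\<exists>x. length x = n \<and> (\<forall>i\<in>I. R (x @ c i)))"
      using seqs[OF S, of "Suc N"] by auto
    define y where "y i = (if i < Suc N then c i else a)" for i
    have ly: "length (y t) = ?m" for t unfolding y_def using c(1) by auto
    have "P (concat (map y ts))" if tsP: "(ts, P) \<in> F" for ts P
    proof -
      have tsN: "set ts \<subseteq> {..<Suc N}" using N tsP by force
      consider i where "ts = [i]" "Def E ?m P" "P a" | "P = ?K" "distinct ts" "length ts = k"
        using F(1) tsP by auto
      then show ?thesis
      proof cases
        case 1
        then have "P \<in> \<S>" using tsP unfolding \<S>_def by force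
        moreover have "S (c i)" using c(1) tsN 1 by auto
        ultimately show ?thesis using 1 tsN by (auto simp: S_def y_def)
      next
        case 2
        have no: "\<not> (\<exists>x. length x = n \<and> (\<forall>i\<in>set ts. R (x @ c i)))"
          using c(2)[OF tsN] 2 by (simp add: distinct_card)
        have sl: "slice ?m j (concat (map y ts)) = c (ts ! j)" if j: "j < k" for j
        proof -
          have "ts ! j \<in> set ts" using j 2(3) by simp
          then have "ts ! j < Suc N" using tsN by (metis lessThan_iff subsetD)
          then show ?thesis using slice_concat[of y ?m j ts, OF ly] j 2 by (simp add: y_def)
        qed
        show ?thesis unfolding 2(1)
        proof
          assume "\<exists>x. length x = n \<and> (\<forall>j\<in>{..<k}. R (x @ slice ?m j (concat (map y ts))))"
          then obtain x where x: "length x = n" "\<And>j. j < k \<Longrightarrow> R (x @ c (ts ! j))" using sl by auto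
          then have "\<forall>i\<in>set ts. R (x @ c i)" using 2(3) by (auto simp: in_set_conv_nth)
          then show False using no x(1) by blast
        qed
      qed
    qed
    then show "\<exists>y. (\<forall>t. length (y t) = ?m) \<and> (\<forall>ts P. (ts, P) \<in> F \<longrightarrow> P (concat (map y ts)))"
      using ly by blast
  qed
  then obtain y where y: "\<And>t. length (y t) = ?m" "\<And>ts P. (ts, P) \<in> ?\<Sigma> \<Longrightarrow> P (concat (map y ts))"
    by blast
  have "\<exists>g\<in>Aut E. map g a = y i" for i
  proof (rule homogeneous_list[OF E y(1)])
    fix P assume "Def E ?m P" "P a"
    then have "([i], P) \<in> ?\<Sigma>" by auto
    from y(2)[OF this] show "P (y i)" by simp
  qed
  then obtain g where g: "\<And>i. g i \<in> Aut E" "\<And>i. map (g i) a = y i" by metis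
  have "k_inconsistent k (\<lambda>i x. length x = n \<and> R (x @ y i))"
    unfolding k_inconsistent_def
  proof (intro allI impI notI, elim conjE exE)
    fix I :: "nat set" and x
    assume I: "finite I" "card I = k" "\<forall>i\<in>I. length x = n \<and> R (x @ y i)"
    show False
    \<comment> \<open>For \<open>k = 0\<close> the set \<open>I\<close> is empty and says nothing
      about the length of \<open>x\<close>; but then the constraint for the empty list of indices
      denies that a list of length \<open>n\<close> exists.\<close>
    proof (cases "k = 0")
      case True
      then have "?K []" using y(2)[of "[]" ?K] by auto
      then show False using True Ex_list_of_length[of n] by auto
    next
      case False
      then have "I \<noteq> {}" using I by auto
      then have x: "length x = n" using I by auto
      define ts where "ts = sorted_list_of_set I"
      have ts: "set ts = I" "distinct ts" "length ts = k" using I unfolding ts_def by auto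
      have K: "?K (concat (map y ts))" by (rule y(2)) (use ts in blast)
      have "R (x @ slice ?m j (concat (map y ts)))" if j: "j < k" for j
      proof -
        have "slice ?m j (concat (map y ts)) = y (ts ! j)" using j ts by (intro slice_concat y(1)) simp
        moreover have "ts ! j \<in> I" using j ts nth_mem by blast
        ultimately show ?thesis using I(3) by simp
      qed
      then show False using K x by blast
    qed
  qed
  then have "k_inconsistent k (\<lambda>i x. length x = n \<and> R (map (inv (g i)) x @ a))"
  proof (rule k_inconsistent_mono)
    fix i x assume x: "length x = n \<and> R (map (inv (g i)) x @ a)"
    have "R (map (g i) (map (inv (g i)) x @ a)) \<longleftrightarrow> R (map (inv (g i)) x @ a)"
      using x by (intro Def_Aut[OF R g(1)]) simp
    then show "length x = n \<and> R (x @ y i)"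
      using x Aut_inv_cancel(4)[OF g(1)] g(2) by (simp del: map_map)
  qed
  then show ?thesis unfolding kdiv_def using Aut_inv[OF g(1)]
    by (intro exI[of _ "\<lambda>i. inv (g i)"]) auto
qed

section \<open>Monotonicity and passage to subtuples\<close>

lemma dnd_mono: "dnd C b B \<Longrightarrow> B' \<subseteq> B \<Longrightarrow> dnd C b B'"
  unfolding dnd_def using Def_mono by blast

lemma dnd_base_mono: "dnd C b B \<Longrightarrow> C \<subseteq> C' \<Longrightarrow> dnd C' b B"
  unfolding dnd_def using kdiv_base_mono by blast

lemma dnf_mono: "dnf C b B \<Longrightarrow> B' \<subseteq> B \<Longrightarrow> dnf C b B'"
  unfolding dnf_def using Def_mono by blast

lemma dnf_dnd: "dnf C b B \<Longrightarrow> dnd C b B"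
  unfolding dnf_def dnd_def fork_def
proof (intro allI impI notI)
  fix P k assume *: "\<forall>P. Def B (length b) P \<longrightarrow> P b \<longrightarrow>
     \<not> (\<exists>F. finite F \<and> (\<forall>Q\<in>F. Def UNIV (length b) Q \<and> (\<exists>k. kdiv k C (length b) Q)) \<and>
          (\<forall>x. length x = length b \<longrightarrow> P x \<longrightarrow> (\<exists>Q\<in>F. Q x)))"
    "Def B (length b) P" "P b" "kdiv k C (length b) P"
  have "Def UNIV (length b) P" using *(2) Def_mono by blast
  then show False using *(1)[rule_format, OF *(2,3)] *(4) by (auto dest!: spec[of _ "{P}"])
qed

text \<open>Automorphisms act coordinatewise, so selecting coordinates commutes with conjugation,
  and a common solution in \<open>m\<close> variables projects to one in \<open>n\<close>
  variables.\<close>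

lemma kdiv_reindex:
  assumes "kdiv k C n P" "\<And>i. i \<in> set js \<Longrightarrow> i < m" "length js = n"
  shows "kdiv k C m (\<lambda>x. P (map (nth x) js))"
proof -
  obtain g where g: "\<And>i. g i \<in> Aut C" "k_inconsistent k (\<lambda>i x. length x = n \<and> P (map (g i) x))"
    using assms(1) unfolding kdiv_def by blast
  have "k_inconsistent k (\<lambda>i x. length x = m \<and> P (map (nth (map (g i) x)) js))"
    unfolding k_inconsistent_def
  proof (intro allI impI notI, elim conjE exE)
    fix I :: "nat set" and x
    assume I: "finite I" "card I = k" "\<forall>i\<in>I. length x = m \<and> P (map (nth (map (g i) x)) js)"
    have "map (nth (map (g i) x)) js = map (g i) (map (nth x) js)" if "i \<in> I" for i
      using I(3) that assms(2) by auto
    then have "\<forall>i\<in>I. length (map (nth x) js) = n \<and> P (map (g i) (map (nth x) js))"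
      using I(3) assms(3) by (metis length_map)
    then show False using g(2) I(1,2) unfolding k_inconsistent_def by blast
  qed
  then show ?thesis unfolding kdiv_def using g(1) by blast
qed

lemma dnd_sub:
  assumes "dnd C b B" "set a \<subseteq> set b"
  shows "dnd C a B"
  unfolding dnd_def
proof (intro allI impI notI)
  fix P k assume P: "Def B (length a) P" "P a" "kdiv k C (length a) P"
  obtain js where js: "length js = length a" "\<forall>i\<in>set js. i < length b"
    "map (nth b) js = a" using ex_index_list[OF assms(2)] by metis
  have "Def B (length b) (\<lambda>x. P (map (nth x) js))"
    using js by (intro Def_tuple_subst[OF P(1)] tuple_subst_map_nth tuple_subst_id) auto
  moreover have "kdiv k C (length b) (\<lambda>x. P (map (nth x) js))"
    using js by (intro kdiv_reindex[OF P(3)]) auto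
  ultimately show False using assms(1) P(2) js(3) unfolding dnd_def by metis
qed

text \<open>If \<open>b\<^sub>i\<close> witnesses dividing over \<open>D\<close> and \<open>\<theta>(z)\<close> says that \<open>S'(y,z)\<close> contains a
  \<open>k\<close>-inconsistent sequence of length \<open>N\<close>, then \<open>S'(b,z) \<and> \<not> \<theta>(z)\<close> divides over \<open>D\<close>, so it
  does not hold of \<open>a\<close>.\<close>

lemma kdiv_extend:
  assumes small: "|D \<union> A| <o \<kappa>" and Q: "Def (D \<union> set b) n Q"
    and indep: "\<And>a. set a \<subseteq> A \<Longrightarrow> dnd D a (D \<union> set b)" and kdiv: "kdiv k D n Q"
  shows "kdiv k (D \<union> A) n Q"
proof -
  let ?m = "length b"
  obtain R where R: "Def D (n + ?m) R" "\<And>x. length x = n \<Longrightarrow> Q x \<longleftrightarrow> R (x @ b)"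
    using Def_abstract_list[OF Q] by blast
  obtain g where g: "\<And>i. g i \<in> Aut D" "k_inconsistent k (\<lambda>i x. length x = n \<and> Q (map (g i) x))"
    using kdiv unfolding kdiv_def by blast
  \<comment> \<open>Moving the automorphisms from the points to the parameters yields the conjugates
    \<open>c i\<close> of \<open>b\<close> over \<open>D\<close>, along which \<open>R\<close> is
    \<open>k\<close>-inconsistent.\<close>
  define c where "c i = map (inv (g i)) b" for i
  have lc: "length (c i) = ?m" for i by (simp add: c_def)
  have shift: "S (map (g i) x @ b) \<longleftrightarrow> S (x @ c i)" if "Def D (length x + ?m) S" for S i x
  proof -
    have "S (map (g i) (x @ c i)) \<longleftrightarrow> S (x @ c i)"
      using that by (intro Def_Aut[OF _ g(1)]) (auto simp: lc)
    then show ?thesis using Aut_inv_cancel(4)[OF g(1)] by (simp add: c_def del: map_map)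
  qed
  have Rinc: "k_inconsistent k (\<lambda>i x. length x = n \<and> R (x @ c i))"
    using g(2) by (rule k_inconsistent_mono) (use R shift in auto)
  have "kdiv k (D \<union> A) n (\<lambda>x. R (x @ b))"
  proof (rule kdiv_compact[OF small])
    show "Def (D \<union> A) (n + ?m) R" using R(1) by (rule Def_mono) auto
  next
    fix S and N :: nat assume S: "Def (D \<union> A) ?m S" "S b" and N: "N > 0"
    obtain a S' where a: "set a \<subseteq> A" "Def D (?m + length a) S'"
      "\<And>x. length x = ?m \<Longrightarrow> S x \<longleftrightarrow> S' (x @ a)" using Def_abstract[OF S(1)] by blast
    let ?r = "length a"
    let ?\<I> = "{I. I \<subseteq> {..<N} \<and> card I = k}"
    \<comment> \<open>The sequence is coded as one list \<open>Y\<close> and quantified, so that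
      \<open>\<theta>\<close> is definable over \<open>D\<close> alone and unaffected by conjugation
      over \<open>D\<close>.\<close>
    define \<theta> where "\<theta> = (\<lambda>z. \<exists>Y. length Y = N * ?m \<and> (\<forall>i\<in>{..<N}. S' (slice ?m i Y @ z)) \<and>
      (\<forall>I\<in>?\<I>. \<not> (\<exists>x. length x = n \<and> (\<forall>i\<in>I. R (x @ slice ?m i Y)))))"
    have \<theta>: "Def D ?r \<theta>"
    proof -
      let ?w = "?r + N * ?m"
      have fin: "finite ?\<I>" by simp
      have 1: "Def D ?w (\<lambda>l. \<forall>i\<in>{..<N}. S' (slice ?m i (drop ?r l) @ take ?r l))"
        by (intro Def_Ball Def_tuple_subst[OF a(2)] tuple_subst_intros tuple_subst_slice) (auto simp: length_slice[of _ N])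
      have 2: "Def D ?w (\<lambda>l. \<forall>I\<in>?\<I>. \<not> (\<exists>x. length x = n \<and> (\<forall>i\<in>I. R (x @ slice ?m i (drop ?r l)))))"
      proof (rule Def_Ball[OF fin])
        fix I assume I: "I \<in> ?\<I>"
        have fI: "finite I" using I finite_subset by auto
        have len: "length (slice ?m i (drop ?r (take ?w l))) = ?m" if "i \<in> I" "length l = ?w + n" for i l
          using that I by (intro length_slice[of _ N]) auto
        have "Def D (?w + n) (\<lambda>l. \<forall>i\<in>I. R (drop ?w l @ slice ?m i (drop ?r (take ?w l))))"
          using fI by (intro Def_Ball Def_tuple_subst[OF R(1)] tuple_subst_intros tuple_subst_slice) (auto simp: len)
        from Def_not[OF Def_ex[OF this]]
        show "Def D ?w (\<lambda>l. \<not> (\<exists>x. length x = n \<and> (\<forall>i\<in>I. R (x @ slice ?m i (drop ?r l)))))"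
          by (rule Def_cong) simp
      qed
      from Def_ex[OF Def_conj[OF 1 2]] show ?thesis unfolding \<theta>_def by (rule Def_cong) auto
    qed
    have "\<theta> a"
    proof (rule ccontr)
      assume "\<not> \<theta> a"
      let ?U = "\<lambda>z. S' (b @ z) \<and> \<not> \<theta> z"
      have "Def (D \<union> set b) ?r (\<lambda>z. S' (b @ z))"
        by (intro Def_tuple_subst[OF a(2)] tuple_subst_intros) auto
      moreover have "Def (D \<union> set b) ?r (\<lambda>z. \<not> \<theta> z)" using Def_not[OF \<theta>] by (rule Def_mono) auto
      ultimately have "Def (D \<union> set b) ?r ?U" by (rule Def_conj)
      moreover have "?U a" using \<open>\<not> \<theta> a\<close> S(2) a(3) by simp
      \<comment> \<open>The degree is the wanted length \<open>N\<close>: failure of dividing along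
        the same \<open>g\<close> gives one \<open>z\<close> with \<open>S' (c i @ z)\<close> for
        \<open>N\<close> indices \<open>i\<close>. These \<open>c i\<close> form a sequence as
        required by \<open>\<theta> z\<close>, whereas invariance gives
        \<open>\<not> \<theta> z\<close>.\<close>
      ultimately have "\<not> kdiv N D ?r ?U" using indep[OF a(1)] unfolding dnd_def by blast
      then have "\<not> k_inconsistent N (\<lambda>i z. length z = ?r \<and> ?U (map (g i) z))"
        unfolding kdiv_def using g(1) by blast
      then obtain I z where I: "finite I" "card I = N" "\<forall>i\<in>I. length z = ?r \<and> ?U (map (g i) z)"
        unfolding k_inconsistent_def by blast
      then obtain i0 where "i0 \<in> I" using N by fastforce
      then have z: "length z = ?r" "\<not> \<theta> z" using I(3) Def_Aut[OF \<theta> g(1)] by auto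
      have S'z: "S' (c i @ z)" if "i \<in> I" for i
      proof -
        have "S' (map (g i) (c i @ z)) \<longleftrightarrow> S' (c i @ z)"
          using z by (intro Def_Aut[OF a(2) g(1)]) (simp add: lc)
        moreover have "map (g i) (c i) = b" using Aut_inv_cancel(4)[OF g(1)] by (simp add: c_def del: map_map)
        ultimately show ?thesis using I(3) that by simp
      qed
      define ts where "ts = sorted_list_of_set I"
      have ts: "set ts = I" "distinct ts" "length ts = N" using I unfolding ts_def by auto
      let ?Y = "concat (map c ts)"
      have sl: "slice ?m i ?Y = c (ts ! i)" if "i < N" for i
        using slice_concat[of c ?m i ts, OF lc] that ts by simp
      have "\<theta> z" unfolding \<theta>_def
      proof (intro exI[of _ ?Y] conjI ballI)
        show "length ?Y = N * ?m" using length_concat_map[of c ?m ts, OF lc] ts by simp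
        show "S' (slice ?m i ?Y @ z)" if "i \<in> {..<N}" for i
          using that sl ts nth_mem[of i ts] S'z by auto
        fix J assume J: "J \<in> ?\<I>"
        show "\<not> (\<exists>x. length x = n \<and> (\<forall>i\<in>J. R (x @ slice ?m i ?Y)))"
        proof
          assume "\<exists>x. length x = n \<and> (\<forall>i\<in>J. R (x @ slice ?m i ?Y))"
          then obtain x where x: "length x = n" "\<forall>i\<in>J. R (x @ slice ?m i ?Y)" by blast
          have JN: "J \<subseteq> {..<N}" "card J = k" using J by auto
          have "inj_on (nth ts) J" using JN ts(2,3) by (intro inj_on_nth) auto
          then have "finite (nth ts ` J)" "card (nth ts ` J) = k"
            using JN finite_subset by (auto simp: card_image)
          moreover have "R (x @ c (ts ! i))" if "i \<in> J" for i
          proof -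
            have "i < N" using that JN by auto
            then show ?thesis using that x(2) sl[of i] by metis
          qed
          then have "\<forall>i\<in>nth ts ` J. length x = n \<and> R (x @ c i)" using x(1) by blast
          ultimately show False using Rinc unfolding k_inconsistent_def by blast
        qed
      qed
      then show False using z by simp
    qed
    then obtain Y where Y: "length Y = N * ?m" "\<forall>i\<in>{..<N}. S' (slice ?m i Y @ a)"
      "\<forall>I\<in>?\<I>. \<not> (\<exists>x. length x = n \<and> (\<forall>i\<in>I. R (x @ slice ?m i Y)))" unfolding \<theta>_def by blast
    have "length (slice ?m i Y) = ?m" if "i < N" for i using length_slice[OF that Y(1)] .
    then show "\<exists>c. (\<forall>i<N. length (c i) = ?m \<and> S (c i)) \<and>
        (\<forall>I\<subseteq>{..<N}. card I = k \<longrightarrow> \<not> (\<exists>x. length x = n \<and> (\<forall>i\<in>I. R (x @ c i))))"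
      using Y a(3) by (intro exI[of _ "\<lambda>i. slice ?m i Y"]) auto
  qed
  then show ?thesis by (rule kdiv_cong) (simp add: R(2))
qed

end

section \<open>The local rank\<close>

text \<open>\<open>rk \<Delta> n N S\<close> says that \<open>S\<close> has \<open>D(x, \<Delta>)\<close>-rank at least \<open>N\<close>; a member \<open>(R, m, k)\<close> of
  \<open>\<Delta>\<close> is a relation \<open>R(x, y)\<close> with \<open>|y| = m\<close> together with a degree \<open>k\<close> of inconsistency.\<close>

primrec rk :: "(('a list \<Rightarrow> bool) \<times> nat \<times> nat) set \<Rightarrow> nat \<Rightarrow> nat \<Rightarrow> ('a list \<Rightarrow> bool) \<Rightarrow> bool" where
  "rk \<Delta> n 0 S \<longleftrightarrow> (\<exists>x. length x = n \<and> S x)"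
| "rk \<Delta> n (Suc N) S \<longleftrightarrow> (\<exists>R m k c. (R, m, k) \<in> \<Delta> \<and> (\<forall>i. length (c i) = m) \<and>
     k_inconsistent k (\<lambda>i x. length x = n \<and> R (x @ c i)) \<and>
     (\<forall>i :: nat. rk \<Delta> n N (\<lambda>x. S x \<and> R (x @ c i))))"

lemma rk_mono:
  assumes "rk \<Delta> n N S" "\<And>x. length x = n \<Longrightarrow> S x \<Longrightarrow> S' x"
  shows "rk \<Delta> n N S'"
  using assms
proof (induction N arbitrary: S S')
  case (Suc N)
  then obtain R m k c where c: "(R, m, k) \<in> \<Delta>" "\<forall>i. length (c i) = m"
     "k_inconsistent k (\<lambda>i x. length x = n \<and> R (x @ c i))"
     "\<And>i :: nat. rk \<Delta> n N (\<lambda>x. S x \<and> R (x @ c i))" by auto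
  have "rk \<Delta> n N (\<lambda>x. S' x \<and> R (x @ c i))" for i
    by (rule Suc.IH[OF c(4)]) (use Suc.prems(2) in auto)
  then show ?case using c(1-3) by auto
qed auto

lemma rk_nonempty: "rk \<Delta> n N S \<Longrightarrow> \<exists>x. length x = n \<and> S x"
proof (induction N arbitrary: S)
  case (Suc N)
  then obtain R m k c where "(R, m, k) \<in> \<Delta>" "\<And>i :: nat. rk \<Delta> n N (\<lambda>x. S x \<and> R (x @ c i))" by auto
  from Suc.IH[OF this(2)] show ?case by blast
qed auto

text \<open>By induction each child keeps its rank inside some piece \<open>T j\<close>. One
  \<open>j\<close> serves infinitely many children, and passing to these preserves
  \<open>k\<close>-inconsistency.\<close>

lemma rk_union:
  assumes "finite J" "rk \<Delta> n N S" "\<And>x. length x = n \<Longrightarrow> S x \<Longrightarrow> \<exists>j\<in>J. T j x"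
  shows "\<exists>j\<in>J. rk \<Delta> n N (\<lambda>x. S x \<and> T j x)"
  using assms(2,3)
proof (induction N arbitrary: S)
  case 0
  then obtain x where x: "length x = n" "S x" by auto
  then obtain j where "j \<in> J" "T j x" using 0 by blast
  then show ?case using x by auto
next
  case (Suc N)
  then obtain R m k c where c: "(R, m, k) \<in> \<Delta>" "\<forall>i. length (c i) = m"
     "k_inconsistent k (\<lambda>i x. length x = n \<and> R (x @ c i))"
     "\<And>i :: nat. rk \<Delta> n N (\<lambda>x. S x \<and> R (x @ c i))" by auto
  have "\<exists>j\<in>J. rk \<Delta> n N (\<lambda>x. (S x \<and> R (x @ c i)) \<and> T j x)" for i
    by (rule Suc.IH[OF c(4)]) (use Suc.prems(2) in auto)
  then obtain j where j: "\<And>i. j i \<in> J" "\<And>i. rk \<Delta> n N (\<lambda>x. (S x \<and> R (x @ c i)) \<and> T (j i) x)" by metis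
  have "finite (range j)" using j(1) assms(1) by (auto intro: finite_subset)
  then obtain i0 where "infinite {i. j i = j i0}"
    using pigeonhole_infinite[of UNIV j] by auto
  then obtain f :: "nat \<Rightarrow> nat" where f: "strict_mono f" "\<And>i. f i \<in> {i. j i = j i0}"
    using infinite_enumerate by blast
  have "k_inconsistent k (\<lambda>i x. length x = n \<and> R (x @ c (f i)))"
    using k_inconsistent_reindex[OF c(3) strict_mono_imp_inj_on[OF f(1)]] .
  moreover have "rk \<Delta> n N (\<lambda>x. (S x \<and> T (j i0) x) \<and> R (x @ c (f i)))" for i
    using j(2)[of "f i"] by (rule rk_mono) (use f(2)[of i] in auto)
  ultimately have "rk \<Delta> n (Suc N) (\<lambda>x. S x \<and> T (j i0) x)" using c(1,2)
    by (simp only: rk.simps) (intro exI[of _ R] exI[of _ m] exI[of _ k] exI[of _ "\<lambda>i. c (f i)"], simp)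
  then show ?case using j(1) by blast
qed

text \<open>A pigeonhole principle on trees. Let \<open>?d\<close> label the root and lower a
  positive \<open>f ?d\<close> by one: either every child attains the lowered value for
  \<open>?d\<close>, so that the root attains \<open>f ?d\<close>, or some child attains
  \<open>f \<delta>\<close> for another \<open>\<delta>\<close>.\<close>

lemma rk_single:
  assumes "finite \<Delta>" "\<Delta> \<noteq> {}" "rk \<Delta> n N S" "(\<Sum>\<delta>\<in>\<Delta>. f \<delta>) \<le> N"
  shows "\<exists>\<delta>\<in>\<Delta>. rk {\<delta>} n (f \<delta>) S"
  using assms(3,4)
proof (induction N arbitrary: S f)
  case 0
  then have "\<forall>\<delta>\<in>\<Delta>. f \<delta> = 0" using assms(1) by simp
  then show ?case using 0 assms(2) by auto
next
  case (Suc N)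
  then obtain R m k c where c: "(R, m, k) \<in> \<Delta>" "\<forall>i. length (c i) = m"
     "k_inconsistent k (\<lambda>i x. length x = n \<and> R (x @ c i))"
     "\<And>i :: nat. rk \<Delta> n N (\<lambda>x. S x \<and> R (x @ c i))" by auto
  let ?d = "(R, m, k)"
  show ?case
  proof (cases "f ?d")
    case 0
    then show ?thesis using c(1) rk_nonempty[OF Suc.prems(1)] by (intro bexI[of _ ?d]) auto
  next
    case (Suc N')
    let ?f = "f(?d := N')"
    have "(\<Sum>\<delta>\<in>\<Delta>. ?f \<delta>) \<le> N"
    proof -
      have "(\<Sum>\<delta>\<in>\<Delta>. f \<delta>) = f ?d + (\<Sum>\<delta>\<in>\<Delta> - {?d}. f \<delta>)" using assms(1) c(1) by (rule sum.remove)
      moreover have "(\<Sum>\<delta>\<in>\<Delta>. ?f \<delta>) = ?f ?d + (\<Sum>\<delta>\<in>\<Delta> - {?d}. ?f \<delta>)" using assms(1) c(1) by (rule sum.remove)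
      moreover have "(\<Sum>\<delta>\<in>\<Delta> - {?d}. ?f \<delta>) = (\<Sum>\<delta>\<in>\<Delta> - {?d}. f \<delta>)" by (rule sum.cong) auto
      ultimately show ?thesis using Suc.prems(2) Suc by simp
    qed
    from Suc.IH[OF c(4) this]
    have step: "\<exists>\<delta>\<in>\<Delta>. rk {\<delta>} n (?f \<delta>) (\<lambda>x. S x \<and> R (x @ c i))" for i .
    show ?thesis
    proof (cases "\<forall>i. rk {?d} n N' (\<lambda>x. S x \<and> R (x @ c i))")
      case True
      then have "rk {?d} n (Suc N') S" using c(2,3) by auto
      then show ?thesis using c(1) Suc by metis
    next
      case False
      then obtain i where i: "\<not> rk {?d} n N' (\<lambda>x. S x \<and> R (x @ c i))" by blast
      obtain \<delta> where \<delta>: "\<delta> \<in> \<Delta>" "rk {\<delta>} n (?f \<delta>) (\<lambda>x. S x \<and> R (x @ c i))" using step by blast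
      then have "\<delta> \<noteq> ?d" using i by auto
      then have "rk {\<delta>} n (f \<delta>) (\<lambda>x. S x \<and> R (x @ c i))" using \<delta>(2) by simp
      then have "rk {\<delta>} n (f \<delta>) S" by (rule rk_mono) simp
      then show ?thesis using \<delta>(1) by blast
    qed
  qed
qed

lemma rk_tree:
  assumes "rk {(R, m, k)} n N S"
  shows "\<exists>y :: nat list \<Rightarrow> 'a list. (\<forall>s. length (y s) = m) \<and>
    (\<forall>s. length s \<le> N \<longrightarrow> (\<exists>x. length x = n \<and> S x \<and> (\<forall>j\<in>{1..length s}. R (x @ y (take j s))))) \<and>
    (\<forall>s. length s < N \<longrightarrow> k_inconsistent k (\<lambda>i x. length x = n \<and> R (x @ y (s @ [i]))))"
  using assms
proof (induction N arbitrary: S)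
  case 0
  then show ?case by (intro exI[of _ "\<lambda>_. replicate m undefined"]) auto
next
  case (Suc N)
  then obtain c where c: "\<And>i. length (c i) = m"
     "k_inconsistent k (\<lambda>i x. length x = n \<and> R (x @ c i))"
     "\<And>i :: nat. rk {(R, m, k)} n N (\<lambda>x. S x \<and> R (x @ c i))" by auto
  have "\<forall>i. \<exists>y. (\<forall>s. length (y s) = m) \<and>
    (\<forall>s. length s \<le> N \<longrightarrow> (\<exists>x. length x = n \<and> (S x \<and> R (x @ c i)) \<and> (\<forall>j\<in>{1..length s}. R (x @ y (take j s))))) \<and>
    (\<forall>s. length s < N \<longrightarrow> k_inconsistent k (\<lambda>i x. length x = n \<and> R (x @ y (s @ [i]))))"
    by (rule allI, rule Suc.IH[OF c(3)])
  from choice[OF this] obtain Y where Y0: "\<forall>i. (\<forall>s. length (Y i s) = m) \<and>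
    (\<forall>s. length s \<le> N \<longrightarrow> (\<exists>x. length x = n \<and> (S x \<and> R (x @ c i)) \<and> (\<forall>j\<in>{1..length s}. R (x @ Y i (take j s))))) \<and>
    (\<forall>s. length s < N \<longrightarrow> k_inconsistent k (\<lambda>i' x. length x = n \<and> R (x @ Y i (s @ [i']))))" ..
  have Y: "\<And>i s. length (Y i s) = m"
    "\<And>i s. length s \<le> N \<Longrightarrow> \<exists>x. length x = n \<and> (S x \<and> R (x @ c i)) \<and> (\<forall>j\<in>{1..length s}. R (x @ Y i (take j s)))"
    "\<And>i s. length s < N \<Longrightarrow> k_inconsistent k (\<lambda>i' x. length x = n \<and> R (x @ Y i (s @ [i'])))"
    using Y0 by simp_all
  \<comment> \<open>The root carries no instance of \<open>R\<close>, so its tuple is a dummy of the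
    right length; the node \<open>[i]\<close> gets \<open>c i\<close>, and deeper nodes come from
    the tree for child \<open>i\<close>.\<close>
  define y where "y s = (case s of [] \<Rightarrow> replicate m undefined | i # s' \<Rightarrow> if s' = [] then c i else Y i s')" for s
  show ?case
  proof (intro exI[of _ y] conjI allI impI)
    fix s
    show "length (y s) = m" using c(1) Y(1) by (auto simp: y_def split: list.split)
  next
    fix s :: "nat list" assume s: "length s \<le> Suc N"
    show "\<exists>x. length x = n \<and> S x \<and> (\<forall>j\<in>{1..length s}. R (x @ y (take j s)))"
    proof (cases s)
      case Nil
      then show ?thesis using rk_nonempty[OF Suc.prems] by auto
    next
      case (Cons i s')
      obtain x where x: "length x = n" "S x" "R (x @ c i)" "\<forall>j\<in>{1..length s'}. R (x @ Y i (take j s'))"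
        using Y(2)[of s' i] s Cons by auto
      have "R (x @ y (take j s))" if j: "j \<in> {1..length s}" for j
      proof (cases "j = 1")
        case True
        then show ?thesis using x(3) Cons by (simp add: y_def)
      next
        case False
        then obtain j' where j': "j = Suc j'" "j' \<in> {1..length s'}" using j Cons by (cases j) auto
        then have "take j' s' \<noteq> []" by auto
        then show ?thesis using x(4) j' Cons by (simp add: y_def)
      qed
      then show ?thesis using x(1,2) by blast
    qed
  next
    fix s :: "nat list" assume s: "length s < Suc N"
    show "k_inconsistent k (\<lambda>i x. length x = n \<and> R (x @ y (s @ [i])))"
    proof (cases s)
      case Nil
      then show ?thesis using c(2) by (simp add: y_def)
    next
      case (Cons i s')
      then show ?thesis using Y(3)[of s' i] s by (simp add: y_def)
    qed
  qed
qed

section \<open>Boundedness of the rank, and its growth under dividing\<close>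

context monster
begin

text \<open>Otherwise \<open>R\<close> has trees of every finite height, and compactness with finite
  sequences of naturals as indices joins them into one infinite tree that witnesses the tree
  property.\<close>

lemma rk_bound_single:
  assumes R: "Def {} (n + m) R"
  shows "\<exists>N. \<not> rk {(R, m, k)} n N (\<lambda>_. True)"
proof (rule ccontr)
  assume "\<not> ?thesis"
  then have all: "\<And>N. rk {(R, m, k)} n N (\<lambda>_. True)" by blast
  obtain c :: "nat \<Rightarrow> 'a list" where "k_inconsistent k (\<lambda>i x. length x = n \<and> R (x @ c i))"
    using all[of 1] by auto
  \<comment> \<open>In degree 0 the empty index set would refute inconsistency, so positive rank
    forces \<open>k > 0\<close>.\<close>
  then have "card ({} :: nat set) \<noteq> k" unfolding k_inconsistent_def by blast
  then have k: "k > 0" by simp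
  let ?B = "\<lambda>r l. \<exists>x. length x = n \<and> (\<forall>j\<in>{..r}. R (x @ slice m j l))"
  let ?K = "\<lambda>l. \<not> (\<exists>x. length x = n \<and> (\<forall>j\<in>{..<k}. R (x @ slice m j l)))"
  \<comment> \<open>All prefixes of \<open>s\<close>, including the empty one and \<open>s\<close>
    itself; hence \<open>Suc (length s)\<close> entries.\<close>
  let ?pre = "\<lambda>s :: nat list. map (\<lambda>j. take j s) [0..<Suc (length s)]"
  let ?\<Sigma> = "{(?pre s, ?B (length s)) | s. True} \<union>
     {(map (\<lambda>i. s @ [i]) js, ?K) | s js. distinct js \<and> length js = k}"
  have DB: "Def {} (m * Suc r) (?B r)" for r
  proof -
    have "Def {} (m * Suc r + n) (\<lambda>l. \<forall>j\<in>{..r}. R (drop (m * Suc r) l @ slice m j (take (m * Suc r) l)))"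
    proof (intro Def_Ball Def_tuple_subst[OF R] tuple_subst_intros tuple_subst_slice)
      fix j x assume "j \<in> {..r}" "length (x :: 'a list) = m * Suc r + n"
      then have "length (slice m j (take (m * Suc r) x)) = m"
        by (intro length_slice[of _ "Suc r"]) (auto simp: mult.commute)
      then show "length (drop (m * Suc r) x @ slice m j (take (m * Suc r) x)) = n + m"
        using \<open>length x = _\<close> by simp
    qed auto
    from Def_ex[OF this] show ?thesis by (rule Def_cong) simp
  qed
  have DK: "Def {} (m * k) ?K"
  proof -
    have "Def {} (m * k + n) (\<lambda>l. \<forall>j\<in>{..<k}. R (drop (m * k) l @ slice m j (take (m * k) l)))"
      by (intro Def_Ball Def_tuple_subst[OF R] tuple_subst_intros tuple_subst_slice)
        (auto simp: length_slice[of _ k] mult.commute)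
    from Def_not[OF Def_ex[OF this]] show ?thesis by (rule Def_cong) auto
  qed
  have "\<exists>y. (\<forall>t. length (y t) = m) \<and> (\<forall>ts P. (ts, P) \<in> ?\<Sigma> \<longrightarrow> P (concat (map y ts)))"
  proof (rule compactness[where D = "{}"])
    show "|{} :: 'a set| <o \<kappa>" by (rule small_finite) simp
  next
    fix ts P assume "(ts, P) \<in> ?\<Sigma>"
    then consider s where "ts = ?pre s" "P = ?B (length s)"
      | s js where "ts = map (\<lambda>i. s @ [i]) js" "P = ?K" "length js = k" by blast
    then show "Def {} (m * length ts) P"
    proof cases
      case 1
      then show ?thesis using DB[of "length s"] by (simp only: length_map length_upt diff_zero)
    next
      case 2
      then show ?thesis using DK by (simp only: length_map)
    qed
  next
    fix F assume F: "F \<subseteq> ?\<Sigma>" "finite F"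
    have "finite (length ` (\<Union>ts\<in>fst ` F. set ts))" using F(2) by auto
    then obtain N where N: "\<forall>i\<in>length ` (\<Union>ts\<in>fst ` F. set ts). i < N"
      using finite_nat_set_iff_bounded by auto
    obtain y where y: "\<And>s. length (y s) = m"
      "\<And>s. length s \<le> N + 2 \<Longrightarrow> \<exists>x. length x = n \<and> (\<forall>j\<in>{1..length s}. R (x @ y (take j s)))"
      "\<And>s. length s < N + 2 \<Longrightarrow> k_inconsistent k (\<lambda>i x. length x = n \<and> R (x @ y (s @ [i])))"
      using rk_tree[OF all[of "N + 2"]] by auto
    \<comment> \<open>The tree property imposes the formula at the root too, while
      \<open>rk_tree\<close> leaves the root blank. The subtree below \<open>[0]\<close> is used
      instead; its nodes lie one level deeper, for which height \<open>N + 2\<close> leaves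
      room.\<close>
    define y' where "y' s = y (0 # s)" for s
    have "P (concat (map y' ts))" if tsP: "(ts, P) \<in> F" for ts P
    proof -
      have tsN: "length t < N" if "t \<in> set ts" for t using N tsP that by force
      have len: "length (y' s) = m" for s using y(1) by (simp add: y'_def)
      consider s where "ts = ?pre s" "P = ?B (length s)"
        | s js where "ts = map (\<lambda>i. s @ [i]) js" "P = ?K" "distinct js" "length js = k"
        using F(1) tsP by blast
      then show ?thesis
      proof cases
        case 1
        have "s \<in> set ts" unfolding 1 by force
        then have "length (0 # s) \<le> N + 2" using tsN[of s] by simp
        from y(2)[OF this] obtain x where x: "length x = n" "\<And>j. j \<in> {1..length (0 # s)} \<Longrightarrow> R (x @ y (take j (0 # s)))"
          by blast
        have "R (x @ slice m j (concat (map y' ts)))" if j: "j \<le> length s" for j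
        proof -
          have "slice m j (concat (map y' ts)) = y' (ts ! j)"
            using slice_concat[of y' m j ts, OF len] j 1 by simp
          also have "ts ! j = take j s" unfolding 1 using j by (simp del: upt_Suc add: nth_append)
          also have "y' (take j s) = y (take (Suc j) (0 # s))" by (simp add: y'_def)
          finally have "slice m j (concat (map y' ts)) = y (take (Suc j) (0 # s))" .
          then show ?thesis using x(2)[of "Suc j"] j by simp
        qed
        then show ?thesis unfolding 1(2) using x(1) by auto
      next
        case 2
        have "js \<noteq> []" using 2 k by auto
        then have "s @ [hd js] \<in> set ts" unfolding 2 by auto
        then have "length (0 # s) < N + 2" using tsN by fastforce
        from y(3)[OF this] have inc: "k_inconsistent k (\<lambda>i x. length x = n \<and> R (x @ y' (s @ [i])))"
          by (simp add: y'_def)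
        show ?thesis unfolding 2(2)
        proof
          assume "\<exists>x. length x = n \<and> (\<forall>j\<in>{..<k}. R (x @ slice m j (concat (map y' ts))))"
          then obtain x where x: "length x = n" "\<And>j. j < k \<Longrightarrow> R (x @ slice m j (concat (map y' ts)))" by blast
          have "R (x @ y' (s @ [i]))" if i: "i \<in> set js" for i
          proof -
            obtain j where j: "j < k" "js ! j = i" using i 2(4) by (auto simp: in_set_conv_nth)
            then have "slice m j (concat (map y' ts)) = y' (s @ [i])"
              using slice_concat[of y' m j ts, OF len] 2 by simp
            then show ?thesis using x(2)[OF j(1)] by simp
          qed
          moreover have "finite (set js)" "card (set js) = k" using 2 by (auto simp: distinct_card)
          ultimately show False using inc x(1) unfolding k_inconsistent_def by blast
        qed
      qed
    qed
    then show "\<exists>y. (\<forall>t. length (y t) = m) \<and> (\<forall>ts P. (ts, P) \<in> F \<longrightarrow> P (concat (map y ts)))"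
      using y(1) by (intro exI[of _ y']) (auto simp: y'_def)
  qed
  then obtain y where y: "\<And>t. length (y t) = m" "\<And>ts P. (ts, P) \<in> ?\<Sigma> \<Longrightarrow> P (concat (map y ts))"
    by blast
  have branch: "\<exists>x. length x = n \<and> (\<forall>j\<le>length s. R (x @ y (take j s)))" for s
  proof -
    have "?B (length s) (concat (map y (?pre s)))" by (rule y(2)) blast
    then obtain x where x: "length x = n" "\<And>j. j \<le> length s \<Longrightarrow> R (x @ slice m j (concat (map y (?pre s))))"
      by auto
    have "slice m j (concat (map y (?pre s))) = y (take j s)" if j: "j \<le> length s" for j
    proof -
      have "slice m j (concat (map y (?pre s))) = y (?pre s ! j)"
        using j by (intro slice_concat y(1)) simp
      also have "?pre s ! j = take j s" using j by (simp del: upt_Suc add: nth_append)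
      finally show ?thesis .
    qed
    then show ?thesis using x by auto
  qed
  have incons: "k_inconsistent k (\<lambda>i x. length x = n \<and> R (x @ y (s @ [i])))" for s
    unfolding k_inconsistent_def
  proof (intro allI impI notI, elim conjE exE)
    fix I :: "nat set" and x
    assume I: "finite I" "card I = k" "\<forall>i\<in>I. length x = n \<and> R (x @ y (s @ [i]))"
    define js where "js = sorted_list_of_set I"
    have js: "set js = I" "distinct js" "length js = k" using I unfolding js_def by auto
    let ?ts = "map (\<lambda>i. s @ [i]) js"
    have K: "?K (concat (map y ?ts))" by (rule y(2)) (use js in blast)
    have "R (x @ slice m j (concat (map y ?ts)))" if j: "j < k" for j
    proof -
      have "slice m j (concat (map y ?ts)) = y (?ts ! j)" using j js by (intro slice_concat y(1)) simp
      moreover have "js ! j \<in> I" using j js nth_mem by blast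
      ultimately show ?thesis using I(3) j js by simp
    qed
    moreover have "length x = n" using I k by (metis card.empty ex_in_conv less_irrefl)
    ultimately show False using K by blast
  qed
  obtain us :: "'v list" where us: "distinct us" "length us = n + m"
    using ex_distinct_list by blast
  define xs where "xs = take n us"
  define ys where "ys = drop n us"
  have xy: "us = xs @ ys" "length xs = n" "length ys = m" "distinct xs" "distinct ys" "set xs \<inter> set ys = {}"
    using us unfolding xs_def ys_def by (auto simp: set_take_disj_set_drop_if_distinct)
  obtain \<phi> where \<phi>: "\<phi> \<in> fms L {} (set us)" "\<And>e. sat M e \<phi> \<longleftrightarrow> R (map e us)"
    using Def_fm[OF R us(2)] by blast
  have ev: "sat M (override_on (asg ys (y s)) e (set xs)) \<phi> \<longleftrightarrow> R (map e xs @ y s)" for s e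
  proof -
    have "map (override_on (asg ys (y s)) e (set xs)) xs = map e xs" by auto
    moreover have "map (override_on (asg ys (y s)) e (set xs)) ys = map (asg ys (y s)) ys"
      using xy(6) by (intro map_cong refl override_on_apply_notin) auto
    then have "map (override_on (asg ys (y s)) e (set xs)) ys = y s"
      using map_asg[OF xy(5), of "y s"] y(1) xy(3) by simp
    ultimately show ?thesis unfolding \<phi>(2) xy(1) by (simp del: map_eq_conv)
  qed
  have "tree_property M \<phi> (set xs)" unfolding tree_property_def
  proof (intro exI[of _ k] exI[of _ "\<lambda>s. asg ys (y s)"] conjI allI impI)
    fix \<eta> :: "nat \<Rightarrow> nat" and N :: "nat set" assume N: "finite N"
    \<comment> \<open>Inserting 0 keeps the maximum meaningful when \<open>N\<close> is
      empty.\<close>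
    define K where "K = Max (insert 0 N)"
    let ?s = "map \<eta> [0..<K]"
    obtain x where x: "length x = n" "\<And>j. j \<le> K \<Longrightarrow> R (x @ y (take j ?s))" using branch[of ?s] by auto
    have "sat M (override_on (asg ys (y (map \<eta> [0..<i]))) (asg xs x) (set xs)) \<phi>" if "i \<in> N" for i
    proof -
      have i: "i \<le> K" using N that unfolding K_def by auto
      then have "take i ?s = map \<eta> [0..<i]" by (simp add: take_map)
      then show ?thesis using x(2)[OF i] map_asg[OF xy(4), of x] x(1) xy(2) ev by simp
    qed
    then show "\<exists>e. \<forall>i\<in>N. sat M (override_on (asg ys (y (map \<eta> [0..<i]))) e (set xs)) \<phi>" by blast
  next
    fix s
    show "k_inconsistent k (\<lambda>i e. sat M (override_on (asg ys (y (s @ [i]))) e (set xs)) \<phi>)"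
      unfolding k_inconsistent_def ev
    proof (intro allI impI notI, elim conjE exE)
      fix I :: "nat set" and e assume I: "finite I" "card I = k" "\<forall>i\<in>I. R (map e xs @ y (s @ [i]))"
      then have "\<forall>i\<in>I. length (map e xs) = n \<and> R (map e xs @ y (s @ [i]))" using xy(2) by simp
      then show False using incons[of s] I(1,2) unfolding k_inconsistent_def by blast
    qed
  qed
  moreover have "\<phi> \<in> fms L {} UNIV" using \<phi>(1) unfolding fms_def by auto
  ultimately show False using no_tree_property by blast
qed

text \<open>Members are definable without parameters, so that \<open>rk\<close> is invariant under
  all automorphisms and its bound does not depend on the instances considered.\<close>

definition Def_family :: "nat \<Rightarrow> (('a list \<Rightarrow> bool) \<times> nat \<times> nat) set \<Rightarrow> bool" where
  "Def_family n \<Delta> \<longleftrightarrow> (\<forall>R m k. (R, m, k) \<in> \<Delta> \<longrightarrow> Def {} (n + m) R)"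

lemma Def_familyD: "Def_family n \<Delta> \<Longrightarrow> (R, m, k) \<in> \<Delta> \<Longrightarrow> Def {} (n + m) R"
  unfolding Def_family_def by blast

text \<open>By \<open>rk_single\<close>, the sum of the bounds for the individual members cannot be
  attained.\<close>

lemma rk_bound:
  assumes "finite \<Delta>" "Def_family n \<Delta>"
  shows "\<exists>N. \<not> rk \<Delta> n N (\<lambda>_. True)"
proof (cases "\<Delta> = {}")
  case True
  then show ?thesis by (intro exI[of _ 1]) auto
next
  case False
  have "\<forall>\<delta>\<in>\<Delta>. \<exists>N. \<not> rk {\<delta>} n N (\<lambda>_. True)"
  proof
    fix \<delta> assume "\<delta> \<in> \<Delta>"
    then show "\<exists>N. \<not> rk {\<delta>} n N (\<lambda>_. True)"
      using rk_bound_single[OF Def_familyD[OF assms(2)]] by (cases \<delta>) auto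
  qed
  then obtain f where f: "\<forall>\<delta>\<in>\<Delta>. \<not> rk {\<delta>} n (f \<delta>) (\<lambda>_. True)" by metis
  have "\<not> rk \<Delta> n (\<Sum>\<delta>\<in>\<Delta>. f \<delta>) (\<lambda>_. True)"
    using rk_single[OF assms(1) False, of n _ "\<lambda>_. True" f] f by blast
  then show ?thesis by blast
qed

lemma rk_Aut:
  assumes "Def_family n \<Delta>" "g \<in> Aut {}" "rk \<Delta> n N S"
  shows "rk \<Delta> n N (\<lambda>x. S (map g x))"
  using assms(3)
proof (induction N arbitrary: S)
  case 0
  then obtain x where "length x = n" "S x" by auto
  then show ?case using Aut_inv_cancel(4)[OF assms(2)]
    by (simp del: map_map) (metis length_map)
next
  case (Suc N)
  then obtain R m k c where c: "(R, m, k) \<in> \<Delta>" "\<And>i. length (c i) = m"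
     "k_inconsistent k (\<lambda>i x. length x = n \<and> R (x @ c i))"
     "\<And>i :: nat. rk \<Delta> n N (\<lambda>x. S x \<and> R (x @ c i))" by auto
  define c' where "c' i = map (inv g) (c i)" for i
  have R: "R (map g x @ c i) \<longleftrightarrow> R (x @ c' i)" if "length x = n" for x i
  proof -
    have "R (map g (x @ c' i)) \<longleftrightarrow> R (x @ c' i)"
      using that c(2) by (intro Def_Aut[OF Def_familyD[OF assms(1) c(1)] assms(2)]) (simp add: c'_def)
    then show ?thesis using Aut_inv_cancel(4)[OF assms(2)] by (simp add: c'_def del: map_map)
  qed
  have "k_inconsistent k (\<lambda>i x. length x = n \<and> R (x @ c' i))"
    unfolding k_inconsistent_def
  proof (intro allI impI notI, elim conjE exE)
    fix I :: "nat set" and x assume I: "finite I" "card I = k" "\<forall>i\<in>I. length x = n \<and> R (x @ c' i)"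
    then have "\<forall>i\<in>I. length (map g x) = n \<and> R (map g x @ c i)" using R by simp
    then show False using c(3) I(1,2) unfolding k_inconsistent_def by blast
  qed
  moreover have "rk \<Delta> n N (\<lambda>x. S (map g x) \<and> R (x @ c' i))" for i
    using Suc.IH[OF c(4)] by (rule rk_mono) (use R in auto)
  moreover have "\<forall>i. length (c' i) = m" using c(2) by (simp add: c'_def)
  ultimately show ?case using c(1) by auto
qed

text \<open>Dividing over \<open>E\<close> provides the children for the next level, namely the
  conjugates of \<open>a\<close>. As \<open>S\<close> is invariant over \<open>E\<close>,
  conjugation carries the conjunction of \<open>S\<close> with \<open>R (x @ a)\<close> to that of
  \<open>S\<close> with \<open>R (x @ c i)\<close>, so every child has rank at least
  \<open>N\<close>.\<close>

lemma rk_divide: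
  assumes \<Delta>: "Def_family n \<Delta>"
    and R: "(R, m, k) \<in> \<Delta>" "length a = m" and kdiv: "kdiv k E n (\<lambda>x. R (x @ a))"
    and S: "\<And>g x. g \<in> Aut E \<Longrightarrow> length x = n \<Longrightarrow> S (map g x) \<longleftrightarrow> S x"
    and rk: "rk \<Delta> n N (\<lambda>x. S x \<and> R (x @ a))"
  shows "rk \<Delta> n (Suc N) S"
proof -
  obtain g where g: "\<And>i. g i \<in> Aut E" "k_inconsistent k (\<lambda>i x. length x = n \<and> R (map (g i) x @ a))"
    using kdiv unfolding kdiv_def by blast
  have g0: "g i \<in> Aut {}" for i using g(1) by (rule Aut_mono) auto
  define c where "c i = map (inv (g i)) a" for i
  have Rc: "R (map (g i) x @ a) \<longleftrightarrow> R (x @ c i)" if "length x = n" for x i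
  proof -
    have "R (map (g i) (x @ c i)) \<longleftrightarrow> R (x @ c i)"
      using that R(2) by (intro Def_Aut[OF Def_familyD[OF \<Delta> R(1)] g0]) (simp add: c_def)
    then show ?thesis using Aut_inv_cancel(4)[OF g(1)] by (simp add: c_def del: map_map)
  qed
  have "k_inconsistent k (\<lambda>i x. length x = n \<and> R (x @ c i))"
    using g(2) by (rule k_inconsistent_mono) (use Rc in auto)
  moreover have "rk \<Delta> n N (\<lambda>x. S x \<and> R (x @ c i))" for i
    using rk_Aut[OF \<Delta> g0[of i] rk] by (rule rk_mono) (use Rc S[OF g(1)] in auto)
  moreover have "\<forall>i. length (c i) = m" using R(2) by (simp add: c_def)
  ultimately show ?thesis using R(1) by auto
qed

section \<open>Symmetry and transitivity\<close>

lemma fork_witnesses: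
  assumes "fork C n P"
  obtains F D R K where "finite F" "\<And>Q. Q \<in> F \<Longrightarrow> Def {} (n + length (D Q)) (R Q)"
    "\<And>Q x. Q \<in> F \<Longrightarrow> length x = n \<Longrightarrow> Q x \<longleftrightarrow> R Q (x @ D Q)" "\<And>Q. Q \<in> F \<Longrightarrow> kdiv (K Q) C n Q"
    "\<And>x. length x = n \<Longrightarrow> P x \<Longrightarrow> \<exists>Q\<in>F. Q x"
proof -
  obtain F where F: "finite F" "\<And>Q. Q \<in> F \<Longrightarrow> Def UNIV n Q \<and> (\<exists>k. kdiv k C n Q)"
    "\<And>x. length x = n \<Longrightarrow> P x \<Longrightarrow> \<exists>Q\<in>F. Q x" using assms unfolding fork_def by blast
  have "\<forall>Q\<in>F. \<exists>z. Def {} (n + length (fst z)) (fst (snd z)) \<and>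
     (\<forall>x. length x = n \<longrightarrow> Q x \<longleftrightarrow> fst (snd z) (x @ fst z)) \<and> kdiv (snd (snd z)) C n Q"
  proof
    fix Q assume "Q \<in> F"
    then obtain k where Q: "Def UNIV n Q" "kdiv k C n Q" using F(2) by blast
    obtain d R where "Def {} (n + length d) R" "\<forall>x. length x = n \<longrightarrow> Q x \<longleftrightarrow> R (x @ d)"
      using Def_params[OF Q(1)] by blast
    then show "\<exists>z. Def {} (n + length (fst z)) (fst (snd z)) \<and>
     (\<forall>x. length x = n \<longrightarrow> Q x \<longleftrightarrow> fst (snd z) (x @ fst z)) \<and> kdiv (snd (snd z)) C n Q"
      using Q(2) by (intro exI[of _ "(d, R, k)"]) simp
  qed
  from bchoice[OF this] obtain z where z: "\<forall>Q\<in>F. Def {} (n + length (fst (z Q))) (fst (snd (z Q))) \<and>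
     (\<forall>x. length x = n \<longrightarrow> Q x \<longleftrightarrow> fst (snd (z Q)) (x @ fst (z Q))) \<and> kdiv (snd (snd (z Q))) C n Q" ..
  show thesis
    by (rule that[of F "\<lambda>Q. fst (z Q)" "\<lambda>Q. fst (snd (z Q))" "\<lambda>Q. snd (snd (z Q))"]) (use F z in simp_all)
qed

text \<open>Measure \<open>P\<close> by the rank for the relations behind the dividing disjuncts. By
  \<open>rk_union\<close> some disjunct \<open>Q\<close> keeps the largest rank that
  \<open>P\<close> attains; but \<open>Q\<close> divides over \<open>C\<close> and \<open>P\<close>
  is invariant over \<open>C\<close>, so by \<open>rk_divide\<close> the rank of \<open>P\<close>
  would be larger by one.\<close>

lemma existence: "dnf C b C"
  unfolding dnf_def
proof (intro allI impI notI)
  let ?n = "length b"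
  fix P assume P: "Def C ?n P" "P b" and fork: "fork C ?n P"
  obtain F D R K where F: "finite F" and R: "\<And>Q. Q \<in> F \<Longrightarrow> Def {} (?n + length (D Q)) (R Q)"
    "\<And>Q x. Q \<in> F \<Longrightarrow> length x = ?n \<Longrightarrow> Q x \<longleftrightarrow> R Q (x @ D Q)" "\<And>Q. Q \<in> F \<Longrightarrow> kdiv (K Q) C ?n Q"
    and cover: "\<And>x. length x = ?n \<Longrightarrow> P x \<Longrightarrow> \<exists>Q\<in>F. Q x" by (rule fork_witnesses[OF fork]) (rule that, assumption+)
  define \<Delta> where "\<Delta> = (\<lambda>Q. (R Q, length (D Q), K Q)) ` F"
  have \<Delta>: "Def_family ?n \<Delta>" using R(1) unfolding \<Delta>_def Def_family_def by auto
  have fin\<Delta>: "finite \<Delta>" using F unfolding \<Delta>_def by simp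
  obtain N0 where "\<not> rk \<Delta> ?n N0 (\<lambda>_. True)" using rk_bound[OF fin\<Delta> \<Delta>] by blast
  then have ex: "\<not> rk \<Delta> ?n N0 P" using rk_mono[of \<Delta> ?n N0 P "\<lambda>_. True"] by auto
  \<comment> \<open>The least value not attained is positive because \<open>P\<close> holds of
    \<open>b\<close>, and its predecessor is attained.\<close>
  define N where "N = (LEAST N. \<not> rk \<Delta> ?n N P)"
  have N: "\<not> rk \<Delta> ?n N P" unfolding N_def using ex by (rule LeastI)
  have "rk \<Delta> ?n 0 P" using P(2) by auto
  then obtain N' where N': "N = Suc N'" using N by (cases N) auto
  then have "rk \<Delta> ?n N' P" using not_less_Least[of N' "\<lambda>N. \<not> rk \<Delta> ?n N P"] unfolding N_def by auto
  from rk_union[OF F this, of "\<lambda>Q. Q"] cover obtain Q where Q: "Q \<in> F" "rk \<Delta> ?n N' (\<lambda>x. P x \<and> Q x)" by blast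
  have RQ: "(R Q, length (D Q), K Q) \<in> \<Delta>" using Q(1) unfolding \<Delta>_def by blast
  have "rk \<Delta> ?n (Suc N') P"
  proof (rule rk_divide[OF \<Delta> RQ refl])
    show "kdiv (K Q) C ?n (\<lambda>x. R Q (x @ D Q))"
      using R(3)[OF Q(1)] by (rule kdiv_cong) (rule R(2)[OF Q(1)])
    show "P (map g x) \<longleftrightarrow> P x" if "g \<in> Aut C" "length x = ?n" for g x
      using Def_Aut[OF P(1) that] .
    show "rk \<Delta> ?n N' (\<lambda>x. P x \<and> R Q (x @ D Q))"
      using Q(2) by (rule rk_mono) (use R(2)[OF Q(1)] in auto)
  qed
  then show False using N N' by simp
qed

lemma fork_cover:
  assumes "finite \<Q>" "\<And>Q. Q \<in> \<Q> \<Longrightarrow> fork C n Q" "\<And>x. length x = n \<Longrightarrow> P x \<Longrightarrow> \<exists>Q\<in>\<Q>. Q x"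
  shows "fork C n P"
proof -
  have "\<forall>Q\<in>\<Q>. \<exists>F. finite F \<and> (\<forall>Q\<in>F. Def UNIV n Q \<and> (\<exists>k. kdiv k C n Q)) \<and>
     (\<forall>x. length x = n \<longrightarrow> Q x \<longrightarrow> (\<exists>Q\<in>F. Q x))" using assms(2) unfolding fork_def by blast
  from bchoice[OF this] obtain F where F: "\<forall>Q\<in>\<Q>. finite (F Q) \<and> (\<forall>Q\<in>F Q. Def UNIV n Q \<and> (\<exists>k. kdiv k C n Q)) \<and>
     (\<forall>x. length x = n \<longrightarrow> Q x \<longrightarrow> (\<exists>Q\<in>F Q. Q x))" ..
  show ?thesis unfolding fork_def
  proof (intro exI[of _ "\<Union>Q\<in>\<Q>. F Q"] conjI allI impI ballI)
    show "finite (\<Union>Q\<in>\<Q>. F Q)" using F assms(1) by blast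
    show "Def UNIV n Q" "\<exists>k. kdiv k C n Q" if "Q \<in> (\<Union>Q\<in>\<Q>. F Q)" for Q using that F by blast+
    fix x assume x: "length x = n" "P x"
    then obtain Q where "Q \<in> \<Q>" "Q x" using assms(3) by blast
    then show "\<exists>Q\<in>\<Union>Q\<in>\<Q>. F Q. Q x" using F x(1) by blast
  qed
qed

text \<open>Add to the type of \<open>b\<close> over \<open>B\<close> the negation of every forking
  relation over \<open>E\<close>. Were this inconsistent, finitely many forking relations would
  cover a relation in the type of \<open>b\<close> over \<open>B\<close>, which would itself fork by
  \<open>fork_cover\<close>.\<close>

lemma extension:
  assumes dnf: "dnf C b B" and "B \<subseteq> E" and E: "|E| <o \<kappa>"
  shows "\<exists>g\<in>Aut B. dnf C (map g b) E"
proof -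
  let ?n = "length b"
  let ?\<Sigma> = "{([()], P) | P. Def B ?n P \<and> P b} \<union> {([()], P) | P. Def E ?n P \<and> fork C ?n (\<lambda>x. \<not> P x)}"
  have "\<exists>y. (\<forall>t. length (y t) = ?n) \<and> (\<forall>ts P. (ts, P) \<in> ?\<Sigma> \<longrightarrow> P (concat (map y ts)))"
  proof (rule compactness[OF E])
    fix ts P assume "(ts, P) \<in> ?\<Sigma>"
    then show "Def E (?n * length ts) P" using Def_mono[OF _ assms(2)] by auto
  next
    fix F assume F: "F \<subseteq> ?\<Sigma>" "finite F"
    define \<P> where "\<P> = {P \<in> snd ` F. Def B ?n P \<and> P b}"
    define \<Q> where "\<Q> = {P \<in> snd ` F. Def E ?n P \<and> fork C ?n (\<lambda>x. \<not> P x)}"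
    have fin: "finite \<P>" "finite \<Q>" using F(2) unfolding \<P>_def \<Q>_def by auto
    have "\<exists>x. length x = ?n \<and> (\<forall>P\<in>\<P>. P x) \<and> (\<forall>P\<in>\<Q>. P x)"
    proof (rule ccontr)
      assume no: "\<not> ?thesis"
      have "fork C ?n (\<lambda>x. \<forall>P\<in>\<P>. P x)"
      proof (rule fork_cover[of "(\<lambda>P x. \<not> P x) ` \<Q>"])
        show "finite ((\<lambda>P x. \<not> P x) ` \<Q>)" using fin by simp
        show "fork C ?n Q" if "Q \<in> (\<lambda>P x. \<not> P x) ` \<Q>" for Q using that unfolding \<Q>_def by auto
        show "\<exists>Q\<in>(\<lambda>P x. \<not> P x) ` \<Q>. Q x" if "length x = ?n" "\<forall>P\<in>\<P>. P x" for x using no that by auto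
      qed
      moreover have "Def B ?n (\<lambda>x. \<forall>P\<in>\<P>. P x)" using fin(1) by (rule Def_Ball) (auto simp: \<P>_def)
      moreover have "\<forall>P\<in>\<P>. P b" by (auto simp: \<P>_def)
      ultimately show False using dnf unfolding dnf_def by blast
    qed
    then obtain x where x: "length x = ?n" "\<And>P. P \<in> \<P> \<Longrightarrow> P x" "\<And>P. P \<in> \<Q> \<Longrightarrow> P x" by blast
    have "P (concat (map (\<lambda>_. x) ts))" if tsP: "(ts, P) \<in> F" for ts P
    proof -
      have "P \<in> \<P> \<union> \<Q>" "ts = [()]" using F(1) tsP unfolding \<P>_def \<Q>_def by force+
      then show ?thesis using x by auto
    qed
    then show "\<exists>y. (\<forall>t. length (y t) = ?n) \<and> (\<forall>ts P. (ts, P) \<in> F \<longrightarrow> P (concat (map y ts)))"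
      using x(1) by (intro exI[of _ "\<lambda>_. x"] conjI allI impI)
  qed
  then obtain y where y: "\<And>t. length (y t) = ?n" "\<And>ts P. (ts, P) \<in> ?\<Sigma> \<Longrightarrow> P (concat (map y ts))"
    by blast
  have "\<exists>g\<in>Aut B. map g b = y ()"
  proof (rule homogeneous_list[OF small_subset[OF E assms(2)] y(1)])
    fix P assume "Def B ?n P" "P b"
    then have "([()], P) \<in> ?\<Sigma>" by blast
    from y(2)[OF this] show "P (y ())" by simp
  qed
  moreover have "dnf C (y ()) E" unfolding dnf_def y(1)
  proof (intro allI impI notI)
    fix Q assume Q: "Def E ?n Q" "Q (y ())" "fork C ?n Q"
    have "([()], \<lambda>x. \<not> Q x) \<in> ?\<Sigma>" using Def_not[OF Q(1)] Q(3) by simp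
    from y(2)[OF this] Q(2) show False by simp
  qed
  ultimately show ?thesis by metis
qed

section \<open>Free sequences and the rank they produce\<close>

lemma morley_sequence:
  assumes "dnf C a B" "|B| <o \<kappa>"
  shows "\<exists>g :: nat \<Rightarrow> 'a \<Rightarrow> 'a. \<forall>i. g i \<in> Aut B \<and>
    dnf C (map (g i) a) (B \<union> (\<Union>l<i. set (map (g l) a)))"
\<comment> \<open>Each term depends on all previous ones, not only on the last. The terms are
  conjugates of \<open>a\<close> over \<open>B\<close>, each free over \<open>C\<close> from
  \<open>B\<close> and its predecessors, with no indiscernibility demanded.\<close>
proof (rule dependent_wellorder_choice)
  fix r and f g :: "nat \<Rightarrow> 'a \<Rightarrow> 'a" and i
  assume "\<And>y. y < i \<Longrightarrow> f y = g y"
  then have "(\<Union>l<i. set (map (f l) a)) = (\<Union>l<i. set (map (g l) a))" by simp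
  then show "(r \<in> Aut B \<and> dnf C (map r a) (B \<union> (\<Union>l<i. set (map (f l) a)))) \<longleftrightarrow>
    (r \<in> Aut B \<and> dnf C (map r a) (B \<union> (\<Union>l<i. set (map (g l) a))))" by simp
next
  fix i and f :: "nat \<Rightarrow> 'a \<Rightarrow> 'a"
  have "|B \<union> (\<Union>l<i. set (map (f l) a))| <o \<kappa>" by (rule small_Un[OF assms(2) small_finite]) simp
  from extension[OF assms(1) _ this]
  show "\<exists>r. r \<in> Aut B \<and> dnf C (map r a) (B \<union> (\<Union>l<i. set (map (f l) a)))" by blast
qed

text \<open>The base grows by one term at a time in increasing order of the indices. A new term
  \<open>d b\<close> is free over \<open>C\<close> from \<open>d i\<close> and the terms already
  added, all of which precede it, so \<open>kdiv_extend\<close> preserves the degree.\<close>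

lemma morley_kdiv:
  assumes C: "|C| <o \<kappa>" and d: "\<And>i. dnf C (d i) (C \<union> (\<Union>l<i. set (d l)))"
    and Q: "Def (C \<union> set (d i)) n Q" "kdiv k C n Q"
    and "finite K" "\<And>l. l \<in> K \<Longrightarrow> i < (l :: nat)"
  shows "kdiv k (C \<union> (\<Union>l\<in>K. set (d l))) n Q"
  using assms(5,6)
proof (induction K rule: finite_linorder_max_induct)
  case empty
  then show ?case using Q(2) by simp
next
  case (insert b A)
  let ?D = "C \<union> (\<Union>l\<in>A. set (d l))"
  have "kdiv k (?D \<union> set (d b)) n Q"
  proof (rule kdiv_extend)
    show "|?D \<union> set (d b)| <o \<kappa>" using small_Un[OF C small_finite] insert.hyps(1) by (simp add: Un_assoc)
    show "Def (?D \<union> set (d i)) n Q" using Q(1) by (rule Def_mono) auto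
    show "kdiv k ?D n Q" using insert by auto
    fix a assume a: "set a \<subseteq> set (d b)"
    have "dnd C (d b) (C \<union> (\<Union>l<b. set (d l)))" using d by (rule dnf_dnd)
    moreover have "?D \<union> set (d i) \<subseteq> C \<union> (\<Union>l<b. set (d l))" using insert by auto
    ultimately have "dnd C (d b) (?D \<union> set (d i))" by (rule dnd_mono)
    then have "dnd ?D (d b) (?D \<union> set (d i))" by (rule dnd_base_mono) auto
    then show "dnd ?D a (?D \<union> set (d i))" using a by (rule dnd_sub)
  qed
  then show ?case by (simp add: Un_ac)
qed

text \<open>The tree is built against the order of the sequence: the largest index of
  \<open>J\<close> is split off and joins \<open>K\<close>. Its relation still divides over
  \<open>C\<close> together with the later terms by \<open>morley_kdiv\<close>, and the relations
  for \<open>K\<close> are invariant over that set, so \<open>rk_divide\<close> gains one level. The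
  common solution \<open>x\<close> starts the induction at rank 0.\<close>

lemma morley_chain:
  assumes C: "|C| <o \<kappa>" and d: "\<And>i. dnf C (d i) (C \<union> (\<Union>l<i. set (d l)))"
    and \<Delta>: "Def_family n \<Delta>"
    and R: "\<And>i. i \<in> J \<union> K \<Longrightarrow> (R i, length (a i), k i) \<in> \<Delta> \<and> set (a i) \<subseteq> C \<union> set (d i) \<and>
        kdiv (k i) C n (\<lambda>x. R i (x @ a i)) \<and> R i (x @ a i)"
    and x: "length x = n"
    and fin: "finite J" "finite K" and less: "\<And>i l. i \<in> J \<Longrightarrow> l \<in> K \<Longrightarrow> i < (l :: nat)"
  shows "rk \<Delta> n (card J) (\<lambda>x. \<forall>i\<in>K. R i (x @ a i))"
  using fin R less
proof (induction J arbitrary: K rule: finite_linorder_max_induct)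
  case empty
  then show ?case using x by auto
next
  case (insert b A)
  have Rb: "(R b, length (a b), k b) \<in> \<Delta>" "set (a b) \<subseteq> C \<union> set (d b)" "kdiv (k b) C n (\<lambda>x. R b (x @ a b))"
    using insert.prems(2)[of b] by auto
  have IH: "rk \<Delta> n (card A) (\<lambda>x. \<forall>i\<in>insert b K. R i (x @ a i))"
  proof (rule insert.IH)
    show "finite (insert b K)" using insert.prems(1) by simp
    show "i < l" if "i \<in> A" "l \<in> insert b K" for i l
      using that insert.hyps(2) insert.prems(3)[of i l] by auto
    show "(R i, length (a i), k i) \<in> \<Delta> \<and> set (a i) \<subseteq> C \<union> set (d i) \<and>
        kdiv (k i) C n (\<lambda>x. R i (x @ a i)) \<and> R i (x @ a i)" if "i \<in> A \<union> insert b K" for i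
      by (rule insert.prems(2)) (use that in blast)
  qed
  have "rk \<Delta> n (Suc (card A)) (\<lambda>x. \<forall>i\<in>K. R i (x @ a i))"
  proof (rule rk_divide[OF \<Delta> Rb(1) refl])
    show "kdiv (k b) (C \<union> (\<Union>l\<in>K. set (d l))) n (\<lambda>x. R b (x @ a b))"
    proof (rule morley_kdiv[OF C d _ Rb(3) insert.prems(1)])
      show "Def (C \<union> set (d b)) n (\<lambda>x. R b (x @ a b))"
        using Rb(2) by (intro Def_instance[OF Def_familyD[OF \<Delta> Rb(1)]]) auto
      show "b < l" if "l \<in> K" for l using insert.prems(3) that by auto
    qed
  next
    fix g x assume g: "g \<in> Aut (C \<union> (\<Union>l\<in>K. set (d l)))" and x: "length (x :: 'a list) = n"
    have "R i (map g x @ a i) \<longleftrightarrow> R i (x @ a i)" if i: "i \<in> K" for i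
    proof -
      have Ri: "(R i, length (a i), k i) \<in> \<Delta>" "set (a i) \<subseteq> C \<union> set (d i)"
        using insert.prems(2)[of i] i by auto
      have "map g (a i) = a i" using Ri(2) i by (intro Aut_map[OF g]) auto
      moreover have "R i (map g (x @ a i)) \<longleftrightarrow> R i (x @ a i)"
        using x by (intro Def_Aut[OF Def_familyD[OF \<Delta> Ri(1)]] Aut_mono[OF g]) auto
      ultimately show ?thesis by simp
    qed
    then show "(\<forall>i\<in>K. R i (map g x @ a i)) \<longleftrightarrow> (\<forall>i\<in>K. R i (x @ a i))" by blast
  next
    show "rk \<Delta> n (card A) (\<lambda>x. (\<forall>i\<in>K. R i (x @ a i)) \<and> R b (x @ a b))"
      using IH by (rule rk_mono) auto
  qed
  moreover have "card (insert b A) = Suc (card A)" using insert.hyps by (auto intro!: card_insert_disjoint)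
  ultimately show ?case by simp
qed

section \<open>Symmetry, equality of forking and dividing, transitivity\<close>

lemma shift_Aut:
  assumes "Def {} (length x + length e) R" "g \<in> Aut C"
  shows "R (map (inv g) x @ e) \<longleftrightarrow> R (x @ map g e)"
proof -
  have "R (map g (map (inv g) x @ e)) \<longleftrightarrow> R (map (inv g) x @ e)"
    by (rule Def_Aut[OF assms(1)]) (use Aut_mono[OF assms(2)] in auto)
  then show ?thesis using Aut_inv_cancel(4)[OF assms(2)] by (simp del: map_map)
qed

text \<open>Suppose a relation over \<open>C \<union> set a\<close> holds of \<open>b\<close> and
  divides over \<open>C\<close>. Along copies of \<open>a\<close> over
  \<open>C \<union> set b\<close> that are free over \<open>C\<close>, its conjugates all hold of
  \<open>b\<close> and divide over \<open>C\<close> with the same \<open>k\<close>. They are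
  instances of one relation \<open>R\<close>, whose rank would be unbounded.\<close>

lemma dnf_symmetric_dnd:
  assumes C: "|C| <o \<kappa>" and dnf: "dnf C a (C \<union> set b)"
  shows "dnd C b (C \<union> set a)"
  unfolding dnd_def
proof (intro allI impI notI)
  let ?n = "length b"
  fix P k assume P: "Def (C \<union> set a) ?n P" "P b" "kdiv k C ?n P"
  obtain e R where e: "set e \<subseteq> C \<union> set a" "Def {} (?n + length e) R"
    "\<And>x. length x = ?n \<Longrightarrow> P x \<longleftrightarrow> R (x @ e)" using Def_params[OF P(1)] by blast
  have small: "|C \<union> set b| <o \<kappa>" by (intro small_Un C small_finite) auto
  obtain g :: "nat \<Rightarrow> 'a \<Rightarrow> 'a" where g': "\<forall>i. g i \<in> Aut (C \<union> set b) \<and>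
    dnf C (map (g i) a) (C \<union> set b \<union> (\<Union>l<i. set (map (g l) a)))"
    using morley_sequence[OF dnf small] ..
  note g = g'[THEN spec, THEN conjunct1] g'[THEN spec, THEN conjunct2]
  have gC: "g i \<in> Aut C" for i using g(1) by (rule Aut_mono) auto
  let ?\<Delta> = "{(R, length e, k)}"
  obtain N where N: "\<not> rk ?\<Delta> ?n N (\<lambda>_. True)" using rk_bound_single[OF e(2)] by blast
  have "rk ?\<Delta> ?n (card {..<N}) (\<lambda>x. \<forall>i\<in>{}. R (x @ map (g i) e))"
  proof (rule morley_chain[where R = "\<lambda>_. R" and k = "\<lambda>_. k" and a = "\<lambda>i. map (g i) e", OF C, of "\<lambda>i. map (g i) a"])
    show "dnf C (map (g i) a) (C \<union> (\<Union>l<i. set (map (g l) a)))" for i using g(2) by (rule dnf_mono) auto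
    show "Def_family ?n ?\<Delta>" using e(2) unfolding Def_family_def by simp
    show "length b = ?n" by simp
    fix i
    have "set (map (g i) e) \<subseteq> C \<union> set (map (g i) a)"
      using e(1) gC[of i] unfolding Aut_def by auto
    moreover have "kdiv k C ?n (\<lambda>x. P (map (inv (g i)) x))"
      by (rule kdiv_conj_Aut[OF P(3) Aut_inv[OF gC]])
    then have "kdiv k C ?n (\<lambda>x. R (x @ map (g i) e))"
      by (rule kdiv_cong) (use e(3) shift_Aut[OF _ gC] e(2) in auto)
    moreover have "R (b @ map (g i) e)"
    proof -
      have "map (inv (g i)) b = b" by (rule Aut_map[OF Aut_inv[OF g(1)]]) auto
      then show ?thesis using shift_Aut[OF e(2) gC[of i]] P(2) e(3)[of b] by simp
    qed
    ultimately show "(R, length (map (g i) e), k) \<in> ?\<Delta> \<and> set (map (g i) e) \<subseteq> C \<union> set (map (g i) a) \<and>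
        kdiv k C ?n (\<lambda>x. R (x @ map (g i) e)) \<and> R (b @ map (g i) e)" by simp
  qed auto
  then show False using N by simp
qed

text \<open>Let \<open>e\<close> list the parameters of all disjuncts and conjugate \<open>P\<close>
  along free copies of \<open>e\<close> over \<open>C\<close>, which \<open>existence\<close>
  provides. A common solution of \<open>N\<close> conjugates selects a disjunct in each, and
  \<open>morley_chain\<close> turns the selection into rank \<open>N\<close>; so a value that the
  rank cannot attain is a degree of inconsistency.\<close>

lemma fork_imp_kdiv:
  assumes C: "|C| <o \<kappa>" and fork: "fork C n P"
  shows "\<exists>k. kdiv k C n P"
proof -
  obtain F D R K where F: "finite F" and R: "\<And>Q. Q \<in> F \<Longrightarrow> Def {} (n + length (D Q)) (R Q)"
    "\<And>Q x. Q \<in> F \<Longrightarrow> length x = n \<Longrightarrow> Q x \<longleftrightarrow> R Q (x @ D Q)" "\<And>Q. Q \<in> F \<Longrightarrow> kdiv (K Q) C n Q"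
    and cover: "\<And>x. length x = n \<Longrightarrow> P x \<Longrightarrow> \<exists>Q\<in>F. Q x" by (rule fork_witnesses[OF fork]) (rule that, assumption+)
  define \<Delta> where "\<Delta> = (\<lambda>Q. (R Q, length (D Q), K Q)) ` F"
  have \<Delta>: "Def_family n \<Delta>" using R(1) unfolding \<Delta>_def Def_family_def by auto
  have fin\<Delta>: "finite \<Delta>" using F unfolding \<Delta>_def by simp
  obtain N where N: "\<not> rk \<Delta> n N (\<lambda>_. True)" using rk_bound[OF fin\<Delta> \<Delta>] by blast
  \<comment> \<open>Rank 0 is attained by any list of length \<open>n\<close>, so \<open>N\<close>
    is positive and a set of \<open>N\<close> indices is nonempty.\<close>
  have N0: "N \<noteq> 0" using N Ex_list_of_length[of n] by (cases N) auto
  have "finite (\<Union>Q\<in>F. set (D Q))" using F by auto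
  from finite_list[OF this] obtain e where e: "set e = (\<Union>Q\<in>F. set (D Q))" by auto
  obtain g :: "nat \<Rightarrow> 'a \<Rightarrow> 'a" where g': "\<forall>i. g i \<in> Aut C \<and> dnf C (map (g i) e) (C \<union> (\<Union>l<i. set (map (g l) e)))"
    using morley_sequence[OF existence C, of e] ..
  note g = g'[THEN spec, THEN conjunct1] g'[THEN spec, THEN conjunct2]
  have "k_inconsistent N (\<lambda>i x. length x = n \<and> P (map (inv (g i)) x))"
    unfolding k_inconsistent_def
  proof (intro allI impI notI, elim conjE exE)
    fix I :: "nat set" and x
    assume I: "finite I" "card I = N" "\<forall>i\<in>I. length x = n \<and> P (map (inv (g i)) x)"
    have x: "length x = n" using I N0 by (metis card.empty ex_in_conv)
    have "\<forall>i\<in>I. \<exists>Q\<in>F. Q (map (inv (g i)) x)" using cover I(3) by simp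
    then obtain Q where Q: "\<And>i. i \<in> I \<Longrightarrow> Q i \<in> F \<and> Q i (map (inv (g i)) x)" by metis
    have "rk \<Delta> n (card I) (\<lambda>x. \<forall>i\<in>{}. R (Q i) (x @ map (g i) (D (Q i))))"
    proof (rule morley_chain[where R = "\<lambda>i. R (Q i)" and k = "\<lambda>i. K (Q i)" and a = "\<lambda>i. map (g i) (D (Q i))",
          OF C g(2) \<Delta> _ x])
      fix i assume "i \<in> I \<union> {}"
      then have i: "i \<in> I" by simp
      note QF = Q[OF i, THEN conjunct1]
      have "(R (Q i), length (map (g i) (D (Q i))), K (Q i)) \<in> \<Delta>" using QF unfolding \<Delta>_def by auto
      moreover have "set (map (g i) (D (Q i))) \<subseteq> C \<union> set (map (g i) e)"
        using QF e by auto
      moreover have "kdiv (K (Q i)) C n (\<lambda>x. Q i (map (inv (g i)) x))"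
        by (rule kdiv_conj_Aut[OF R(3)[OF QF] Aut_inv[OF g(1)]])
      then have "kdiv (K (Q i)) C n (\<lambda>x. R (Q i) (x @ map (g i) (D (Q i))))"
        by (rule kdiv_cong) (use R(2)[OF QF] shift_Aut[OF _ g(1)] R(1)[OF QF] in auto)
      moreover have "R (Q i) (x @ map (g i) (D (Q i)))"
        using Q[OF i] R(2)[OF QF, of "map (inv (g i)) x"] x
          shift_Aut[OF _ g(1), of x "D (Q i)" "R (Q i)" i] R(1)[OF QF] by simp
      ultimately show "(R (Q i), length (map (g i) (D (Q i))), K (Q i)) \<in> \<Delta> \<and>
        set (map (g i) (D (Q i))) \<subseteq> C \<union> set (map (g i) e) \<and>
        kdiv (K (Q i)) C n (\<lambda>x. R (Q i) (x @ map (g i) (D (Q i)))) \<and> R (Q i) (x @ map (g i) (D (Q i)))"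
        by blast
    qed (use I in auto)
    then show False using N I(2) by simp
  qed
  then show ?thesis unfolding kdiv_def using Aut_inv[OF g(1)] by (intro exI[of _ N] exI[of _ "\<lambda>i. inv (g i)"]) auto
qed

lemma dnd_dnf: "|C| <o \<kappa> \<Longrightarrow> dnd C b B \<Longrightarrow> dnf C b B"
  unfolding dnd_def dnf_def using fork_imp_kdiv by blast

lemma dnf_symmetric: "|C| <o \<kappa> \<Longrightarrow> dnf C a (C \<union> set b) \<Longrightarrow> dnf C b (C \<union> set a)"
  using dnd_dnf dnf_symmetric_dnd by blast

text \<open>By symmetry the claim concerns relations over \<open>C \<union> set b\<close> that hold
  of \<open>e\<close>. Such a relation dividing over \<open>C\<close> still divides over
  \<open>A\<close>, as \<open>b\<close> is free from \<open>A\<close> over \<open>C\<close>, and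
  then over \<open>A \<union> set e\<close>, as \<open>b\<close> is free from \<open>e\<close> over
  \<open>A\<close>; but over a set containing \<open>e\<close> it cannot hold of
  \<open>e\<close>.\<close>

lemma dnf_transitive:
  assumes A: "|A| <o \<kappa>" and "C \<subseteq> A" and bA: "dnf C b A" and be: "dnf A b (A \<union> set e)"
  shows "dnf C b (C \<union> set e)"
proof -
  have C: "|C| <o \<kappa>" using A assms(2) by (rule small_subset)
  have Ae: "|A \<union> set e| <o \<kappa>" by (intro small_Un A small_finite) auto
  have CA: "C \<union> A = A" using assms(2) by auto
  have "dnd C e (C \<union> set b)" unfolding dnd_def
  proof (intro allI impI notI)
    fix Q k assume Q: "Def (C \<union> set b) (length e) Q" "Q e" "kdiv k C (length e) Q"
    have "kdiv k (C \<union> A) (length e) Q"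
    proof (rule kdiv_extend[OF _ Q(1) _ Q(3)])
      show "|C \<union> A| <o \<kappa>" using A CA by simp
      fix a assume "set a \<subseteq> A"
      then have "dnf C b (C \<union> set a)" using assms(2) by (intro dnf_mono[OF bA]) auto
      then show "dnd C a (C \<union> set b)" by (rule dnf_symmetric_dnd[OF C])
    qed
    then have kA: "kdiv k A (length e) Q" using CA by simp
    have eb: "dnd A e (A \<union> set b)" by (rule dnf_symmetric_dnd[OF A be])
    have "kdiv k (A \<union> set e) (length e) Q"
    proof (rule kdiv_extend[OF Ae _ _ kA])
      show "Def (A \<union> set b) (length e) Q" using Q(1) assms(2) by (rule Def_mono[OF _ Un_mono]) auto
      show "dnd A a (A \<union> set b)" if "set a \<subseteq> set e" for a using eb that by (rule dnd_sub)
    qed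
    then show False using kdiv_not_sat[of k _ _ Q e] Q(2) by auto
  qed
  then have "dnf C e (C \<union> set b)" by (rule dnd_dnf[OF C])
  then show ?thesis by (rule dnf_symmetric[OF C])
qed

section \<open>Descent of algebraicity to the smaller base\<close>

lemma infinite_orbit:
  assumes D: "|D| <o \<kappa>" and inf: "\<And>S. Def D 1 S \<Longrightarrow> S [e] \<Longrightarrow> infinite {a. S [a]}"
  shows "\<exists>g :: nat \<Rightarrow> 'a \<Rightarrow> 'a. (\<forall>i. g i \<in> Aut D) \<and> inj (\<lambda>i. g i e)"
proof -
  \<comment> \<open>Every term realizes the type of \<open>e\<close> over \<open>D\<close>, and
    terms with different indices differ; finitely many constraints can be met because each relation
    in the type has infinitely many solutions.\<close>
  let ?\<Sigma> = "{([i], S) | i S. Def D 1 S \<and> S [e]} \<union>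
    {([i, j], \<lambda>l. l ! 0 \<noteq> l ! 1) | i j :: nat. i \<noteq> j}"
  have "\<exists>y. (\<forall>t. length (y t) = 1) \<and> (\<forall>ts P. (ts, P) \<in> ?\<Sigma> \<longrightarrow> P (concat (map y ts)))"
  proof (rule compactness[OF D])
    fix ts :: "nat list" and P assume "(ts, P) \<in> ?\<Sigma>"
    then show "Def D (1 * length ts) P" using Def_not[OF Def_eq[of 0 2 1 D]] by (auto simp: numeral_2_eq_2)
  next
    fix F assume F: "F \<subseteq> ?\<Sigma>" "finite F"
    define \<S> where "\<S> = {S \<in> snd ` F. Def D 1 S \<and> S [e]}"
    have fS: "finite \<S>" using F(2) unfolding \<S>_def by auto
    have "Def D 1 (\<lambda>x. \<forall>S\<in>\<S>. S x)" using fS by (rule Def_Ball) (auto simp: \<S>_def)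
    moreover have "\<forall>S\<in>\<S>. S [e]" by (auto simp: \<S>_def)
    ultimately have "infinite {a. \<forall>S\<in>\<S>. S [a]}" by (rule inf)
    then obtain f :: "nat \<Rightarrow> 'a" where f: "inj f" "range f \<subseteq> {a. \<forall>S\<in>\<S>. S [a]}"
      using infinite_countable_subset by blast
    have "P (concat (map (\<lambda>i. [f i]) ts))" if tsP: "(ts, P) \<in> F" for ts P
    proof -
      consider i where "ts = [i]" "P \<in> \<S>" | i j where "ts = [i, j]" "i \<noteq> j" "P = (\<lambda>l. l ! 0 \<noteq> l ! 1)"
        using F(1) tsP unfolding \<S>_def by force
      then show ?thesis using f by cases (auto simp: inj_eq)
    qed
    then show "\<exists>y. (\<forall>t. length (y t) = 1) \<and> (\<forall>ts P. (ts, P) \<in> F \<longrightarrow> P (concat (map y ts)))"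
      by (intro exI[of _ "\<lambda>i. [f i]"] conjI allI impI) simp
  qed
  then obtain y where y: "\<And>t. length (y t) = 1" "\<And>ts P. (ts, P) \<in> ?\<Sigma> \<Longrightarrow> P (concat (map y ts))"
    by blast
  have "\<exists>g\<in>Aut D. map g [e] = y i" for i
  proof (rule homogeneous_list[OF D])
    show "length (y i) = length [e]" using y(1) by simp
    fix P assume "Def D (length [e]) P" "P [e]"
    then have "([i], P) \<in> ?\<Sigma>" by auto
    from y(2)[OF this] show "P (y i)" by simp
  qed
  then obtain g where g: "\<And>i. g i \<in> Aut D" "\<And>i. map (g i) [e] = y i" by metis
  have "g i e \<noteq> g j e" if "i \<noteq> j" for i j
  proof -
    have "([i, j], \<lambda>l. l ! 0 \<noteq> l ! 1) \<in> ?\<Sigma>" using that by blast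
    from y(2)[OF this] show ?thesis using g(2)[of i] g(2)[of j] by (auto simp flip: g(2))
  qed
  then have "inj (\<lambda>i. g i e)" by (auto simp: inj_def)
  then show ?thesis using g(1) by blast
qed

text \<open>If \<open>R(x,a)\<close> has \<open>m\<close> solutions and \<open>e\<close> is one of them with infinitely many conjugates over
  \<open>D\<close>, then \<open>R(e,z) \<and> \<exists>\<^sup>\<le>\<^sup>m x. R(x,z)\<close> divides over \<open>D\<close> with degree \<open>m + 1\<close>.\<close>

lemma dnf_algebraic:
  assumes A: "|A| <o \<kappa>" and "C \<subseteq> A" and dnf: "dnf C (e # b) A"
    and P: "Def (A \<union> set b) 1 P" "finite {a. P [a]}" "P [e]"
  shows "\<exists>P'. Def (C \<union> set b) 1 P' \<and> finite {a. P' [a]} \<and> P' [e]"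
proof (rule ccontr)
  assume no: "\<not> ?thesis"
  let ?D = "C \<union> set b"
  have C: "|C| <o \<kappa>" using A assms(2) by (rule small_subset)
  have D: "|?D| <o \<kappa>" by (intro small_Un C small_finite) auto
  have "?D \<union> A = A \<union> set b" using assms(2) by auto
  then obtain a R where a: "set a \<subseteq> A" "Def ?D (1 + length a) R"
    "\<And>x. length x = 1 \<Longrightarrow> P x \<longleftrightarrow> R (x @ a)" using Def_abstract[of ?D A 1 P] P(1) by auto
  \<comment> \<open>Symmetry is applied to \<open>e\<close> and \<open>b\<close> together. Enlarging
    the base by \<open>b\<close> afterwards leaves \<open>e\<close> as the only parameter outside
    it, as needed for \<open>?\<chi>\<close>.\<close>
  have "dnf C (e # b) (C \<union> set a)" using a(1) assms(2) by (intro dnf_mono[OF dnf]) auto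
  then have "dnd C a (C \<union> set (e # b))" by (rule dnf_symmetric_dnd[OF C])
  then have "dnd ?D a (C \<union> set (e # b))" by (rule dnd_base_mono) auto
  then have ind: "dnd ?D a (?D \<union> {e})" by (rule dnd_mono) auto
  obtain g where g: "\<And>i. g i \<in> Aut ?D" "inj (\<lambda>i :: nat. g i e)"
    using infinite_orbit[OF D, of e] no by blast
  define m where "m = card {a. P [a]}"
  let ?r = "length a"
  \<comment> \<open>Having \<open>m + 1\<close> distinct solutions, in a form definable over
    \<open>?D\<close>; as \<open>m\<close> counts the solutions of \<open>P\<close>, this fails for
    \<open>a\<close>.\<close>
  define \<theta> where "\<theta> = (\<lambda>z. \<exists>Y. length Y = Suc m \<and>
    (\<forall>p\<in>{(i, j). i < j \<and> j < Suc m}. Y ! fst p \<noteq> Y ! snd p) \<and> (\<forall>j\<in>{..m}. R ([Y ! j] @ z)))"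
  have fin: "finite {(i, j). i < j \<and> j < Suc m}"
    by (rule finite_subset[of _ "{..m} \<times> {..m}"]) auto
  have \<theta>: "Def ?D ?r \<theta>"
  proof -
    have 1: "Def ?D (?r + Suc m) (\<lambda>l. \<forall>p\<in>{(i, j). i < j \<and> j < Suc m}. l ! (?r + fst p) \<noteq> l ! (?r + snd p))"
      using fin by (intro Def_Ball Def_not Def_eq) auto
    have 2: "Def ?D (?r + Suc m) (\<lambda>l. \<forall>j\<in>{..m}. R ([l ! (?r + j)] @ take ?r l))"
      by (intro Def_Ball Def_tuple_subst[OF a(2)] tuple_subst_intros tuple_subst_nth) auto
    from Def_ex[OF Def_conj[OF 1 2]] show ?thesis unfolding \<theta>_def
      by (rule Def_cong) (auto simp: nth_append)
  qed
  let ?\<chi> = "\<lambda>z. R ([e] @ z) \<and> \<not> \<theta> z"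
  have "Def (?D \<union> {e}) ?r (\<lambda>z. R ([e] @ z))" by (intro Def_tuple_subst[OF a(2)] tuple_subst_intros) auto
  moreover have "Def (?D \<union> {e}) ?r (\<lambda>z. \<not> \<theta> z)" using Def_not[OF \<theta>] by (rule Def_mono) auto
  ultimately have "Def (?D \<union> {e}) ?r ?\<chi>" by (rule Def_conj)
  moreover have "?\<chi> a"
  proof
    show "R ([e] @ a)" using P(3) a(3)[of "[e]"] by simp
    show "\<not> \<theta> a"
    proof
      assume "\<theta> a"
      then obtain Y where Y: "length Y = Suc m" "\<And>i j. i < j \<Longrightarrow> j < Suc m \<Longrightarrow> Y ! i \<noteq> Y ! j"
        "\<And>j. j \<le> m \<Longrightarrow> R ([Y ! j] @ a)" unfolding \<theta>_def by fastforce
      have "distinct Y" unfolding distinct_conv_nth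
      proof (intro allI impI)
        fix i j assume "i < length Y" "j < length Y" "i \<noteq> j"
        then show "Y ! i \<noteq> Y ! j" using Y(1,2) by (metis linorder_neqE_nat)
      qed
      then have "card (set Y) = Suc m" using Y(1) distinct_card by metis
      moreover have "set Y \<subseteq> {a. P [a]}" using Y(1,3) a(3) by (auto simp: in_set_conv_nth less_Suc_eq_le)
      ultimately show False using card_mono[OF P(2), of "set Y"] unfolding m_def by simp
    qed
  qed
  \<comment> \<open>If \<open>m + 1\<close> conjugates had a common \<open>z\<close>, the distinct
    elements \<open>g i e\<close> would be \<open>m + 1\<close> solutions of \<open>R\<close> over
    \<open>z\<close>, whereas invariance over \<open>?D\<close> gives
    \<open>\<not> \<theta> z\<close>.\<close>
  moreover have "kdiv (Suc m) ?D ?r ?\<chi>" unfolding kdiv_def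
  proof (intro exI[of _ "\<lambda>i. inv (g i)"] conjI allI)
    show "inv (g i) \<in> Aut ?D" for i by (rule Aut_inv[OF g(1)])
    show "k_inconsistent (Suc m) (\<lambda>i z. length z = ?r \<and> ?\<chi> (map (inv (g i)) z))"
      unfolding k_inconsistent_def
    proof (intro allI impI notI, elim conjE exE)
      fix I :: "nat set" and z
      assume I: "finite I" "card I = Suc m" "\<forall>i\<in>I. length z = ?r \<and> ?\<chi> (map (inv (g i)) z)"
      define ts where "ts = sorted_list_of_set I"
      have ts: "set ts = I" "distinct ts" "length ts = Suc m" using I unfolding ts_def by auto
      have tsI: "ts ! j \<in> I" if "j < Suc m" for j using that ts nth_mem by metis
      have z: "length z = ?r" using I(3) tsI by blast
      have "\<not> \<theta> z" using I(3) tsI[of 0] Def_Aut[OF \<theta> Aut_inv[OF g(1)] z] by auto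
      moreover have "\<theta> z" unfolding \<theta>_def
      proof (intro exI[of _ "map (\<lambda>i. g i e) ts"] conjI ballI)
        show "length (map (\<lambda>i. g i e) ts) = Suc m" using ts by simp
        show "map (\<lambda>i. g i e) ts ! fst p \<noteq> map (\<lambda>i. g i e) ts ! snd p"
          if "p \<in> {(i, j). i < j \<and> j < Suc m}" for p
          using that ts by (auto dest!: injD[OF g(2)] simp: nth_eq_iff_index_eq)
        fix j assume "j \<in> {..m}"
        then have j: "j < Suc m" by auto
        have "R ([e] @ map (inv (g (ts ! j))) z)" using I(3) tsI[OF j] by blast
        moreover have "R (map (g (ts ! j)) ([e] @ map (inv (g (ts ! j))) z)) \<longleftrightarrow> R ([e] @ map (inv (g (ts ! j))) z)"
          by (rule Def_Aut[OF a(2) g(1)]) (simp add: z)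
        ultimately have "R ([g (ts ! j) e] @ z)"
          using Aut_inv_cancel(4)[OF g(1)] by (simp del: map_map)
        then show "R ([map (\<lambda>i. g i e) ts ! j] @ z)" using j ts by simp
      qed
      ultimately show False by blast
    qed
  qed
  ultimately show False using ind unfolding dnd_def by blast
qed

lemma dnf_Aut:
  assumes dnf: "dnf C b B" and g: "g \<in> Aut C"
  shows "dnf C (map g b) (g ` B)"
  unfolding dnf_def length_map
proof (intro allI impI notI)
  let ?n = "length b"
  fix P assume P: "Def (g ` B) ?n P" "P (map g b)" "fork C ?n P"
  have ig: "inv g \<in> Aut {}" using Aut_inv[OF g] by (rule Aut_mono) auto
  have iig: "inv (inv g) = g" using Aut_bij[OF g] by (rule inv_inv_eq)
  have "inv g ` g ` B = B" using Aut_inv_cancel(1)[OF g] by (auto simp: image_iff)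
  then have "Def B ?n (\<lambda>x. P (map g x))" using Def_image_Aut[OF P(1) ig] iig by simp
  moreover obtain F where F: "finite F" "\<And>Q. Q \<in> F \<Longrightarrow> Def UNIV ?n Q \<and> (\<exists>k. kdiv k C ?n Q)"
    "\<And>x. length x = ?n \<Longrightarrow> P x \<Longrightarrow> \<exists>Q\<in>F. Q x" using P(3) unfolding fork_def by blast
  have "fork C ?n (\<lambda>x. P (map g x))" unfolding fork_def
  proof (intro exI[of _ "(\<lambda>Q x. Q (map g x)) ` F"] conjI ballI allI impI)
    show "finite ((\<lambda>Q x. Q (map g x)) ` F)" using F(1) by simp
    fix Q' assume "Q' \<in> (\<lambda>Q x. Q (map g x)) ` F"
    then obtain Q where Q: "Q \<in> F" "Q' = (\<lambda>x. Q (map g x))" by blast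
    have "Def (inv g ` UNIV) ?n (\<lambda>x. Q (map g x))"
      using Def_image_Aut[of UNIV ?n Q "inv g"] F(2)[OF Q(1)] ig iig by simp
    then show "Def UNIV ?n Q'" unfolding Q(2) by (rule Def_mono) auto
    show "\<exists>k. kdiv k C ?n Q'" unfolding Q(2) using kdiv_conj_Aut[OF _ g] F(2)[OF Q(1)] by blast
  next
    fix x :: "'a list" assume "length x = ?n" "P (map g x)"
    then show "\<exists>Q\<in>(\<lambda>Q x. Q (map g x)) ` F. Q x" using F(3)[of "map g x"] by auto
  qed
  ultimately show False using dnf P(2) unfolding dnf_def by blast
qed

section \<open>Amalgamation systems\<close>

lemma dnf_of_not_forks:
  assumes nf: "\<not> forks L M C X p" and p: "\<And>\<phi>. \<phi> \<in> fms L B X \<Longrightarrow> sat M b \<phi> \<Longrightarrow> \<phi> \<in> p"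
    and vs: "set vs \<subseteq> X"
  shows "dnf C (map b vs) B"
  unfolding dnf_def length_map
proof (intro allI impI notI)
  let ?n = "length vs"
  fix P assume P: "Def B ?n P" "P (map b vs)" "fork C ?n P"
  obtain F where F: "finite F" "\<And>Q. Q \<in> F \<Longrightarrow> Def UNIV ?n Q \<and> (\<exists>k. kdiv k C ?n Q)"
    "\<And>x. length x = ?n \<Longrightarrow> P x \<Longrightarrow> \<exists>Q\<in>F. Q x" using P(3) unfolding fork_def by blast
  obtain \<phi> where \<phi>: "\<phi> \<in> fms L B (set vs)" "\<And>e. sat M e \<phi> \<longleftrightarrow> P (map e vs)"
    using Def_fm[OF P(1) refl] by blast
  have "\<phi> \<in> fms L B X" using \<phi>(1) vs unfolding fms_def by blast
  \<comment> \<open>The assumption on \<open>p\<close> asks it to contain what \<open>b\<close>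
    satisfies over \<open>B\<close>; in this form it covers both the given types \<open>p w\<close>
    and the types \<open>tp\<close> in the definition of independence.\<close>
  then have \<phi>p: "\<phi> \<in> p" using p \<phi>(2) P(2) by blast
  have "\<forall>Q\<in>F. \<exists>\<psi>. \<psi> \<in> fms L UNIV (set vs) \<and> (\<forall>e. sat M e \<psi> \<longleftrightarrow> Q (map e vs))"
    using Def_fm[OF _ refl] F(2) by blast
  from bchoice[OF this] obtain \<psi> where \<psi>: "\<forall>Q\<in>F. \<psi> Q \<in> fms L UNIV (set vs) \<and> (\<forall>e. sat M e (\<psi> Q) \<longleftrightarrow> Q (map e vs))" ..
  have "divides L M C (\<psi> Q)" if Q: "Q \<in> F" for Q
  proof -
    obtain k where "kdiv k C ?n Q" using F(2)[OF Q] by blast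
    then obtain g where g: "\<And>i. g i \<in> Aut C" "k_inconsistent k (\<lambda>i x. length x = ?n \<and> Q (map (g i) x))"
      unfolding kdiv_def by blast
    have wf: "wf_fm L (\<psi> Q)" using \<psi> Q by (auto simp: fms_def)
    \<comment> \<open>Renaming parameters by \<open>inv (g i)\<close> has the same effect as moving
      the points by \<open>g i\<close>, which matches \<open>divides\<close> with
      \<open>kdiv\<close>.\<close>
    have ev: "sat M e (rename_params (inv (g i)) (\<psi> Q)) \<longleftrightarrow> Q (map (g i) (map e vs))" for e i
    proof -
      have "inv (g i) \<circ> (g i \<circ> e) = e" using Aut_inv_cancel(1)[OF g(1)] by (auto simp: fun_eq_iff)
      moreover have "automorphism L M (inv (g i))" using Aut_inv[OF g(1)] unfolding Aut_def by blast
      from sat_automorphism[OF this wf, of "g i \<circ> e"]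
      have "sat M (inv (g i) \<circ> (g i \<circ> e)) (rename_params (inv (g i)) (\<psi> Q)) \<longleftrightarrow> sat M (g i \<circ> e) (\<psi> Q)" .
      ultimately have "sat M e (rename_params (inv (g i)) (\<psi> Q)) \<longleftrightarrow> sat M (g i \<circ> e) (\<psi> Q)" by metis
      then show ?thesis using \<psi> Q by simp
    qed
    have "k_inconsistent k (\<lambda>i e. sat M e (rename_params (inv (g i)) (\<psi> Q)))"
      unfolding k_inconsistent_def ev
    proof (intro allI impI notI, elim conjE exE)
      fix I :: "nat set" and e assume I: "finite I" "card I = k" "\<forall>i\<in>I. Q (map (g i) (map e vs))"
      then have "\<forall>i\<in>I. length (map e vs) = ?n \<and> Q (map (g i) (map e vs))" by simp
      then show False using g(2) I(1,2) unfolding k_inconsistent_def by blast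
    qed
    moreover have "elementary_map L M (C \<union> fm_params (\<psi> Q)) (inv (g i))" "\<forall>c\<in>C. inv (g i) c = c" for i
      using Aut_inv[OF g(1)] elementary_map_automorphism unfolding Aut_def by blast+
    ultimately show ?thesis unfolding divides_def
      by (intro exI[of _ k] exI[of _ "\<lambda>i. inv (g i)"]) blast
  qed
  moreover have "\<psi> ` F \<subseteq> fms L UNIV X" using \<psi> vs unfolding fms_def by blast
  moreover have "entails_disj M p (\<psi> ` F)" unfolding entails_disj_def
  proof (intro exI[of _ "{\<phi>}"] conjI allI impI)
    fix e assume "\<forall>\<phi>\<in>{\<phi>}. sat M e \<phi>"
    then have "P (map e vs)" using \<phi>(2) by simp
    then obtain Q where "Q \<in> F" "Q (map e vs)" using F(3) by (metis length_map)
    then show "\<exists>\<psi>\<in>\<psi> ` F. sat M e \<psi>" using \<psi> by blast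
  qed (use \<phi>p in auto)
  ultimately show False using nf F(1) unfolding forks_def by blast
qed

text \<open>Elementarity of the maps in \<open>divides\<close> is given only on \<open>C\<close> and
  the parameters of \<open>\<psi>\<close>. That set is small, so strong homogeneity provides
  automorphisms that agree with them there.\<close>

lemma kdiv_of_divides:
  assumes C: "|C| <o \<kappa>" and div: "divides L M C \<psi>" and \<psi>: "wf_fm L \<psi>" "fv \<psi> \<subseteq> set vs"
  shows "\<exists>k. kdiv k C (length vs) (\<lambda>xs. sat M (asg vs xs) \<psi>)"
proof -
  let ?n = "length vs"
  obtain k h where h: "\<And>i. elementary_map L M (C \<union> fm_params \<psi>) (h i)" "\<And>i c. c \<in> C \<Longrightarrow> h i c = c"
    "k_inconsistent k (\<lambda>i e. sat M e (rename_params (h i) \<psi>))" using div unfolding divides_def by blast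
  have small: "|C \<union> fm_params \<psi>| <o \<kappa>" by (rule small_Un[OF C small_finite]) simp
  have "\<forall>i. \<exists>g. automorphism L M g \<and> (\<forall>d\<in>C \<union> fm_params \<psi>. g d = h i d)"
    using homogeneous h(1) small unfolding strongly_homogeneous_def by blast
  from choice[OF this] obtain g where g: "\<forall>i. automorphism L M (g i) \<and> (\<forall>d\<in>C \<union> fm_params \<psi>. g i d = h i d)" ..
  have gC: "g i \<in> Aut C" for i unfolding Aut_def using g h(2) by auto
  have ren: "rename_params (h i) \<psi> = rename_params (g i) \<psi>" for i
    using g by (intro rename_params_cong) auto
  have ev: "sat M (asg vs (map (inv (g i)) x)) \<psi> \<longleftrightarrow> sat M (asg vs x) (rename_params (h i) \<psi>)"
    if x: "length x = ?n" for i x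
  proof -
    have "sat M (asg vs (map (inv (g i)) x)) \<psi> \<longleftrightarrow> sat M (inv (g i) \<circ> asg vs x) \<psi>"
      using x \<psi>(2) pos_less[of _ vs] by (intro sat_cong) (auto simp: asg_def)
    also have "\<dots> \<longleftrightarrow> sat M (g i \<circ> (inv (g i) \<circ> asg vs x)) (rename_params (g i) \<psi>)"
      using sat_automorphism[of L M "g i" \<psi>] g \<psi>(1) by blast
    also have "g i \<circ> (inv (g i) \<circ> asg vs x) = asg vs x"
      using Aut_inv_cancel(2)[OF gC] by (auto simp: fun_eq_iff)
    finally show ?thesis unfolding ren .
  qed
  have "k_inconsistent k (\<lambda>i x. length x = ?n \<and> sat M (asg vs (map (inv (g i)) x)) \<psi>)"
    unfolding k_inconsistent_def
  proof (intro allI impI notI, elim conjE exE)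
    fix I :: "nat set" and x
    assume I: "finite I" "card I = k" "\<forall>i\<in>I. length x = ?n \<and> sat M (asg vs (map (inv (g i)) x)) \<psi>"
    then have "\<forall>i\<in>I. sat M (asg vs x) (rename_params (h i) \<psi>)" using ev by blast
    then show False using h(3) I(1,2) unfolding k_inconsistent_def by blast
  qed
  then show ?thesis unfolding kdiv_def using Aut_inv[OF gC]
    by (intro exI[of _ k] exI[of _ "\<lambda>i. inv (g i)"]) blast
qed

text \<open>Forking is witnessed by finitely many formulas, whose variables form a finite tuple even
  when \<open>X\<close> is infinite.\<close>

lemma not_forks_of_dnf:
  assumes C: "|C| <o \<kappa>" and dnf: "\<And>vs. set vs \<subseteq> X \<Longrightarrow> dnf C (map b vs) B"
  shows "\<not> forks L M C X (tp L M B X b)"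
proof
  assume "forks L M C X (tp L M B X b)"
  then obtain \<Psi> where \<Psi>: "finite \<Psi>" "\<Psi> \<subseteq> fms L UNIV X" "\<forall>\<psi>\<in>\<Psi>. divides L M C \<psi>"
    and "entails_disj M (tp L M B X b) \<Psi>" unfolding forks_def by (elim exE conjE)
  then obtain F where F: "F \<subseteq> tp L M B X b" "finite F"
    "\<forall>e. (\<forall>\<phi>\<in>F. sat M e \<phi>) \<longrightarrow> (\<exists>\<psi>\<in>\<Psi>. sat M e \<psi>)" unfolding entails_disj_def by (elim exE conjE)
  let ?V = "\<Union>\<phi>\<in>F \<union> \<Psi>. fv \<phi>"
  have "finite ?V" using \<Psi>(1) F(2) by auto
  from finite_list[OF this] obtain vs where vs: "set vs = ?V" by auto
  have V: "set vs \<subseteq> X" using \<Psi>(2) F(1) unfolding vs tp_def fms_def by auto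
  let ?n = "length vs"
  let ?P = "\<lambda>xs. \<forall>\<phi>\<in>F. sat M (asg vs xs) \<phi>"
  have "Def B ?n ?P"
  proof (rule Def_Ball[OF F(2)])
    fix \<phi> assume "\<phi> \<in> F"
    then have "\<phi> \<in> fms L B (set vs)" using F(1) vs unfolding tp_def fms_def by auto
    then show "Def B ?n (\<lambda>xs. sat M (asg vs xs) \<phi>)" by (rule fm_Def)
  qed
  moreover have "?P (map b vs)"
  proof
    fix \<phi> assume "\<phi> \<in> F"
    then have "sat M b \<phi>" "fv \<phi> \<subseteq> set vs" using F(1) vs unfolding tp_def by auto
    then show "sat M (asg vs (map b vs)) \<phi>" using sat_asg_map by blast
  qed
  moreover have "fork C ?n ?P" unfolding fork_def
  proof (intro exI[of _ "(\<lambda>\<psi> xs. sat M (asg vs xs) \<psi>) ` \<Psi>"] conjI ballI allI impI)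
    show "finite ((\<lambda>\<psi> xs. sat M (asg vs xs) \<psi>) ` \<Psi>)" using \<Psi>(1) by simp
    fix Q assume "Q \<in> (\<lambda>\<psi> xs. sat M (asg vs xs) \<psi>) ` \<Psi>"
    then obtain \<psi> where \<psi>: "\<psi> \<in> \<Psi>" "Q = (\<lambda>xs. sat M (asg vs xs) \<psi>)" by blast
    have f: "\<psi> \<in> fms L UNIV (set vs)" using \<psi>(1) \<Psi>(2) vs unfolding fms_def by auto
    show "Def UNIV ?n Q" unfolding \<psi>(2) using f by (rule fm_Def)
    show "\<exists>k. kdiv k C ?n Q" unfolding \<psi>(2)
      using f by (intro kdiv_of_divides[OF C \<Psi>(3)[rule_format, OF \<psi>(1)]]) (auto simp: fms_def)
  next
    fix xs assume "?P xs"
    then obtain \<psi> where "\<psi> \<in> \<Psi>" "sat M (asg vs xs) \<psi>" using F(3) by blast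
    then show "\<exists>Q\<in>(\<lambda>\<psi> xs. sat M (asg vs xs) \<psi>) ` \<Psi>. Q xs"
      by (intro bexI[of _ "\<lambda>xs. sat M (asg vs xs) \<psi>"]) auto
  qed
  ultimately show False using dnf[OF V] unfolding dnf_def by simp
qed

lemma dnf_finite_character:
  assumes "\<And>e. set e \<subseteq> E \<Longrightarrow> dnf C b (C \<union> set e)"
  shows "dnf C b (C \<union> E)"
  unfolding dnf_def
proof (intro allI impI)
  fix P assume P: "Def (C \<union> E) (length b) P" "P b"
  obtain a R where a: "set a \<subseteq> E" "Def C (length b + length a) R"
    "\<And>x. length x = length b \<Longrightarrow> P x \<longleftrightarrow> R (x @ a)" using Def_abstract[OF P(1)] by blast
  have "Def (C \<union> set a) (length b) (\<lambda>x. R (x @ a))" by (rule Def_instance[OF a(2)]) auto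
  then have "Def (C \<union> set a) (length b) P" by (rule Def_cong) (simp add: a(3))
  then show "\<not> fork C (length b) P" using assms[OF a(1)] P(2) unfolding dnf_def by blast
qed

lemma acl_iff_Def: "a \<in> acl L M D \<longleftrightarrow> (\<exists>P. Def D 1 P \<and> finite {c. P [c]} \<and> P [a])"
proof
  assume "a \<in> acl L M D"
  then obtain u \<phi> where \<phi>: "\<phi> \<in> fms L D {u}" "finite {e u |e. sat M e \<phi>}" "a \<in> {e u |e. sat M e \<phi>}"
    unfolding acl_def by blast
  let ?P = "\<lambda>xs. sat M (asg [u] xs) \<phi>"
  have "Def D (length [u]) ?P" using \<phi>(1) by (intro fm_Def) simp
  then have "Def D 1 ?P" by simp
  moreover have "?P [c] \<longleftrightarrow> c \<in> {e u |e. sat M e \<phi>}" for c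
  proof
    assume "?P [c]"
    moreover have "asg [u] [c] u = c" using asg_map[of u "[u]" "\<lambda>_. c"] by simp
    ultimately show "c \<in> {e u |e. sat M e \<phi>}" by (metis (mono_tags, lifting) mem_Collect_eq)
  next
    assume "c \<in> {e u |e. sat M e \<phi>}"
    then obtain e where e: "c = e u" "sat M e \<phi>" by blast
    then show "?P [c]" using sat_asg_map[of \<phi> "[u]" e] \<phi>(1) by (simp add: fms_def)
  qed
  then have "{c. ?P [c]} = {e u |e. sat M e \<phi>}" by blast
  ultimately show "\<exists>P. Def D 1 P \<and> finite {c. P [c]} \<and> P [a]"
    using \<phi>(2,3) by (intro exI[of _ ?P]) auto
next
  assume "\<exists>P. Def D 1 P \<and> finite {c. P [c]} \<and> P [a]"
  then obtain P where P: "Def D 1 P" "finite {c. P [c]}" "P [a]" by blast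
  obtain \<phi> where \<phi>: "\<phi> \<in> fms L D {undefined :: 'v}" "\<And>e. sat M e \<phi> \<longleftrightarrow> P [e undefined]"
    using Def_fm[OF P(1), of "[undefined]"] by auto
  have eq: "{e undefined |e. sat M e \<phi>} = {c. P [c]}"
    unfolding \<phi>(2) by (auto intro: exI[of _ "\<lambda>_. c" for c])
  have "finite {e undefined |e. sat M e \<phi>} \<and> a \<in> {e undefined |e. sat M e \<phi>}"
    unfolding eq using P(2,3) by simp
  then show "a \<in> acl L M D" unfolding acl_def mem_Collect_eq[of a] using \<phi>(1) by (intro exI bexI)
qed

lemma list_subset_image: "set e \<subseteq> b ` U \<Longrightarrow> \<exists>us. set us \<subseteq> U \<and> e = map b us"
  by (intro exI[of _ "map (inv_into U b) e"]) (auto simp: inv_into_into f_inv_into_f comp_def intro!: map_idI[symmetric])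

lemma Aut_image_Un:
  assumes "g \<in> Aut C" "map g a = a'"
  shows "g ` (C \<union> set a) = C \<union> set a'"
proof -
  have "g ` C = C" using assms(1) unfolding Aut_def by (auto simp: image_iff)
  moreover have "g ` set a = set a'" using assms(2) by (metis set_map)
  ultimately show ?thesis by (simp add: image_Un)
qed

lemma amalgamation_system_restrict:
  assumes A: "|A| <o \<kappa>" and x: "\<And>w. w \<in> W \<Longrightarrow> |x w| <o \<kappa>"
    and am: "amalgamation_system L M A W x p" and CA: "C \<subseteq> A"
    and nf: "\<And>w. w \<in> W \<Longrightarrow> \<not> forks L M C (x w) (p w)"
  shows "amalgamation_system L M C W x (\<lambda>w. restrict_params C (p w))"
proof -
  have C: "|C| <o \<kappa>" using A CA by (rule small_subset)
  note am' = am[unfolded amalgamation_system_def]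
  note W = am'[THEN conjunct1] am'[THEN conjunct2, THEN conjunct1]
  note am' = am'[THEN conjunct2, THEN conjunct2]
  note ct = am'[THEN conjunct1] and ne = am'[THEN conjunct2, THEN conjunct1]
  note am' = am'[THEN conjunct2, THEN conjunct2]
  note xint = am'[THEN conjunct1] and res = am'[THEN conjunct2, THEN conjunct1]
    and real = am'[THEN conjunct2, THEN conjunct2]
  have mem: "\<phi> \<in> p w" if "w \<in> W" "\<forall>\<phi>\<in>p w. sat M b \<phi>" "\<phi> \<in> fms L A (x w)" "sat M b \<phi>" for w b \<phi>
    using ct that unfolding complete_type_def by (metis sat.simps(3))
  have ct': "complete_type L M C (x w) (restrict_params C (p w))" if w: "w \<in> W" for w
  proof -
    have p: "p w \<subseteq> fms L A (x w)" "consistent M (p w)" "\<forall>\<phi>\<in>fms L A (x w). \<phi> \<in> p w \<or> Neg \<phi> \<in> p w"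
      using ct w unfolding complete_type_def by blast+
    have sub: "restrict_params C (p w) \<subseteq> p w" unfolding restrict_params_def by blast
    have "restrict_params C (p w) \<subseteq> fms L C (x w)"
      using p(1) unfolding restrict_params_def fms_def by blast
    moreover have "consistent M (restrict_params C (p w))"
      using p(2) sub unfolding consistent_def by (meson subset_trans)
    moreover have "\<phi> \<in> restrict_params C (p w) \<or> Neg \<phi> \<in> restrict_params C (p w)"
      if \<phi>: "\<phi> \<in> fms L C (x w)" for \<phi>
    proof -
      have "\<phi> \<in> fms L A (x w)" "fm_params \<phi> \<subseteq> C" using \<phi> CA unfolding fms_def by auto
      then show ?thesis using p(3) unfolding restrict_params_def by auto
    qed
    ultimately show ?thesis unfolding complete_type_def by blast
  qed
  have ne': "entails_disj M (restrict_params C (p w)) {Neg (Eq (Var y) (Var z))}"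
    if w: "w \<in> W" "y \<in> x w" "z \<in> x w" "y \<noteq> z" for w y z
  proof -
    let ?\<phi> = "Eq (Var y) (Var z) :: ('f,'r,'v,'a) fm"
    have "entails_disj M (p w) {Neg ?\<phi>}" using ne w by blast
    then obtain F where F: "F \<subseteq> p w" "finite F" "\<And>e. \<forall>\<phi>\<in>F. sat M e \<phi> \<Longrightarrow> sat M e (Neg ?\<phi>)"
      unfolding entails_disj_def by auto
    \<comment> \<open>The entailment may use formulas with parameters outside \<open>C\<close>.
      Consistency and completeness place the inequality itself in \<open>p w\<close>, and having no
      parameters it survives the restriction.\<close>
    have "?\<phi> \<notin> p w"
    proof
      assume "?\<phi> \<in> p w"
      then have "insert ?\<phi> F \<subseteq> p w" "finite (insert ?\<phi> F)" using F by auto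
      moreover have "consistent M (p w)" using ct w(1) unfolding complete_type_def by blast
      ultimately obtain e where "\<forall>\<phi>\<in>insert ?\<phi> F. sat M e \<phi>" unfolding consistent_def by blast
      then show False using F(3)[of e] by auto
    qed
    moreover have "?\<phi> \<in> fms L A (x w)" using w by (auto simp: fms_def)
    ultimately have "Neg ?\<phi> \<in> p w" using ct w(1) unfolding complete_type_def by blast
    then have "Neg ?\<phi> \<in> restrict_params C (p w)" unfolding restrict_params_def by simp
    then show ?thesis unfolding entails_disj_def by (intro exI[of _ "{Neg ?\<phi>}"]) auto
  qed
  have res': "restrict_vars (x v) (restrict_params C (p w)) = restrict_params C (p v)"
    if "v \<in> W" "w \<in> W" "v \<subseteq> w" for v w
  proof -
    have "restrict_vars (x v) (p w) = p v" using res that by blast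
    then show ?thesis unfolding restrict_vars_def restrict_params_def by blast
  qed
  have real': "independent_family L M C w (\<lambda>i. x {i}) b \<and> b ` x w \<subseteq> acl L M (C \<union> (\<Union>i\<in>w. b ` x {i}))"
    if w: "w \<in> W" and b: "\<forall>\<phi>\<in>restrict_params C (p w). sat M b \<phi>" for w b
  proof -
    have pw: "p w \<subseteq> fms L A (x w)" "consistent M (p w)" using ct w unfolding complete_type_def by blast+
    \<comment> \<open>The given independence and algebraicity over \<open>A\<close> concern
      realizations of \<open>p w\<close>, which \<open>b\<close> need not be; so one is chosen for
      comparison with \<open>b\<close>.\<close>
    obtain b' where b': "\<forall>\<phi>\<in>p w. sat M b' \<phi>" using realize_type[OF pw(1) A x[OF w] pw(2)] by blast
    \<comment> \<open>Completeness of \<open>p w\<close> gives corresponding finite subtuples of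
      \<open>b'\<close> and \<open>b\<close> the same type over \<open>C\<close>. The automorphism
      depends on the subtuple, so each finite claim is transferred separately.\<close>
    have conj: "\<exists>g\<in>Aut C. map g (map b' vs) = map b vs" if vs: "set vs \<subseteq> x w" for vs
    proof (rule homogeneous_list[OF C])
      fix P assume P: "Def C (length (map b' vs)) P" "P (map b' vs)"
      then obtain \<phi> where \<phi>: "\<phi> \<in> fms L C (set vs)" "\<And>e. sat M e \<phi> \<longleftrightarrow> P (map e vs)"
        using Def_fm[of C "length vs" P vs] by auto
      have "\<phi> \<in> fms L A (x w)" using \<phi>(1) vs CA unfolding fms_def by blast
      then have "\<phi> \<in> p w" using mem[OF w b'] \<phi>(2) P(2) by blast
      then have "\<phi> \<in> restrict_params C (p w)" using \<phi>(1) unfolding restrict_params_def fms_def by blast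
      then show "P (map b vs)" using b \<phi>(2) by blast
    qed simp
    have bA: "dnf C (map b' vs) A" if "set vs \<subseteq> x w" for vs
      using dnf_of_not_forks[OF nf[OF w] mem[OF w b'] that] .
    have xi: "x {i} \<subseteq> x w" if i: "i \<in> w" for i
    proof -
      have "{i} \<in> W" using W(2) w i by blast
      then have "x {i} \<inter> x w = x ({i} \<inter> w)" using xint w by blast
      moreover have "{i} \<inter> w = {i}" using i by blast
      ultimately show ?thesis by auto
    qed
    have ind': "independent_family L M A w (\<lambda>i. x {i}) b'"
      and acl': "b' ` x w \<subseteq> acl L M (A \<union> (\<Union>i\<in>w. b' ` x {i}))" using real w b' by blast+
    have "\<not> forks L M C (x {i}) (tp L M (C \<union> (\<Union>j\<in>w - {i}. b ` x {j})) (x {i}) b)" if i: "i \<in> w" for i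
    proof (rule not_forks_of_dnf[OF C], rule dnf_finite_character)
      fix vs e assume vs: "set vs \<subseteq> x {i}" and e: "set e \<subseteq> (\<Union>j\<in>w - {i}. b ` x {j})"
      let ?U = "\<Union>j\<in>w - {i}. x {j}"
      have "set e \<subseteq> b ` ?U" using e by blast
      then obtain us where us: "set us \<subseteq> ?U" "e = map b us" using list_subset_image by metis
      have sub: "set vs \<subseteq> x w" "set (vs @ us) \<subseteq> x w" using vs us(1) xi i by auto
      obtain g where g: "g \<in> Aut C" "map g (map b' (vs @ us)) = map b (vs @ us)" using conj[OF sub(2)] by blast
      then have gv: "map g (map b' vs) = map b vs" "map g (map b' us) = map b us" by simp_all
      have "\<not> forks L M A (x {i}) (tp L M (A \<union> (\<Union>j\<in>w - {i}. b' ` x {j})) (x {i}) b')"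
        using ind' i unfolding independent_family_def by blast
      then have "dnf A (map b' vs) (A \<union> (\<Union>j\<in>w - {i}. b' ` x {j}))"
        by (rule dnf_of_not_forks) (use vs in \<open>auto simp: tp_def\<close>)
      then have "dnf A (map b' vs) (A \<union> set (map b' us))"
        by (rule dnf_mono) (use us(1) in fastforce)
      \<comment> \<open>Freeness from \<open>A\<close> over \<open>C\<close> comes from
        \<open>p w\<close> not forking, freeness from the other components over \<open>A\<close>
        from the given system; transitivity joins them.\<close>
      with bA[OF sub(1)] have "dnf C (map b' vs) (C \<union> set (map b' us))" by (rule dnf_transitive[OF A CA])
      from dnf_Aut[OF this g(1)] show "dnf C (map b vs) (C \<union> set e)"
        unfolding gv us(2) Aut_image_Un[OF g(1) gv(2)] .
    qed
    then have "independent_family L M C w (\<lambda>i. x {i}) b" unfolding independent_family_def by blast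
    moreover have "b v \<in> acl L M (C \<union> (\<Union>i\<in>w. b ` x {i}))" if v: "v \<in> x w" for v
    proof -
      let ?U = "\<Union>i\<in>w. x {i}"
      have U: "(\<Union>i\<in>w. b' ` x {i}) = b' ` ?U" "(\<Union>i\<in>w. b ` x {i}) = b ` ?U" by auto
      have "b' v \<in> acl L M (A \<union> b' ` ?U)" using acl' v unfolding U by blast
      then obtain P where P: "Def (A \<union> b' ` ?U) 1 P" "finite {c. P [c]}" "P [b' v]"
        unfolding acl_iff_Def by blast
      obtain e R where e: "set e \<subseteq> b' ` ?U" "Def A (1 + length e) R"
        "\<And>x. length x = 1 \<Longrightarrow> P x \<longleftrightarrow> R (x @ e)" using Def_abstract[OF P(1)] by blast
      obtain us where us: "set us \<subseteq> ?U" "e = map b' us" using list_subset_image[OF e(1)] by blast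
      have "Def (A \<union> set e) 1 (\<lambda>x. R (x @ e))" by (rule Def_instance[OF e(2)]) auto
      then have P': "Def (A \<union> set (map b' us)) 1 P" unfolding us(2) by (rule Def_cong) (simp add: e(3) us(2))
      have sub: "set (v # us) \<subseteq> x w" using us(1) v xi by auto
      have "dnf C (b' v # map b' us) A" using bA[OF sub] by simp
      \<comment> \<open>The tuple free from \<open>A\<close> over \<open>C\<close> must include the
        algebraic element \<open>b' v\<close> along with \<open>b'\<close> on \<open>us\<close>,
        which is why both are taken from \<open>x w\<close>.\<close>
      from dnf_algebraic[OF A CA this P' P(2,3)] obtain Q where
        Q: "Def (C \<union> set (map b' us)) 1 Q" "finite {c. Q [c]}" "Q [b' v]" by blast
      obtain g where g: "g \<in> Aut C" "map g (map b' (v # us)) = map b (v # us)" using conj[OF sub] by blast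
      then have gv: "g (b' v) = b v" "map g (map b' us) = map b us" by simp_all
      have "g \<in> Aut {}" using g(1) by (rule Aut_mono) auto
      from Def_image_Aut[OF Q(1) this] have "Def (C \<union> set (map b us)) 1 (\<lambda>x. Q (map (inv g) x))"
        unfolding Aut_image_Un[OF g(1) gv(2)] .
      moreover have "C \<union> set (map b us) \<subseteq> C \<union> b ` ?U" using us(1) by auto
      ultimately have "Def (C \<union> b ` ?U) 1 (\<lambda>x. Q (map (inv g) x))" by (rule Def_mono)
      moreover have "{c. Q (map (inv g) [c])} \<subseteq> g ` {c. Q [c]}"
      proof
        fix c assume "c \<in> {c. Q (map (inv g) [c])}"
        then have "inv g c \<in> {c. Q [c]}" by simp
        then show "c \<in> g ` {c. Q [c]}" using Aut_inv_cancel(2)[OF g(1), of c] by (metis imageI)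
      qed
      then have "finite {c. Q (map (inv g) [c])}" using Q(2) finite_subset by blast
      moreover have "Q (map (inv g) [b v])" using Q(3) Aut_inv_cancel(1)[OF g(1), of "b' v"] gv(1) by simp
      ultimately show ?thesis unfolding U acl_iff_Def by blast
    qed
    ultimately show ?thesis by blast
  qed
  show ?thesis unfolding amalgamation_system_def
  proof (intro conjI)
    show "finite W" "\<forall>w\<in>W. \<forall>v\<subseteq>w. v \<in> W" "\<forall>v\<in>W. \<forall>w\<in>W. x v \<inter> x w = x (v \<inter> w)"
      by (fact W xint)+
  qed (use ct' ne' res' real' in simp_all)
qed

end

theorem lemma2p10:
  fixes L :: "('f, 'r, 'v :: infinite) language"
    and T :: "('f, 'r, 'v, 'a) fm set"
    and \<kappa> :: "'k rel"
    and M :: "('f, 'r, 'a) struc"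
    and A C :: "'a set"
    and W :: "nat set set"
    and x :: "nat set \<Rightarrow> 'v set"
    and p :: "nat set \<Rightarrow> ('f, 'r, 'v, 'a) fm set"
  assumes "complete_theory L T"
    and "simple_theory L T"
    and "monster_model L T \<kappa> M"
    and "|A| <o \<kappa>"
    and "\<And>w. w \<in> W \<Longrightarrow> |x w| <o \<kappa>"
    and "amalgamation_system L M A W x p"
    and "C \<subseteq> A"
    and "\<And>w. w \<in> W \<Longrightarrow> \<not> forks L M C (x w) (p w)"
  shows "amalgamation_system L M C W x (\<lambda>w. restrict_params C (p w))"
proof -
  \<comment> \<open>Simplicity is applied to \<open>M\<close> itself, as a model of
    \<open>T\<close>.\<close>
  interpret monster L M \<kappa>
    using assms(2,3) unfolding monster_model_def simple_theory_def by unfold_locales auto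
  show ?thesis using assms(4-8) by (rule amalgamation_system_restrict)
qed

end
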